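(* For each conjugacy class $\mathcal O$ of $\tilde W$ choose a minimal length representative $\tilde w_{\mathcal O}\in\mathcal O$. Then the images of $(T_{\tilde w_{\mathcal O}})_{\mathcal O}$, with $\mathcal O$ ranging over all conjugacy classes of $\tilde W$, form an $\mathcal A$-basis of the cocenter $\tilde H/[\tilde H,\tilde H]$. In particular, the polynomials $f_{\tilde w,\mathcal O}$ with $T_{\tilde w}\equiv\sum_{\mathcal O}f_{\tilde w,\mathcal O}T_{\tilde w_{\mathcal O}}\mod[\tilde H,\tilde H]$ are uniquely determined by $\tilde w$.
   Context: Setting: $W=Q\rtimes W_0$ affine Weyl group with simple reflections $S$; $\tilde W=P\rtimes(W_0\rtimes\Omega')=W\rtimes\Omega$ for a connected complex reductive group with coweight lattice $P$ and finite group $\Omega'$ of diagram automorphisms; $\ell$ the length on $\tilde W$ (number of affine root hyperplanes separating the fundamental alcove from its image). $\mathcal A=\mathbb Z[v,v^{-1}]$; $\tilde H$ is the $\mathcal A$-algebra with basis $\{T_w\}_{w\in\tilde W}$, $T_xT_y=T_{xy}$ when $\ell(xy)=\ell(x)+\ell(y)$, $(T_s-v)(T_s+v^{-1})=0$ for $s\in S$; $[\tilde H,\tilde H]$ is the $\mathcal A$-span of all commutators. *)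

theory Defs
  imports "HOL-Analysis.Analysis" "HOL-Library.Poly_Mapping"
begin

section \<open>Root datum data (X_* = Z^n inside R^n, X^* = Z^n via the dot product)\<close>

type_synonym 'n vec = "real ^ 'n"
type_synonym 'n amap = "'n vec \<Rightarrow> 'n vec"

definition lattice :: "'n::finite vec set" where
  "lattice = {x. \<forall>i. x $ i \<in> \<int>}"

text \<open>Reduced root datum: roots Phi (in X^* = Z^n, paired with X_* by the dot product),
  coroot map cor : Phi -> X_* (a bijection onto the coroots).\<close>
definition reduced_root_datum :: "'n::finite vec set \<Rightarrow> ('n vec \<Rightarrow> 'n vec) \<Rightarrow> bool" where
  "reduced_root_datum Phi cor \<longleftrightarrow>
     finite Phi \<and>
     (\<forall>a\<in>Phi. a \<in> lattice \<and> cor a \<in> lattice) \<and>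
     inj_on cor Phi \<and>
     (\<forall>a\<in>Phi. a \<bullet> cor a = 2) \<and>
     (\<forall>a\<in>Phi. \<forall>b\<in>Phi. b - (b \<bullet> cor a) *\<^sub>R a \<in> Phi) \<and>
     (\<forall>a\<in>Phi. \<forall>b\<in>Phi. cor b - (a \<bullet> cor b) *\<^sub>R cor a \<in> cor ` Phi) \<and>
     (\<forall>a\<in>Phi. \<forall>c. c *\<^sub>R a \<in> Phi \<longrightarrow> c = 1 \<or> c = -1)"

definition root_base :: "'n::finite vec set \<Rightarrow> 'n vec set \<Rightarrow> bool" where
  "root_base Phi Delta \<longleftrightarrow> Delta \<subseteq> Phi \<and> independent Delta \<and>
     (\<forall>a\<in>Phi. \<exists>c. (\<forall>d\<in>Delta. c d \<in> \<int>) \<and> a = (\<Sum>d\<in>Delta. c d *\<^sub>R d) \<and>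
        ((\<forall>d\<in>Delta. c d \<ge> 0) \<or> (\<forall>d\<in>Delta. c d \<le> 0)))"

definition pos_roots :: "'n::finite vec set \<Rightarrow> 'n vec set \<Rightarrow> 'n vec set" where
  "pos_roots Phi Delta = {a\<in>Phi. \<exists>c. (\<forall>d\<in>Delta. c d \<in> \<int> \<and> c d \<ge> 0) \<and> a = (\<Sum>d\<in>Delta. c d *\<^sub>R d)}"

definition diagram_aut_group ::
  "'n::finite vec set \<Rightarrow> ('n vec \<Rightarrow> 'n vec) \<Rightarrow> 'n vec set \<Rightarrow> 'n amap set \<Rightarrow> bool" where
  "diagram_aut_group Phi cor Delta D \<longleftrightarrow>
     finite D \<and> id \<in> D \<and> (\<forall>d\<in>D. \<forall>e\<in>D. d \<circ> e \<in> D) \<and> (\<forall>d\<in>D. \<exists>e\<in>D. d \<circ> e = id) \<and>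
     (\<forall>d\<in>D. linear d \<and> bij d \<and> d ` lattice = lattice \<and>
        (\<forall>a\<in>Phi. \<exists>b\<in>Phi. (\<forall>x. b \<bullet> d x = a \<bullet> x) \<and> cor b = d (cor a)) \<and>
        (\<forall>a\<in>Delta. \<exists>b\<in>Delta. (\<forall>x. b \<bullet> d x = a \<bullet> x)))"

definition sref :: "('n::finite vec \<Rightarrow> 'n vec) \<Rightarrow> 'n vec \<Rightarrow> 'n amap" where
  "sref cor a = (\<lambda>x. x - (a \<bullet> x) *\<^sub>R cor a)"

definition aref :: "('n::finite vec \<Rightarrow> 'n vec) \<Rightarrow> 'n vec \<Rightarrow> int \<Rightarrow> 'n amap" where
  "aref cor a k = (\<lambda>x. x - (a \<bullet> x - of_int k) *\<^sub>R cor a)"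

inductive_set W0 :: "'n::finite vec set \<Rightarrow> ('n vec \<Rightarrow> 'n vec) \<Rightarrow> 'n amap set"
  for Phi cor where
  W0_id: "id \<in> W0 Phi cor"
| W0_step: "w \<in> W0 Phi cor \<Longrightarrow> a \<in> Phi \<Longrightarrow> sref cor a \<circ> w \<in> W0 Phi cor"

text \<open>W~ = P \<rtimes> (W_0 \<rtimes> Omega'), realised as a group of affine maps of X_* (x) R
  (group law = composition).\<close>
definition ext_affine_weyl ::
  "'n::finite vec set \<Rightarrow> ('n vec \<Rightarrow> 'n vec) \<Rightarrow> 'n amap set \<Rightarrow> 'n amap set" where
  "ext_affine_weyl Phi cor D =
     {(\<lambda>x. w (d x) + p) | w d p. w \<in> W0 Phi cor \<and> d \<in> D \<and> p \<in> lattice}"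

definition fund_alcove :: "'n::finite vec set \<Rightarrow> 'n vec set \<Rightarrow> 'n vec set" where
  "fund_alcove Phi Delta = {x. \<forall>a\<in>pos_roots Phi Delta. 0 < a \<bullet> x \<and> a \<bullet> x < 1}"

text \<open>Length: number of affine root hyperplanes H_{a,k} = {a(x) = k} (a positive, k integer)
  separating the fundamental alcove A from w(A).\<close>
definition wlen :: "'n::finite vec set \<Rightarrow> 'n vec set \<Rightarrow> 'n amap \<Rightarrow> nat" where
  "wlen Phi Delta w = card {(a, k). a \<in> pos_roots Phi Delta \<and>
      (\<forall>x\<in>fund_alcove Phi Delta. (a \<bullet> x - of_int k) * (a \<bullet> w x - of_int k) < 0)}"

text \<open>Simple reflections S: the affine reflections of length one (reflections in the walls of A).\<close>
definition simple_refls ::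
  "'n::finite vec set \<Rightarrow> ('n vec \<Rightarrow> 'n vec) \<Rightarrow> 'n vec set \<Rightarrow> 'n amap set" where
  "simple_refls Phi cor Delta = {aref cor a k | a k. a \<in> Phi \<and> wlen Phi Delta (aref cor a k) = 1}"

definition conjugate_in :: "('a \<Rightarrow> 'a) set \<Rightarrow> ('a \<Rightarrow> 'a) \<Rightarrow> ('a \<Rightarrow> 'a) \<Rightarrow> bool" where
  "conjugate_in G x y \<longleftrightarrow> (\<exists>g\<in>G. g \<circ> x = y \<circ> g)"

type_synonym laurent = "int \<Rightarrow>\<^sub>0 int"

text \<open>A = Z[v, v^-1] realised as the group ring Z[Z]; v is the basis element at 1.\<close>
definition lv :: laurent where "lv = Poly_Mapping.single 1 1"
definition lv_inv :: laurent where "lv_inv = Poly_Mapping.single (-1) 1"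

definition A_algebra :: "(laurent \<Rightarrow> 'h::ring_1 \<Rightarrow> 'h) \<Rightarrow> bool" where
  "A_algebra sc \<longleftrightarrow> module sc \<and>
     (\<forall>c x y. sc c (x * y) = sc c x * y \<and> sc c (x * y) = x * sc c y)"

definition is_hecke_algebra ::
  "'n::finite vec set \<Rightarrow> ('n vec \<Rightarrow> 'n vec) \<Rightarrow> 'n vec set \<Rightarrow> 'n amap set \<Rightarrow>
   (laurent \<Rightarrow> 'h::ring_1 \<Rightarrow> 'h) \<Rightarrow> ('n amap \<Rightarrow> 'h) \<Rightarrow> bool" where
  "is_hecke_algebra Phi cor Delta D sc T \<longleftrightarrow>
     (let Wt = ext_affine_weyl Phi cor D; l = wlen Phi Delta in
       A_algebra sc \<and>
       inj_on T Wt \<and> module.independent sc (T ` Wt) \<and> module.span sc (T ` Wt) = UNIV \<and>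
       (\<forall>x\<in>Wt. \<forall>y\<in>Wt. l (x \<circ> y) = l x + l y \<longrightarrow> T x * T y = T (x \<circ> y)) \<and>
       (\<forall>s\<in>simple_refls Phi cor Delta. (T s - sc lv 1) * (T s + sc lv_inv 1) = 0))"

definition commutator_span :: "(laurent \<Rightarrow> 'h::ring_1 \<Rightarrow> 'h) \<Rightarrow> 'h set" where
  "commutator_span sc = module.span sc {a * b - b * a | a b. True}"

end

theory Submission
  imports Defs
begin

text \<open>
  Every \<open>T\<^sub>w\<close> is read off the hyperplane arrangement: a conjugate of \<open>w\<close> corresponds to an alcove
  \<open>C\<close>, its length being the number of hyperplanes that separate \<open>C\<close> from \<open>w C\<close>.

  Spanning. Let \<open>w\<close> translate its axis by \<open>\<nu>\<close> and split the linear part of \<open>w\<close> into rotations by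
  angles \<open>0 = \<theta>\<^sub>0 < \<dots> < \<theta>\<^sub>r = \<pi>\<close>; let \<open>F\<^sub>i\<close> be the affine subspace through the axis spanned by the
  rotation spaces of the first angles. Shrinking the components outside \<open>F\<^sub>i\<close> follows the descent
  direction \<open>w q + w\<^sup>-\<^sup>1 q - 2 q\<close>, so no wall crossing on the way increases the length; hence every
  alcove reduces to a good one, whose closure meets every \<open>F\<^sub>i\<close> in a regular point. Two good alcoves
  are joined by crossing panels of the \<open>F\<^sub>i\<close>; each crossing is a length-additive conjugation (or, for
  angle \<open>\<pi>\<close>, a reflection commuting with \<open>w\<close>), so all good alcoves give the same length and the same
  class in the cocenter.

  Independence. Put \<open>\<pi> = v - 1\<close>. Modulo \<open>\<pi>\<close> the algebra is the group ring, whose cocenter has the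
  conjugacy classes as a basis, so it suffices that the cocenter has no \<open>\<pi>\<close>-torsion up to integers.
  The obstruction is, for each \<open>w\<close>, an additive character of the centralizer of \<open>w\<close>. It is torsion-free
  valued, hence determined by translations \<open>t\<^sub>\<lambda>\<close> commuting with \<open>w\<close>, and for dominant \<open>\<lambda>\<close> it vanishes
  because \<open>t\<^sub>\<mu> u\<close> commuting with \<open>t\<^sub>\<lambda>\<close> lifts to \<open>T\<^bsub>\<mu>\<^sub>1\<^esub> T\<^bsub>\<mu>\<^sub>2\<^esub>\<^sup>-\<^sup>1 T\<^sub>u\<close>, which commutes exactly with \<open>T\<^sub>\<lambda>\<close>.
\<close>

section \<open>Root data and the extended affine Weyl group\<close>

text \<open>The dot product need not be invariant under the group, so the rotation parts of a linear
  part cannot be taken from an orthogonal diagonalisation. They come from averaging over the cyclic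
  group that it generates, with cosines as weights, and distance to a subspace is measured component
  by component.

  For independence, a relation makes its coefficients divisible by v - 1, but dividing the relation
  is not allowed while torsion is possible. The way out is to fix, for each \<open>w\<close>, one
  commutator lifting \<open>w\<close> minus its representative. Modulo v - 1, the lifts for
  \<open>w\<close> outside the representatives form a basis together with the representatives. Once
  every commutator is known to be, up to an integer factor, a combination of these lifts plus v - 1
  times another commutator, this can be applied again to the remainder. So each coefficient of a
  relation is divisible by all powers of v - 1 up to integers, hence is 0. That the obstruction is
  additive comes from the identity [ab, c] = [a, bc] + [b, ca].\<close>

locale root_setting =
  fixes Phi Delta :: "'n::finite vec set"
    and cor :: "'n vec \<Rightarrow> 'n vec"
    and D :: "'n amap set"
  assumes datum: "reduced_root_datum Phi cor"
    and base: "root_base Phi Delta"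
    and auts: "diagram_aut_group Phi cor Delta D"
begin

abbreviation Pos :: "'n vec set" where "Pos \<equiv> pos_roots Phi Delta"
abbreviation G :: "'n amap set" where "G \<equiv> ext_affine_weyl Phi cor D"
abbreviation len :: "'n amap \<Rightarrow> nat" where "len \<equiv> wlen Phi Delta"

lemma finite_Phi: "finite Phi"
  and root_lattice: "a \<in> Phi \<Longrightarrow> a \<in> lattice"
  and cor_lattice: "a \<in> Phi \<Longrightarrow> cor a \<in> lattice"
  and root_cor: "a \<in> Phi \<Longrightarrow> a \<bullet> cor a = 2"
  and root_reflect: "\<lbrakk>a \<in> Phi; b \<in> Phi\<rbrakk> \<Longrightarrow> b - (b \<bullet> cor a) *\<^sub>R a \<in> Phi"
  and cor_reflect_image: "\<lbrakk>a \<in> Phi; b \<in> Phi\<rbrakk> \<Longrightarrow> cor b - (a \<bullet> cor b) *\<^sub>R cor a \<in> cor ` Phi"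
  and root_multiple: "\<lbrakk>a \<in> Phi; t *\<^sub>R a \<in> Phi\<rbrakk> \<Longrightarrow> t = 1 \<or> t = -1"
  using datum by (auto simp: reduced_root_datum_def)

lemma root_nonzero: "a \<in> Phi \<Longrightarrow> a \<noteq> 0"
  using root_cor by fastforce

lemma root_uminus: "a \<in> Phi \<Longrightarrow> - a \<in> Phi"
  using root_reflect[of a a] root_cor[of a] by (simp add: scaleR_2)

lemma Pos_subset: "Pos \<subseteq> Phi" and finite_Pos: "finite Pos"
  using finite_Phi by (auto simp: pos_roots_def)

lemma lattice_inner: "\<lbrakk>x \<in> lattice; y \<in> lattice\<rbrakk> \<Longrightarrow> x \<bullet> y \<in> \<int>"
  by (auto simp: lattice_def inner_vec_def intro!: Ints_sum Ints_mult)

lemma lattice_add: "\<lbrakk>x \<in> lattice; y \<in> lattice\<rbrakk> \<Longrightarrow> x + y \<in> lattice"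
  and lattice_diff: "\<lbrakk>x \<in> lattice; y \<in> lattice\<rbrakk> \<Longrightarrow> x - y \<in> lattice"
  and lattice_uminus: "x \<in> lattice \<Longrightarrow> - x \<in> lattice"
  and lattice_zero: "0 \<in> lattice"
  and lattice_scale: "\<lbrakk>x \<in> lattice; t \<in> \<int>\<rbrakk> \<Longrightarrow> t *\<^sub>R x \<in> lattice"
  for x y :: "'n vec"
  by (auto simp: lattice_def)

lemma Pos_or_neg: "a \<in> Phi \<Longrightarrow> a \<in> Pos \<or> - a \<in> Pos"
proof -
  assume a: "a \<in> Phi"
  then obtain c where c: "\<forall>d\<in>Delta. c d \<in> \<int>" "a = (\<Sum>d\<in>Delta. c d *\<^sub>R d)"
    "(\<forall>d\<in>Delta. c d \<ge> 0) \<or> (\<forall>d\<in>Delta. c d \<le> 0)"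
    using base unfolding root_base_def by blast
  show ?thesis
  proof (cases "\<forall>d\<in>Delta. c d \<ge> 0")
    case True
    then show ?thesis using a c by (auto simp: pos_roots_def)
  next
    case False
    with c have "\<forall>d\<in>Delta. - c d \<ge> 0" by auto
    moreover have "- a = (\<Sum>d\<in>Delta. (- c d) *\<^sub>R d)"
      using c(2) by (simp add: sum_negf)
    ultimately show ?thesis
      using c(1) root_uminus[OF a] unfolding pos_roots_def
      by (intro disjI2) (auto intro!: exI[of _ "\<lambda>d. - c d"])
  qed
qed

text \<open>A functional equal to 1 on the independent set \<open>Delta\<close> sends a positive
  root to its height, which is positive because a root is not 0; \<open>c\<close> represents that
  functional.\<close>

lemma positive_functional:
  obtains c where "\<And>a. a \<in> Pos \<Longrightarrow> 0 < a \<bullet> c"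
proof -
  have ind: "independent Delta" and sub: "Delta \<subseteq> Phi"
    using base by (auto simp: root_base_def)
  obtain f :: "'n vec \<Rightarrow> real" where f: "linear f" "\<forall>d\<in>Delta. f d = 1"
    using linear_independent_extend[OF ind, of "\<lambda>_. 1"] by auto
  define c where "c = adjoint f 1"
  have fc: "x \<bullet> c = f x" for x
    using adjoint_works[OF f(1), of x 1] by (simp add: c_def inner_real_def)
  have "0 < a \<bullet> c" if a: "a \<in> Pos" for a
  proof -
    obtain e where e: "\<forall>d\<in>Delta. e d \<in> \<int> \<and> e d \<ge> 0" "a = (\<Sum>d\<in>Delta. e d *\<^sub>R d)"
      using a by (auto simp: pos_roots_def)
    have fa: "a \<bullet> c = (\<Sum>d\<in>Delta. e d)"
      using f by (simp add: fc e(2) linear_sum linear_scale)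
    have fin: "finite Delta" using sub finite_Phi finite_subset by blast
    have "a \<noteq> 0" using a Pos_subset root_nonzero by auto
    have "\<exists>d\<in>Delta. e d \<noteq> 0"
    proof (rule ccontr)
      assume "\<not> ?thesis"
      then have "a = 0" unfolding e(2) by (intro sum.neutral) simp
      with \<open>a \<noteq> 0\<close> show False ..
    qed
    then obtain d where d: "d \<in> Delta" "e d \<noteq> 0" ..
    then have "e d > 0" using e(1) by force
    then have "(\<Sum>d\<in>Delta. e d) > 0"
      using e(1) by (intro sum_pos2[OF fin d(1)]) auto
    then show ?thesis using fa by simp
  qed
  then show thesis using that by blast
qed

lemma Pos_not_neg: "a \<in> Pos \<Longrightarrow> - a \<notin> Pos"
proof
  assume a: "a \<in> Pos" "- a \<in> Pos"
  obtain c where "\<And>a. a \<in> Pos \<Longrightarrow> 0 < a \<bullet> c" using positive_functional by blast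
  from this[OF a(1)] this[OF a(2)] show False by simp
qed

lemma alcove_nonempty: "\<exists>c. c \<in> fund_alcove Phi Delta"
proof -
  obtain c where c: "\<And>a. a \<in> Pos \<Longrightarrow> 0 < a \<bullet> c" using positive_functional by blast
  define M where "M = 1 + (\<Sum>a\<in>Pos. a \<bullet> c)"
  have le: "a \<bullet> c \<le> (\<Sum>a\<in>Pos. a \<bullet> c)" if "a \<in> Pos" for a
    using member_le_sum[OF that _ finite_Pos, of "\<lambda>a. a \<bullet> c"] c by (simp add: less_imp_le)
  have M: "M > 0" unfolding M_def
    using sum_nonneg[of Pos "\<lambda>a. a \<bullet> c"] c by (simp add: less_imp_le add_pos_nonneg)
  have "(1 / M) *\<^sub>R c \<in> fund_alcove Phi Delta"
    using M c le by (fastforce simp: fund_alcove_def M_def field_simps)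
  then show ?thesis by blast
qed

definition base_pt :: "'n vec" where
  "base_pt = (SOME c. c \<in> fund_alcove Phi Delta)"

lemma base_pt_alcove: "base_pt \<in> fund_alcove Phi Delta"
  unfolding base_pt_def using alcove_nonempty by (rule someI_ex)

lemma base_pt_bounds: "a \<in> Pos \<Longrightarrow> 0 < a \<bullet> base_pt \<and> a \<bullet> base_pt < 1"
  using base_pt_alcove by (auto simp: fund_alcove_def)

text \<open>The datum only says that the reflected coroot \<open>f\<close> is the coroot of some
  root \<open>c\<close>; the point is that \<open>c\<close> is the reflected root \<open>b'\<close>.
  Both \<open>b'\<close> and \<open>c\<close> pair to 2 with \<open>f\<close>, and both reflections
  along \<open>f\<close> preserve \<open>Phi\<close>. Their composite adds a multiple of
  \<open>c - b'\<close>, so repeating it would give infinitely many roots unless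
  \<open>c = b'\<close>.\<close>

lemma cor_reflect:
  assumes a: "a \<in> Phi" and b: "b \<in> Phi"
  shows "cor (b - (b \<bullet> cor a) *\<^sub>R a) = cor b - (a \<bullet> cor b) *\<^sub>R cor a"
proof -
  define s where "s a y = y - (y \<bullet> cor a) *\<^sub>R a" for a y
  define b' where "b' = s a b"
  define f where "f = cor b - (a \<bullet> cor b) *\<^sub>R cor a"
  have sP: "s a y \<in> Phi" if "a \<in> Phi" "y \<in> Phi" for a y
    using root_reflect that by (simp add: s_def)
  obtain c where c: "c \<in> Phi" "f = cor c"
    using cor_reflect_image[OF a b] by (auto simp: f_def)
  have ff: "y \<bullet> f = s a y \<bullet> cor b" for y
    by (simp add: f_def s_def inner_diff_left inner_diff_right)
  have ss: "s a (s a y) = y" for y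
    using root_cor[OF a] by (simp add: s_def inner_diff_left scaleR_diff_left algebra_simps)
  \<comment> \<open>The reflection of \<open>b\<close>, conjugated by that of \<open>a\<close>, is
    the reflection with root \<open>b'\<close> and coroot \<open>f\<close>.\<close>
  have "s a (s b (s a y)) = y - (y \<bullet> f) *\<^sub>R b'" for y
  proof -
    have lin: "s a (u - t *\<^sub>R z) = s a u - t *\<^sub>R s a z" for u z t
      by (simp add: s_def inner_diff_left algebra_simps)
    have "s a (s b (s a y)) = s a (s a y) - (s a y \<bullet> cor b) *\<^sub>R s a b"
      unfolding s_def[of b] by (rule lin)
    then show ?thesis by (simp add: ss ff b'_def)
  qed
  then have rb: "y - (y \<bullet> f) *\<^sub>R b' \<in> Phi" if "y \<in> Phi" for y
    using that sP a b by metis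
  have rc: "y - (y \<bullet> f) *\<^sub>R c \<in> Phi" if "y \<in> Phi" for y
    using that c root_reflect by metis
  have fb: "b' \<bullet> f = 2" using ff[of b'] ss root_cor[OF b] by (simp add: b'_def)
  have fc: "c \<bullet> f = 2" using c root_cor by simp
  have step: "y + (y \<bullet> f) *\<^sub>R (c - b') \<in> Phi" if "y \<in> Phi" for y
    using rc[OF rb[OF that]] fb by (simp add: inner_diff_left algebra_simps)
  \<comment> \<open>Pairing with \<open>f\<close> remains 2 along the orbit, hence the constant step
    of twice \<open>c - b'\<close>.\<close>
  have "b' + (2 * real n) *\<^sub>R (c - b') \<in> Phi" for n
  proof (induction n)
    case 0
    then show ?case using sP a b by (simp add: b'_def)
  next
    case (Suc n)
    have "(b' + (2 * real n) *\<^sub>R (c - b')) \<bullet> f = 2"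
      using fb fc by (simp add: inner_add_left inner_diff_left)
    then show ?case using step[OF Suc] by (simp add: algebra_simps)
  qed
  then have "range (\<lambda>n. b' + (2 * real n) *\<^sub>R (c - b')) \<subseteq> Phi" by blast
  then have "finite (range (\<lambda>n. b' + (2 * real n) *\<^sub>R (c - b')))"
    using finite_Phi finite_subset by blast
  then have "\<not> inj (\<lambda>n. b' + (2 * real n) *\<^sub>R (c - b'))"
    using finite_imageD by blast
  then have "c = b'" by (auto simp: inj_def)
  then show ?thesis using c by (simp add: b'_def s_def f_def)
qed

lemma cor_uminus: "a \<in> Phi \<Longrightarrow> cor (- a) = - cor a"
  using cor_reflect[of a a] root_cor[of a] by (simp add: scaleR_2)

section \<open>The linear parts and the group of affine maps\<close>

lemma sref_linear: "linear (sref cor a)"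
  by (rule linearI) (simp_all add: sref_def inner_add_right algebra_simps)

lemma sref_sref: "a \<in> Phi \<Longrightarrow> sref cor a (sref cor a x) = x"
  using root_cor[of a] by (simp add: sref_def inner_diff_right algebra_simps)

lemma sref_pull: "b \<bullet> sref cor a x = (b - (b \<bullet> cor a) *\<^sub>R a) \<bullet> x"
  by (simp add: sref_def inner_diff_right inner_diff_left algebra_simps)

lemma sref_lattice: "\<lbrakk>a \<in> Phi; x \<in> lattice\<rbrakk> \<Longrightarrow> sref cor a x \<in> lattice"
  unfolding sref_def
  by (meson lattice_diff lattice_scale cor_lattice lattice_inner root_lattice)

lemma sref_W0: "a \<in> Phi \<Longrightarrow> sref cor a \<in> W0 Phi cor"
  using W0_step[OF W0_id] by fastforce

lemma W0_comp: "\<lbrakk>u \<in> W0 Phi cor; w \<in> W0 Phi cor\<rbrakk> \<Longrightarrow> u \<circ> w \<in> W0 Phi cor"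
  by (induction rule: W0.induct) (auto simp: comp_assoc intro: W0_step)

lemma W0_inverse: "w \<in> W0 Phi cor \<Longrightarrow> \<exists>u\<in>W0 Phi cor. u \<circ> w = id \<and> w \<circ> u = id"
proof (induction rule: W0.induct)
  case W0_id
  show ?case using W0.W0_id[of Phi cor] by (intro bexI[of _ id]) simp_all
next
  case (W0_step w a)
  then obtain u where u: "u \<in> W0 Phi cor" "u \<circ> w = id" "w \<circ> u = id" by blast
  have "(u \<circ> sref cor a) \<circ> (sref cor a \<circ> w) = id" "(sref cor a \<circ> w) \<circ> (u \<circ> sref cor a) = id"
    using u(2,3) sref_sref[OF W0_step(2)] by (auto simp: fun_eq_iff)
  then show ?case using W0_comp[OF u(1) sref_W0[OF W0_step(2)]] by blast
qed

text \<open>Roots are pulled back along \<open>g\<close> and coroots pushed forward. In this form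
  the condition composes, and it holds for \<open>W0\<close> and \<open>D\<close> alike.\<close>

definition admissible :: "'n amap \<Rightarrow> bool" where
  "admissible g \<longleftrightarrow> linear g \<and> bij g \<and> (\<forall>x\<in>lattice. g x \<in> lattice) \<and>
     (\<forall>a\<in>Phi. \<exists>b\<in>Phi. (\<forall>x. a \<bullet> g x = b \<bullet> x) \<and> g (cor b) = cor a)"

lemma admissible_sref: "a \<in> Phi \<Longrightarrow> admissible (sref cor a)"
  unfolding admissible_def
proof (intro conjI ballI)
  assume a: "a \<in> Phi"
  show "linear (sref cor a)" by (rule sref_linear)
  show "bij (sref cor a)" using sref_sref[OF a] by (metis involuntory_imp_bij)
  show "sref cor a x \<in> lattice" if "x \<in> lattice" for x using sref_lattice[OF a that] .
  fix b assume b: "b \<in> Phi"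
  have "sref cor a (cor (b - (b \<bullet> cor a) *\<^sub>R a)) = cor b"
  proof -
    have "cor (b - (b \<bullet> cor a) *\<^sub>R a) = sref cor a (cor b)"
      using cor_reflect[OF a b] by (simp add: sref_def)
    then show ?thesis using sref_sref[OF a] by simp
  qed
  then show "\<exists>c\<in>Phi. (\<forall>x. b \<bullet> sref cor a x = c \<bullet> x) \<and> sref cor a (cor c) = cor b"
    using root_reflect[OF a b] sref_pull by blast
qed

lemma admissible_comp: "\<lbrakk>admissible g; admissible k\<rbrakk> \<Longrightarrow> admissible (g \<circ> k)"
  unfolding admissible_def
proof (elim conjE, intro conjI ballI)
  assume g: "\<forall>a\<in>Phi. \<exists>b\<in>Phi. (\<forall>x. a \<bullet> g x = b \<bullet> x) \<and> g (cor b) = cor a"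
    and k: "\<forall>a\<in>Phi. \<exists>b\<in>Phi. (\<forall>x. a \<bullet> k x = b \<bullet> x) \<and> k (cor b) = cor a"
  fix a assume "a \<in> Phi"
  then obtain b where b: "b \<in> Phi" "\<forall>x. a \<bullet> g x = b \<bullet> x" "g (cor b) = cor a" using g by blast
  obtain c where c: "c \<in> Phi" "\<forall>x. b \<bullet> k x = c \<bullet> x" "k (cor c) = cor b" using k b(1) by blast
  show "\<exists>c\<in>Phi. (\<forall>x. a \<bullet> (g \<circ> k) x = c \<bullet> x) \<and> (g \<circ> k) (cor c) = cor a"
    using b c by (intro bexI[of _ c]) auto
qed (auto intro: linear_compose bij_comp)

lemma admissible_id: "admissible id"
  unfolding admissible_def by (auto simp: module_hom_ident[unfolded id_def[symmetric]] linear_id)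

lemma admissible_W0: "w \<in> W0 Phi cor \<Longrightarrow> admissible w"
proof (induction rule: W0.induct)
  case W0_id
  show ?case by (rule admissible_id)
next
  case (W0_step w a)
  then show ?case by (intro admissible_comp admissible_sref)
qed

lemma D_inverse: "d \<in> D \<Longrightarrow> \<exists>e\<in>D. e \<circ> d = id \<and> d \<circ> e = id"
proof -
  assume d: "d \<in> D"
  then obtain e where e: "e \<in> D" "d \<circ> e = id" using auts by (auto simp: diagram_aut_group_def)
  then obtain f where f: "f \<in> D" "e \<circ> f = id" using auts by (auto simp: diagram_aut_group_def)
  have "d = f" using e f by (metis comp_assoc comp_id id_comp)
  then show ?thesis using e f by blast
qed

lemma finite_D: "finite D" and D_id: "id \<in> D" and D_comp: "\<lbrakk>d \<in> D; e \<in> D\<rbrakk> \<Longrightarrow> d \<circ> e \<in> D"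
  using auts by (auto simp: diagram_aut_group_def)

lemma D_root: "\<lbrakk>d \<in> D; a \<in> Phi\<rbrakk> \<Longrightarrow> \<exists>b\<in>Phi. (\<forall>x. b \<bullet> d x = a \<bullet> x) \<and> cor b = d (cor a)"
  using auts by (auto simp: diagram_aut_group_def)

text \<open>\<open>D\<close> is given by its forward action on roots, while
  \<open>admissible\<close> asks for the pull-back; the inverse \<open>e\<close>, again in
  \<open>D\<close>, exchanges the two.\<close>

lemma admissible_D: "d \<in> D \<Longrightarrow> admissible d"
  unfolding admissible_def
proof (intro conjI ballI)
  assume d: "d \<in> D"
  show "linear d" "bij d" using auts d by (auto simp: diagram_aut_group_def)
  have "d ` lattice = lattice" using auts d by (auto simp: diagram_aut_group_def)
  then show "\<And>x. x \<in> lattice \<Longrightarrow> d x \<in> lattice" by blast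
  obtain e where e: "e \<in> D" "e \<circ> d = id" "d \<circ> e = id" using D_inverse[OF d] by blast
  fix a assume "a \<in> Phi"
  then obtain b where b: "b \<in> Phi" "\<forall>x. b \<bullet> e x = a \<bullet> x" "cor b = e (cor a)"
    using D_root[OF e(1)] by blast
  have "b \<bullet> x = a \<bullet> d x" for x using b(2) e(2) by (metis comp_apply id_apply)
  moreover have "d (cor b) = cor a" using b(3) e(3) by (metis comp_apply id_apply)
  ultimately show "\<exists>b\<in>Phi. (\<forall>x. a \<bullet> d x = b \<bullet> x) \<and> d (cor b) = cor a"
    using b(1) by (intro bexI[of _ b]) auto
qed

text \<open>Conjugation by a diagram automorphism carries the reflection of a root to that of its
  image root.\<close>

lemma D_normalizes: "w \<in> W0 Phi cor \<Longrightarrow> d \<in> D \<Longrightarrow> \<exists>u\<in>W0 Phi cor. d \<circ> w = u \<circ> d"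
proof (induction rule: W0.induct)
  case W0_id
  show ?case using W0.W0_id[of Phi cor] by (intro bexI[of _ id]) simp_all
next
  case (W0_step w a)
  then obtain u where u: "u \<in> W0 Phi cor" "d \<circ> w = u \<circ> d" by blast
  obtain b where b: "b \<in> Phi" "\<forall>x. b \<bullet> d x = a \<bullet> x" "cor b = d (cor a)"
    using D_root W0_step by blast
  have lin: "linear d" using admissible_D[OF W0_step(4)] by (simp add: admissible_def)
  have "d \<circ> sref cor a = sref cor b \<circ> d"
    using b by (auto simp: fun_eq_iff sref_def linear_diff[OF lin] linear_scale[OF lin])
  then have "d \<circ> (sref cor a \<circ> w) = (sref cor b \<circ> u) \<circ> d"
    using u(2) by (metis comp_assoc)
  then show ?case using W0.W0_step[OF u(1) b(1)] by blast
qed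

definition Lin :: "'n amap set" where
  "Lin = {w \<circ> d | w d. w \<in> W0 Phi cor \<and> d \<in> D}"

lemma LinI: "\<lbrakk>w \<in> W0 Phi cor; d \<in> D\<rbrakk> \<Longrightarrow> w \<circ> d \<in> Lin"
  by (auto simp: Lin_def)

lemma W0_Lin: "w \<in> W0 Phi cor \<Longrightarrow> w \<in> Lin"
  using LinI[of w id] D_id by simp

lemma Lin_id: "id \<in> Lin"
  by (intro W0_Lin W0_id)

lemma Lin_comp: "\<lbrakk>g \<in> Lin; k \<in> Lin\<rbrakk> \<Longrightarrow> g \<circ> k \<in> Lin"
proof -
  assume "g \<in> Lin" "k \<in> Lin"
  then obtain w d u e where *: "g = w \<circ> d" "k = u \<circ> e" "w \<in> W0 Phi cor" "u \<in> W0 Phi cor" "d \<in> D" "e \<in> D"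
    by (auto simp: Lin_def)
  obtain u' where u': "u' \<in> W0 Phi cor" "d \<circ> u = u' \<circ> d" using D_normalizes * by blast
  have "g \<circ> k = (w \<circ> u') \<circ> (d \<circ> e)" using * u' by (metis comp_assoc)
  then show ?thesis using * u' W0_comp D_comp LinI by metis
qed

lemma Lin_inverse: "g \<in> Lin \<Longrightarrow> \<exists>k\<in>Lin. k \<circ> g = id \<and> g \<circ> k = id"
proof -
  assume "g \<in> Lin"
  then obtain w d where *: "g = w \<circ> d" "w \<in> W0 Phi cor" "d \<in> D" by (auto simp: Lin_def)
  obtain u where u: "u \<in> W0 Phi cor" "u \<circ> w = id" "w \<circ> u = id" using W0_inverse * by blast
  obtain e where e: "e \<in> D" "e \<circ> d = id" "d \<circ> e = id" using D_inverse * by blast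
  have "(e \<circ> u) \<circ> g = id" "g \<circ> (e \<circ> u) = id"
    using u e * by (metis comp_assoc comp_id id_comp)+
  moreover have "e \<circ> u \<in> Lin"
    using Lin_comp[of "id \<circ> e" "u \<circ> id"] LinI[OF W0_id e(1)] LinI[OF u(1) D_id] by simp
  ultimately show ?thesis by blast
qed

lemma Lin_admissible: "g \<in> Lin \<Longrightarrow> admissible g"
  by (auto simp: Lin_def intro: admissible_comp admissible_W0 admissible_D)

lemma Lin_linear: "g \<in> Lin \<Longrightarrow> linear g"
  and Lin_lattice: "\<lbrakk>g \<in> Lin; x \<in> lattice\<rbrakk> \<Longrightarrow> g x \<in> lattice"
  and Lin_root: "\<lbrakk>g \<in> Lin; a \<in> Phi\<rbrakk> \<Longrightarrow> \<exists>b\<in>Phi. (\<forall>x. a \<bullet> g x = b \<bullet> x) \<and> g (cor b) = cor a"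
  using Lin_admissible by (auto simp: admissible_def)

lemma G_iff: "g \<in> G \<longleftrightarrow> (\<exists>l\<in>Lin. \<exists>p\<in>lattice. g = (\<lambda>x. l x + p))"
  unfolding ext_affine_weyl_def Lin_def by (auto simp: comp_def)

lemma GI: "\<lbrakk>l \<in> Lin; p \<in> lattice\<rbrakk> \<Longrightarrow> (\<lambda>x. l x + p) \<in> G"
  by (auto simp: G_iff)

lemma Lin_G: "l \<in> Lin \<Longrightarrow> l \<in> G"
  using GI[OF _ lattice_zero] by simp

lemma G_id: "id \<in> G"
  by (rule Lin_G[OF Lin_id])

lemma G_comp: "\<lbrakk>g \<in> G; k \<in> G\<rbrakk> \<Longrightarrow> g \<circ> k \<in> G"
proof -
  assume "g \<in> G" "k \<in> G"
  then obtain l p m q where *: "l \<in> Lin" "p \<in> lattice" "g = (\<lambda>x. l x + p)" "m \<in> Lin" "q \<in> lattice" "k = (\<lambda>x. m x + q)"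
    by (auto simp: G_iff)
  have "g \<circ> k = (\<lambda>x. (l \<circ> m) x + (l q + p))"
    using *(3,6) linear_add[OF Lin_linear[OF *(1)]] by (simp add: fun_eq_iff)
  then show ?thesis
    using GI[OF Lin_comp[OF *(1,4)] lattice_add[OF Lin_lattice[OF *(1,5)] *(2)]] by simp
qed

lemma G_inverse_ex: "g \<in> G \<Longrightarrow> \<exists>k\<in>G. k \<circ> g = id \<and> g \<circ> k = id"
proof -
  assume "g \<in> G"
  then obtain l p where *: "l \<in> Lin" "p \<in> lattice" "g = (\<lambda>x. l x + p)" by (auto simp: G_iff)
  obtain m where m: "m \<in> Lin" "m \<circ> l = id" "l \<circ> m = id" using Lin_inverse * by blast
  have ml: "m (l x) = x" "l (m x) = x" for x using m(2,3) by (metis comp_apply id_apply)+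
  define k where "k = (\<lambda>x. m x + - m p)"
  have "k (g x) = x" for x
    unfolding k_def *(3) linear_add[OF Lin_linear[OF m(1)]] ml by simp
  moreover have "g (k x) = x" for x
    unfolding k_def *(3) linear_add[OF Lin_linear[OF *(1)]] linear_neg[OF Lin_linear[OF *(1)]] ml by simp
  moreover have "k \<in> G"
    unfolding k_def by (rule GI[OF m(1) lattice_uminus[OF Lin_lattice[OF m(1) *(2)]]])
  ultimately show ?thesis by (intro bexI[of _ k]) (simp_all add: fun_eq_iff)
qed

lemma G_bij: "g \<in> G \<Longrightarrow> bij g"
  using G_inverse_ex[of g] o_bij[of _ g] by metis

lemma G_inv: "g \<in> G \<Longrightarrow> inv g \<in> G"
  using G_inverse_ex inv_unique_comp by metis

lemma G_inv_comp: "g \<in> G \<Longrightarrow> inv g \<circ> g = id" "g \<in> G \<Longrightarrow> g \<circ> inv g = id"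
  using G_bij[of g] surj_iff[of g] by (auto dest: bij_is_inj bij_is_surj)

lemma G_inv_apply [simp]: "g \<in> G \<Longrightarrow> inv g (g x) = x" "g \<in> G \<Longrightarrow> g (inv g x) = x"
  by (simp_all add: G_bij bij_is_inj bij_is_surj surj_f_inv_f)

lemma G_inv_inv [simp]: "g \<in> G \<Longrightarrow> inv (inv g) = g"
  by (simp add: G_bij inv_inv_eq)

lemma inv_comp: "\<lbrakk>g \<in> G; k \<in> G\<rbrakk> \<Longrightarrow> inv (g \<circ> k) = inv k \<circ> inv g"
  by (simp add: G_bij o_inv_distrib)

lemma G_inv_comp_cancel: "g \<in> G \<Longrightarrow> inv g \<circ> (g \<circ> k) = k" "g \<in> G \<Longrightarrow> g \<circ> (inv g \<circ> k) = k"
  by (simp_all add: fun_eq_iff)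

lemma G_cancel_left: "g \<in> G \<Longrightarrow> g \<circ> k = g \<circ> l \<longleftrightarrow> k = l"
  using G_inv_comp_cancel by metis

lemma aref_G: "a \<in> Phi \<Longrightarrow> aref cor a k \<in> G"
proof -
  assume a: "a \<in> Phi"
  have "aref cor a k = (\<lambda>x. sref cor a x + of_int k *\<^sub>R cor a)"
    by (auto simp: aref_def sref_def fun_eq_iff algebra_simps)
  then show ?thesis
    using GI[OF W0_Lin[OF sref_W0[OF a]] lattice_scale[OF cor_lattice[OF a], of "of_int k"]] by simp
qed

definition trans :: "'n vec \<Rightarrow> 'n amap" where "trans p = (\<lambda>x. x + p)"

lemma trans_G: "p \<in> lattice \<Longrightarrow> trans p \<in> G"
  using GI[OF Lin_id] by (simp add: trans_def)

lemma aref_conj: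
  assumes g: "g \<in> G" and a: "a \<in> Phi"
  obtains b j where "b \<in> Phi" "inv g \<circ> aref cor a k \<circ> g = aref cor b j"
proof -
  obtain l p where *: "l \<in> Lin" "p \<in> lattice" "g = (\<lambda>x. l x + p)" using g by (auto simp: G_iff)
  obtain b where b: "b \<in> Phi" "\<forall>x. a \<bullet> l x = b \<bullet> x" "l (cor b) = cor a" using Lin_root * a by blast
  have "a \<bullet> p \<in> \<int>" using lattice_inner root_lattice a * by blast
  then obtain m where m: "a \<bullet> p = of_int m" by (auto elim: Ints_cases)
  have eq: "g (aref cor b (k - m) x) = aref cor a k (g x)" for x
    unfolding aref_def *(3) linear_diff[OF Lin_linear[OF *(1)]] linear_scale[OF Lin_linear[OF *(1)]]
      b(3) inner_add_right m b(2)[rule_format] by (simp add: algebra_simps)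
  have "inv g (aref cor a k (g x)) = aref cor b (k - m) x" for x
    unfolding eq[symmetric] using g by simp
  then have "inv g \<circ> aref cor a k \<circ> g = aref cor b (k - m)" by (simp add: fun_eq_iff)
  then show thesis by (rule that[OF b(1)])
qed

end

section \<open>Alcoves and separating hyperplanes\<close>

text \<open>General position inside an affine subspace \<open>F\<close>, by induction on
  \<open>\<Psi>\<close>. From a point where the earlier functions do not vanish, move slightly
  towards a point of \<open>F\<close> where the new one is nonzero; an affine function that is 0 at
  the start is nonzero all along the way.\<close>

lemma avoid_affine_zeros:
  fixes F S :: "'a::real_normed_vector set" and \<Psi> :: "('a \<Rightarrow> real) set"
  assumes "finite \<Psi>"
    and aff: "\<And>\<psi> x y t. \<psi> \<in> \<Psi> \<Longrightarrow> \<psi> (x + t *\<^sub>R (y - x)) = \<psi> x + t * (\<psi> y - \<psi> x)"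
    and cont: "\<And>\<psi>. \<psi> \<in> \<Psi> \<Longrightarrow> continuous_on UNIV \<psi>"
    and nz: "\<And>\<psi>. \<psi> \<in> \<Psi> \<Longrightarrow> \<exists>z\<in>F. \<psi> z \<noteq> 0"
    and F: "\<And>x y t. \<lbrakk>x \<in> F; y \<in> F\<rbrakk> \<Longrightarrow> x + t *\<^sub>R (y - x) \<in> F"
    and x0: "x0 \<in> F" "x0 \<in> S" and S: "open S"
  shows "\<exists>x\<in>F \<inter> S. \<forall>\<psi>\<in>\<Psi>. \<psi> x \<noteq> 0"
  using assms(1) aff cont nz
proof (induction \<Psi> rule: finite_induct)
  case empty
  then show ?case using x0 by blast
next
  case (insert \<psi> \<Psi>)
  then obtain x where x: "x \<in> F" "x \<in> S" "\<forall>\<psi>\<in>\<Psi>. \<psi> x \<noteq> 0" by (auto 0 3)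
  show ?case
  proof (cases "\<psi> x = 0")
    case False
    then show ?thesis using x by blast
  next
    case True
    obtain z where z: "z \<in> F" "\<psi> z \<noteq> 0" using insert.prems(3) by blast
    define S' where "S' = S \<inter> (\<Inter>\<psi>\<in>\<Psi>. {y. \<psi> y \<noteq> 0})"
    have "open {y. \<psi>' y \<noteq> 0}" if "\<psi>' \<in> \<Psi>" for \<psi>'
      using insert.prems(2) that by (intro open_Collect_neq) auto
    then have "open S'"
      unfolding S'_def using S insert.hyps(1) by (intro open_Int open_INT) auto
    moreover have "x \<in> S'" using x by (simp add: S'_def)
    ultimately have "\<forall>\<^sub>F y in nhds x. y \<in> S'" by (auto simp: eventually_nhds)
    moreover have "((\<lambda>t::real. x + t *\<^sub>R (z - x)) \<longlongrightarrow> x + 0 *\<^sub>R (z - x)) (at_right 0)"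
      by (intro tendsto_intros)
    ultimately have "\<forall>\<^sub>F t in at_right (0::real). x + t *\<^sub>R (z - x) \<in> S'"
      unfolding filterlim_iff by fastforce
    moreover have "\<forall>\<^sub>F t in at_right (0::real). 0 < t" by (simp add: eventually_at_right_less)
    ultimately have "\<forall>\<^sub>F t in at_right (0::real). x + t *\<^sub>R (z - x) \<in> S' \<and> 0 < t"
      by eventually_elim simp
    then obtain t :: real where t: "x + t *\<^sub>R (z - x) \<in> S'" "0 < t"
      using eventually_happens[of _ "at_right (0::real)"] by auto
    have "\<psi> (x + t *\<^sub>R (z - x)) \<noteq> 0" using insert.prems(1)[of \<psi> x t z] True z t by simp
    then show ?thesis using t F[OF x(1) z(1)] by (auto simp: S'_def)
  qed
qed

context root_setting
begin

text \<open>Positive roots only, so that each affine hyperplane is named once;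
  \<open>hv_proportional_eq\<close> confirms it.\<close>

definition HP :: "('n vec \<times> int) set" where "HP = Pos \<times> UNIV"

definition hv :: "'n vec \<times> int \<Rightarrow> 'n vec \<Rightarrow> real" where
  "hv h x = fst h \<bullet> x - of_int (snd h)"

text \<open>Alcoves are represented by generic points: two of them lie in the same alcove exactly
  when the set \<open>sep\<close> between them is empty.\<close>

definition generic :: "'n vec \<Rightarrow> bool" where
  "generic p \<longleftrightarrow> (\<forall>h\<in>HP. hv h p \<noteq> 0)"

definition sep :: "'n vec \<Rightarrow> 'n vec \<Rightarrow> ('n vec \<times> int) set" where
  "sep x y = {h\<in>HP. hv h x * hv h y < 0}"

lemma HP_root: "h \<in> HP \<Longrightarrow> fst h \<in> Phi"
  using Pos_subset by (auto simp: HP_def)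

lemma hv_affine: "hv h (x + t *\<^sub>R (y - x)) = hv h x + t * (hv h y - hv h x)"
  by (simp add: hv_def inner_add_right inner_diff_right algebra_simps)

lemma hv_add: "hv h (x + v) = hv h x + fst h \<bullet> v"
  by (simp add: hv_def inner_add_right)

lemma continuous_hv: "continuous_on S (hv h)"
  unfolding hv_def by (intro continuous_intros)

lemma sep_HP: "h \<in> sep x y \<Longrightarrow> h \<in> HP" by (simp add: sep_def)

lemma sep_commute: "sep x y = sep y x" by (auto simp: sep_def mult.commute)

lemma sep_self [simp]: "sep x x = {}" by (auto simp: sep_def mult_less_0_iff)

lemma finite_sep: "finite (sep x y)"
proof -
  define M where "M = (\<Sum>a\<in>Pos. \<bar>a \<bullet> x\<bar> + \<bar>a \<bullet> y\<bar>)"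
  have "sep x y \<subseteq> Pos \<times> {- \<lceil>M\<rceil>..\<lceil>M\<rceil>}"
  proof
    fix h assume h: "h \<in> sep x y"
    obtain a k where [simp]: "h = (a, k)" by (cases h)
    have a: "a \<in> Pos" using h by (simp add: sep_def HP_def)
    have "\<bar>a \<bullet> x\<bar> + \<bar>a \<bullet> y\<bar> \<le> M"
      unfolding M_def using member_le_sum[OF a _ finite_Pos, of "\<lambda>a. \<bar>a \<bullet> x\<bar> + \<bar>a \<bullet> y\<bar>"] by simp
    moreover have "(a \<bullet> x - k) * (a \<bullet> y - k) < 0" using h by (simp add: sep_def hv_def)
    then have "\<bar>real_of_int k\<bar> \<le> \<bar>a \<bullet> x\<bar> + \<bar>a \<bullet> y\<bar>" by (auto simp: mult_less_0_iff)
    ultimately have "\<bar>real_of_int k\<bar> \<le> M" by linarith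
    then have "- \<lceil>M\<rceil> \<le> k \<and> k \<le> \<lceil>M\<rceil>" by linarith
    then show "h \<in> Pos \<times> {- \<lceil>M\<rceil>..\<lceil>M\<rceil>}" using a by simp
  qed
  then show ?thesis using finite_subset finite_Pos by blast
qed

text \<open>The infinitely many parallel hyperplanes of one root that miss a point stay at a common
  distance from it; this turns sign conditions into open conditions.\<close>

lemma integer_gap:
  fixes r :: real
  obtains \<delta> :: real where "\<delta> > 0" "\<And>k :: int. r \<noteq> of_int k \<Longrightarrow> \<bar>r - of_int k\<bar> \<ge> \<delta>"
proof (cases "frac r = 0")
  case True
  then have r: "r = of_int \<lfloor>r\<rfloor>" by (simp add: frac_def)
  have "\<bar>r - of_int k\<bar> \<ge> 1" if "r \<noteq> of_int k" for k :: int
  proof -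
    have "\<lfloor>r\<rfloor> \<noteq> k" using r that by metis
    then have "\<bar>\<lfloor>r\<rfloor> - k\<bar> \<ge> 1" by linarith
    then have "\<bar>real_of_int \<lfloor>r\<rfloor> - of_int k\<bar> \<ge> 1" by linarith
    then show ?thesis using r by simp
  qed
  then show ?thesis using that[of 1] by simp
next
  case False
  have "\<bar>r - of_int k\<bar> \<ge> min (frac r) (1 - frac r)" for k :: int
    by (cases "k \<le> \<lfloor>r\<rfloor>") (auto simp: frac_def min_def; linarith)+
  moreover have "min (frac r) (1 - frac r) > 0"
    using False frac_lt_1[of r] frac_ge_0[of r] by auto
  ultimately show ?thesis using that by blast
qed

text \<open>Local finiteness of the arrangement: one gap per root is enough and there are finitely
  many roots, so a single neighbourhood of \<open>e\<close> avoids all hyperplanes missing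
  \<open>e\<close>.\<close>

lemma hv_sign_nhds:
  "\<forall>\<^sub>F y in nhds e. \<forall>h\<in>HP. hv h e \<noteq> 0 \<longrightarrow> hv h y * hv h e > 0"
proof -
  have "\<forall>\<^sub>F y in nhds e. \<forall>k. hv (a, k) e \<noteq> 0 \<longrightarrow> hv (a, k) y * hv (a, k) e > 0" for a
  proof -
    obtain \<delta> :: real where \<delta>: "\<delta> > 0" "\<And>k :: int. a \<bullet> e \<noteq> of_int k \<Longrightarrow> \<bar>a \<bullet> e - of_int k\<bar> \<ge> \<delta>"
      using integer_gap by blast
    have "((\<lambda>y. a \<bullet> y) \<longlongrightarrow> a \<bullet> e) (nhds e)" by (intro tendsto_intros) (simp add: filterlim_ident)
    then have "\<forall>\<^sub>F y in nhds e. dist (a \<bullet> y) (a \<bullet> e) < \<delta>" using \<delta>(1) by (rule tendstoD)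
    then show ?thesis
    proof eventually_elim
      case (elim y)
      show ?case
      proof (intro allI impI)
        fix k assume "hv (a, k) e \<noteq> 0"
        then have "\<bar>a \<bullet> e - of_int k\<bar> \<ge> \<delta>" using \<delta>(2) by (simp add: hv_def)
        then have "(a \<bullet> y - k > 0 \<and> a \<bullet> e - k > 0) \<or> (a \<bullet> y - k < 0 \<and> a \<bullet> e - k < 0)"
          using elim \<delta>(1) unfolding dist_real_def by linarith
        then show "hv (a, k) y * hv (a, k) e > 0"
          by (auto simp: hv_def zero_less_mult_iff)
      qed
    qed
  qed
  then have "\<forall>\<^sub>F y in nhds e. \<forall>a\<in>Pos. \<forall>k. hv (a, k) e \<noteq> 0 \<longrightarrow> hv (a, k) y * hv (a, k) e > 0"
    using finite_Pos by (intro eventually_ball_finite) auto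
  then show ?thesis by eventually_elim (auto simp: HP_def)
qed

lemma hv_sign_ray:
  "\<forall>\<^sub>F t in at_right (0::real). \<forall>h\<in>HP. hv h e \<noteq> 0 \<longrightarrow> hv h (e + t *\<^sub>R v) * hv h e > 0"
proof -
  have "((\<lambda>t::real. e + t *\<^sub>R v) \<longlongrightarrow> e + 0 *\<^sub>R v) (at_right 0)" by (intro tendsto_intros)
  then have "filterlim (\<lambda>t::real. e + t *\<^sub>R v) (nhds e) (at_right 0)" by simp
  from eventually_compose_filterlim[OF hv_sign_nhds this] show ?thesis .
qed

lemma hv_sign_ray_ex:
  assumes "\<epsilon> > 0"
  obtains t :: real where "0 < t" "t < \<epsilon>"
    "\<And>h. \<lbrakk>h \<in> HP; hv h e \<noteq> 0\<rbrakk> \<Longrightarrow> hv h (e + t *\<^sub>R v) * hv h e > 0"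
proof -
  have "\<forall>\<^sub>F t in at_right (0::real). 0 < t \<and> t < \<epsilon> \<and>
     (\<forall>h\<in>HP. hv h e \<noteq> 0 \<longrightarrow> hv h (e + t *\<^sub>R v) * hv h e > 0)"
    using hv_sign_ray[of e v] assms
    by (intro eventually_conj) (auto simp: eventually_at_right_less intro: eventually_at_right_real[THEN eventually_mono])
  then have "\<exists>t. 0 < t \<and> t < \<epsilon> \<and> (\<forall>h\<in>HP. hv h e \<noteq> 0 \<longrightarrow> hv h (e + t *\<^sub>R v) * hv h e > 0)"
    by (intro eventually_happens'[OF trivial_limit_at_right_real])
  then show thesis using that by blast
qed

section \<open>The group acting on hyperplanes, and length as a distance between alcoves\<close>

lemma hv_pull:
  assumes g: "g \<in> G" and h: "h \<in> HP"
  obtains h' \<sigma> where "h' \<in> HP" "\<sigma> = 1 \<or> \<sigma> = -1" "\<And>x. hv h (g x) = \<sigma> * hv h' x"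
proof -
  obtain l p where *: "l \<in> Lin" "p \<in> lattice" "g = (\<lambda>x. l x + p)" using g by (auto simp: G_iff)
  obtain a k where [simp]: "h = (a, k)" by (cases h)
  have a: "a \<in> Phi" using HP_root[OF h] by simp
  obtain b where b: "b \<in> Phi" "\<forall>x. a \<bullet> l x = b \<bullet> x" using Lin_root[OF *(1) a] by blast
  have "a \<bullet> p \<in> \<int>" using lattice_inner root_lattice[OF a] *(2) by blast
  then obtain m where m: "a \<bullet> p = of_int m" by (auto elim: Ints_cases)
  have eq: "hv h (g x) = b \<bullet> x - of_int (k - m)" for x
    using b(2) m by (simp add: hv_def *(3) inner_add_right)
  show thesis
  proof (cases "b \<in> Pos")
    case True
    then show ?thesis using that[of "(b, k - m)" 1] eq by (simp add: HP_def hv_def)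
  next
    case False
    then have "- b \<in> Pos" using Pos_or_neg b(1) by blast
    then show ?thesis using that[of "(- b, m - k)" "-1"] eq by (simp add: HP_def hv_def)
  qed
qed

text \<open>Reducedness leaves only the factors 1 and -1, and positivity of both roots excludes
  -1.\<close>

lemma hv_proportional_eq:
  assumes h: "h \<in> HP" "h' \<in> HP" and eq: "\<And>x. hv h x = t * hv h' x"
  shows "h = h'"
proof -
  obtain a k b j where [simp]: "h = (a, k)" "h' = (b, j)" by (cases h, cases h')
  have kj: "of_int k = t * of_int j" using eq[of 0] by (simp add: hv_def)
  have "a \<bullet> x = (t *\<^sub>R b) \<bullet> x" for x using eq[of x] kj by (simp add: hv_def algebra_simps)
  then have ab: "a = t *\<^sub>R b" by (metis vector_eq_rdot inner_commute)
  have ap: "a \<in> Pos" "b \<in> Pos" using h by (auto simp: HP_def)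
  then have "t = 1 \<or> t = -1" using root_multiple[of b t] ab Pos_subset by auto
  moreover have "t \<noteq> -1" using ab ap Pos_not_neg by auto
  ultimately have "t = 1" by simp
  then show ?thesis using ab kj by simp
qed

text \<open>Pulling hyperplanes back along \<open>g\<close> is injective on \<open>HP\<close>.
  Equality then follows by applying this to \<open>inv g\<close> as well.\<close>

lemma card_sep_le:
  assumes g: "g \<in> G"
  shows "card (sep (g x) (g y)) \<le> card (sep x y)"
proof -
  have "\<forall>h\<in>HP. \<exists>h' \<sigma>. h' \<in> HP \<and> (\<sigma> = 1 \<or> \<sigma> = -1) \<and> (\<forall>x. hv h (g x) = \<sigma> * hv h' x)"
    using hv_pull[OF g] by metis
  then obtain f \<sigma> where f: "\<And>h. h \<in> HP \<Longrightarrow> f h \<in> HP"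
    "\<And>h. h \<in> HP \<Longrightarrow> \<sigma> h = 1 \<or> \<sigma> h = (-1::real)"
    "\<And>h x. h \<in> HP \<Longrightarrow> hv h (g x) = \<sigma> h * hv (f h) x" by metis
  have "inj_on f HP"
  proof (rule inj_onI)
    fix h k assume hk: "h \<in> HP" "k \<in> HP" "f h = f k"
    have "hv h x = (\<sigma> h * \<sigma> k) * hv k x" for x
    proof -
      have "hv h x = \<sigma> h * hv (f k) (inv g x)" "hv k x = \<sigma> k * hv (f k) (inv g x)"
        using f(3)[OF hk(1), of "inv g x"] f(3)[OF hk(2), of "inv g x"] hk(3) g by auto
      then show ?thesis using f(2)[OF hk(2)] by auto
    qed
    then show "h = k" using hv_proportional_eq hk by blast
  qed
  moreover have "f ` sep (g x) (g y) \<subseteq> sep x y"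
  proof
    fix k assume "k \<in> f ` sep (g x) (g y)"
    then obtain h where h: "h \<in> HP" "hv h (g x) * hv h (g y) < 0" "k = f h" by (auto simp: sep_def)
    have "hv k x * hv k y < 0" using h(2) f(2)[OF h(1)] by (auto simp: f(3)[OF h(1)] h(3))
    then show "k \<in> sep x y" using f(1) h by (simp add: sep_def)
  qed
  ultimately show ?thesis
    by (intro card_inj_on_le[of f]) (auto simp: finite_sep sep_HP inj_on_def)
qed

lemma card_sep_G:
  assumes g: "g \<in> G"
  shows "card (sep (g x) (g y)) = card (sep x y)"
  using card_sep_le[OF g, of x y] card_sep_le[OF G_inv[OF g], of "g x" "g y"] g by simp

lemma sep_empty_G: "\<lbrakk>g \<in> G; sep x y = {}\<rbrakk> \<Longrightarrow> sep (g x) (g y) = {}"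
  using card_sep_G[of g x y] finite_sep[of "g x" "g y"] by simp

lemma generic_G: "\<lbrakk>g \<in> G; generic p\<rbrakk> \<Longrightarrow> generic (g p)"
  unfolding generic_def using hv_pull[of g] by (metis mult_eq_0_iff neg_equal_0_iff_equal zero_neq_one)

lemma alcove_sign:
  assumes x: "x \<in> fund_alcove Phi Delta" and h: "h \<in> HP"
  shows "hv h x * hv h base_pt > 0"
proof -
  obtain a k where [simp]: "h = (a, k)" by (cases h)
  have a: "a \<in> Pos" using h by (simp add: HP_def)
  have "0 < a \<bullet> x" "a \<bullet> x < 1" "0 < a \<bullet> base_pt" "a \<bullet> base_pt < 1"
    using x a base_pt_bounds[OF a] by (auto simp: fund_alcove_def)
  moreover have "k \<le> 0 \<or> k \<ge> 1" by linarith
  then have "real_of_int k \<le> 0 \<or> real_of_int k \<ge> 1" by linarith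
  ultimately have "(a \<bullet> x - k > 0 \<and> a \<bullet> base_pt - k > 0) \<or> (a \<bullet> x - k < 0 \<and> a \<bullet> base_pt - k < 0)"
    by linarith
  then show ?thesis by (auto simp: hv_def zero_less_mult_iff)
qed

lemma generic_base: "generic base_pt"
  using alcove_sign[OF base_pt_alcove] by (force simp: generic_def)

text \<open>\<open>wlen\<close> quantifies over the whole alcove; one point is enough because
  neither \<open>hv h\<close> nor its pull-back along \<open>w\<close> changes sign there.\<close>

lemma len_eq:
  assumes w: "w \<in> G"
  shows "len w = card (sep base_pt (w base_pt))"
proof -
  have "{(a, k). a \<in> Pos \<and> (\<forall>x\<in>fund_alcove Phi Delta. (a \<bullet> x - of_int k) * (a \<bullet> w x - of_int k) < 0)}
     = sep base_pt (w base_pt)" (is "?L = _")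
  proof (rule set_eqI)
    fix h :: "'n vec \<times> int"
    obtain a k where [simp]: "h = (a, k)" by (cases h)
    show "h \<in> ?L \<longleftrightarrow> h \<in> sep base_pt (w base_pt)"
    proof
      assume "h \<in> ?L"
      then show "h \<in> sep base_pt (w base_pt)"
        using base_pt_alcove by (auto simp: sep_def HP_def hv_def)
    next
      assume h: "h \<in> sep base_pt (w base_pt)"
      then have hp: "h \<in> HP" by (rule sep_HP)
      obtain h' \<sigma> where h': "h' \<in> HP" "\<sigma> = 1 \<or> \<sigma> = -1" "\<And>x. hv h (w x) = \<sigma> * hv h' x"
        using hv_pull[OF w hp] by metis
      have "hv h base_pt * hv h (w base_pt) < 0" using h by (simp add: sep_def)
      then have "hv h x * hv h (w x) < 0" if x: "x \<in> fund_alcove Phi Delta" for x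
        using alcove_sign[OF x hp] alcove_sign[OF x h'(1)] h'(2)
        unfolding h'(3) by (auto simp: mult_less_0_iff zero_less_mult_iff)
      then show "h \<in> ?L" using hp by (auto simp: HP_def hv_def)
    qed
  qed
  then show ?thesis by (simp add: wlen_def)
qed

lemma len_dist: "\<lbrakk>x \<in> G; y \<in> G\<rbrakk> \<Longrightarrow> len (inv x \<circ> y) = card (sep (x base_pt) (y base_pt))"
  using len_eq[OF G_comp[OF G_inv]] card_sep_G[of x base_pt "inv x (y base_pt)"] by simp

text \<open>Signs multiply, so separating sets add as symmetric differences. This governs the
  bookkeeping of lengths below.\<close>

lemma sep_trans:
  assumes "generic x" "generic y" "generic z"
  shows "sep x z = (sep x y - sep y z) \<union> (sep y z - sep x y)"
proof (rule set_eqI)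
  fix h
  show "h \<in> sep x z \<longleftrightarrow> h \<in> (sep x y - sep y z) \<union> (sep y z - sep x y)"
  proof (cases "h \<in> HP")
    case True
    then have "hv h x \<noteq> 0" "hv h y \<noteq> 0" "hv h z \<noteq> 0" using assms by (auto simp: generic_def)
    then show ?thesis using True by (auto simp: sep_def mult_less_0_iff)
  next
    case False
    then show ?thesis by (auto simp: sep_def)
  qed
qed

lemma sep_cong:
  "\<lbrakk>generic x; generic y; generic z; sep x y = {}\<rbrakk> \<Longrightarrow> sep x z = sep y z"
  using sep_trans[of x y z] by auto

lemma sep_empty_trans:
  "\<lbrakk>generic x; generic y; generic z; sep x y = {}; sep y z = {}\<rbrakk> \<Longrightarrow> sep x z = {}"
  using sep_trans[of x y z] by auto

lemma card_sep_add:
  assumes "generic x" "generic y" "generic z" "sep x y \<inter> sep y z = {}"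
  shows "card (sep x z) = card (sep x y) + card (sep y z)"
proof -
  have "sep x z = sep x y \<union> sep y z" using sep_trans[OF assms(1-3)] assms(4) by auto
  then show ?thesis using card_Un_disjoint[OF finite_sep finite_sep assms(4)] by simp
qed

text \<open>A gallery from the base alcove through that of \<open>x\<close> to that of
  \<open>x \<circ> y\<close> is minimal if no hyperplane is crossed twice.\<close>

lemma len_comp_add:
  assumes xy: "x \<in> G" "y \<in> G"
    and disj: "sep base_pt (x base_pt) \<inter> sep (x base_pt) (x (y base_pt)) = {}"
  shows "len (x \<circ> y) = len x + len y"
proof -
  have "len (x \<circ> y) = card (sep base_pt (x base_pt)) + card (sep (x base_pt) (x (y base_pt)))"
    using len_eq[OF G_comp[OF xy]] card_sep_add[OF generic_base _ _ disj] xy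
    by (simp add: generic_G generic_base)
  then show ?thesis using len_eq xy card_sep_G[OF xy(1)] by simp
qed

text \<open>The segment is stopped at the least crossing parameter. Hyperplanes through both end
  points are allowed, since the lemma is also applied to segments inside the subspaces F_i.\<close>

lemma first_crossing:
  assumes reg: "\<And>h. h \<in> HP \<Longrightarrow> hv h x = 0 \<longleftrightarrow> hv h z = 0" and ne: "sep x z \<noteq> {}"
  obtains t h where "0 < t" "t < 1" "h \<in> sep x z" "hv h (x + t *\<^sub>R (z - x)) = 0"
    "\<And>h. \<lbrakk>h \<in> HP; hv h x \<noteq> 0\<rbrakk> \<Longrightarrow> (h \<in> sep x z \<and> hv h (x + t *\<^sub>R (z - x)) = 0)
        \<or> hv h (x + t *\<^sub>R (z - x)) * hv h x > 0"
proof -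
  define \<tau> where "\<tau> h = hv h x / (hv h x - hv h z)" for h
  define t where "t = Min (\<tau> ` sep x z)"
  have fin: "finite (\<tau> ` sep x z)" "\<tau> ` sep x z \<noteq> {}" using finite_sep ne by auto
  have "t \<in> \<tau> ` sep x z" unfolding t_def using fin by (rule Min_in)
  then obtain h0 where h0: "h0 \<in> sep x z" "t = \<tau> h0" by blast
  have tle: "t \<le> \<tau> h" if "h \<in> sep x z" for h
    unfolding t_def using fin that by (intro Min_le) auto
  have bounds: "0 < \<tau> h \<and> \<tau> h < 1" if "h \<in> sep x z" for h
  proof -
    have "hv h x * hv h z < 0" using that by (simp add: sep_def)
    then show ?thesis unfolding \<tau>_def by (auto simp: mult_less_0_iff divide_simps)
  qed
  have val: "hv h (x + t *\<^sub>R (z - x)) = (hv h x - hv h z) * (\<tau> h - t)" if "h \<in> sep x z" for h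
  proof -
    have "hv h x - hv h z \<noteq> 0" using that by (auto simp: sep_def mult_less_0_iff)
    then show ?thesis unfolding hv_affine \<tau>_def by (simp add: field_simps)
  qed
  have t01: "0 < t" "t < 1" using bounds h0 by auto
  show thesis
  proof (rule that[OF t01 h0(1)])
    show "hv h0 (x + t *\<^sub>R (z - x)) = 0" using val[OF h0(1)] h0(2) by simp
    fix h assume h: "h \<in> HP" "hv h x \<noteq> 0"
    show "(h \<in> sep x z \<and> hv h (x + t *\<^sub>R (z - x)) = 0) \<or> hv h (x + t *\<^sub>R (z - x)) * hv h x > 0"
    proof (cases "h \<in> sep x z")
      case True
      have "hv h x * hv h z < 0" using True by (simp add: sep_def)
      then have "(hv h x - hv h z) * hv h x > 0" by (auto simp: mult_less_0_iff zero_less_mult_iff)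
      then have "\<tau> h \<noteq> t \<Longrightarrow> (\<tau> h - t) * ((hv h x - hv h z) * hv h x) > 0"
        using tle[OF True] by simp
      then show ?thesis
        using val[OF True] True by (cases "\<tau> h = t") (simp_all add: mult_ac)
    next
      case False
      then have same: "hv h x * hv h z > 0" using h reg[OF h(1)]
        by (metis (no_types, lifting) sep_def mem_Collect_eq linorder_neqE_linordered_idom mult_eq_0_iff)
      have "hv h (x + t *\<^sub>R (z - x)) * hv h x = (1 - t) * (hv h x * hv h x) + t * (hv h x * hv h z)"
        unfolding hv_affine by (simp add: algebra_simps)
      moreover have "(1 - t) * (hv h x * hv h x) > 0" using t01 h(2) by (simp add: zero_less_mult_iff) linarith
      ultimately show ?thesis using same t01 by (simp add: add_pos_pos)
    qed
  qed
qed

text \<open>A straight segment may meet two hyperplanes at once. Moving its end within the alcove of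
  \<open>q\<close> prevents this, and just past the first crossing lies the adjacent alcove.\<close>

lemma adjacent_step:
  assumes p: "generic p" and q: "generic q" and ne: "sep p q \<noteq> {}"
  obtains h p' where "h \<in> sep p q" "generic p'" "sep p p' = {h}" "sep p' q = sep p q - {h}"
proof -
  obtain S where S: "open S" "q \<in> S" "\<And>y h. \<lbrakk>y \<in> S; h \<in> HP\<rbrakk> \<Longrightarrow> hv h y * hv h q > 0"
    using hv_sign_nhds[of q] q unfolding eventually_nhds generic_def by blast
  \<comment> \<open>Such a function vanishes at \<open>z\<close> when the segment from
    \<open>p\<close> to \<open>z\<close> meets \<open>h\<close> and \<open>k\<close> at the same
    parameter.\<close>
  define \<Psi> where "\<Psi> = (\<lambda>(h, k). \<lambda>z. hv h p * hv k z - hv k p * hv h z) ` {(h, k) \<in> sep p q \<times> sep p q. h \<noteq> k}"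
  have "\<exists>z\<in>UNIV \<inter> S. \<forall>\<psi>\<in>\<Psi>. \<psi> z \<noteq> 0"
  proof (rule avoid_affine_zeros[where ?x0.0=q])
    have "{(h, k) \<in> sep p q \<times> sep p q. h \<noteq> k} \<subseteq> sep p q \<times> sep p q" by auto
    then show "finite \<Psi>" unfolding \<Psi>_def using finite_sep finite_subset by blast
    fix \<psi> assume "\<psi> \<in> \<Psi>"
    then obtain h k where hk: "h \<in> sep p q" "k \<in> sep p q" "h \<noteq> k"
      and \<psi>: "\<psi> = (\<lambda>z. hv h p * hv k z - hv k p * hv h z)" by (auto simp: \<Psi>_def)
    show "\<psi> (x + t *\<^sub>R (y - x)) = \<psi> x + t * (\<psi> y - \<psi> x)" for x y t
      unfolding \<psi> hv_affine by (simp add: algebra_simps)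
    show "continuous_on UNIV \<psi>" unfolding \<psi> by (intro continuous_intros continuous_hv)
    have nz: "hv h p \<noteq> 0" using p sep_HP[OF hk(1)] by (simp add: generic_def)
    show "\<exists>z\<in>UNIV. \<psi> z \<noteq> 0"
    proof (rule ccontr)
      assume "\<not> ?thesis"
      then have "hv k z = (hv k p / hv h p) * hv h z" for z
        using nz by (auto simp: \<psi> field_simps)
      then have "k = h" using hv_proportional_eq[OF sep_HP[OF hk(2)] sep_HP[OF hk(1)]] by blast
      then show False using hk by simp
    qed
  qed (use S in auto)
  then obtain z where z: "z \<in> S" "\<forall>\<psi>\<in>\<Psi>. \<psi> z \<noteq> 0" by blast
  have zq: "hv h z * hv h q > 0" if "h \<in> HP" for h using S(3)[OF z(1) that] .
  then have gz: "generic z" by (force simp: generic_def)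
  have "sep z q = {}" using zq by (force simp: sep_def)
  then have sz: "sep p z = sep p q" using sep_trans[OF p gz q] by auto
  obtain t h where t: "0 < t" "t < 1" "h \<in> sep p z" "hv h (p + t *\<^sub>R (z - p)) = 0"
    "\<And>h. \<lbrakk>h \<in> HP; hv h p \<noteq> 0\<rbrakk> \<Longrightarrow> (h \<in> sep p z \<and> hv h (p + t *\<^sub>R (z - p)) = 0)
        \<or> hv h (p + t *\<^sub>R (z - p)) * hv h p > 0"
    using first_crossing[of p z] p gz ne sz unfolding generic_def by metis
  define e where "e = p + t *\<^sub>R (z - p)"
  have other: "hv k e * hv k p > 0" if k: "k \<in> HP" "k \<noteq> h" for k
  proof (rule ccontr)
    assume "\<not> ?thesis"
    then have k2: "k \<in> sep p z" "hv k e = 0"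
      using t(5)[OF k(1)] p k(1) by (auto simp: e_def generic_def)
    have 1: "t * hv h z = (t - 1) * hv h p" "t * hv k z = (t - 1) * hv k p"
      using t(4) k2(2) unfolding e_def hv_affine left_diff_distrib right_diff_distrib by linarith+
    have "t * (hv h p * hv k z - hv k p * hv h z) = hv h p * (t * hv k z) - hv k p * (t * hv h z)"
      by (simp only: right_diff_distrib mult_ac)
    also have "\<dots> = 0" unfolding 1 by (simp only: mult_ac diff_self)
    finally have "t * (hv h p * hv k z - hv k p * hv h z) = 0" .
    moreover have "(\<lambda>z. hv h p * hv k z - hv k p * hv h z) \<in> \<Psi>"
      unfolding \<Psi>_def by (rule image_eqI[of _ _ "(h, k)"]) (use k2(1) t(3) k(2) sz in simp_all)
    with z(2) have "hv h p * hv k z - hv k p * hv h z \<noteq> 0" by (rule bspec)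
    ultimately show False using t(1) by simp
  qed
  have hHP: "h \<in> HP" and hs: "hv h p * hv h z < 0" using t(3) by (auto simp: sep_def)
  obtain u :: real where u: "0 < u" "u < 1"
    "\<And>h. \<lbrakk>h \<in> HP; hv h e \<noteq> 0\<rbrakk> \<Longrightarrow> hv h (e + u *\<^sub>R (z - p)) * hv h e > 0"
    using hv_sign_ray_ex[of 1 e "z - p"] by auto
  define p' where "p' = e + u *\<^sub>R (z - p)"
  have "hv h p' = u * (hv h z - hv h p)"
    using t(4) unfolding p'_def e_def[symmetric] hv_add by (simp add: hv_def inner_diff_right algebra_simps)
  then have hneg: "hv h p' * hv h p < 0"
    using hs u(1) by (auto simp: mult_less_0_iff zero_less_mult_iff)
  have kpos: "hv k p' * hv k p > 0" if k: "k \<in> HP" "k \<noteq> h" for k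
    using other[OF k] u(3)[OF k(1)] unfolding p'_def by (auto simp: zero_less_mult_iff)
  have gp': "generic p'" unfolding generic_def using hneg kpos by force
  have "sep p p' = {h}" using hneg kpos hHP by (force simp: sep_def mult.commute)
  moreover have "h \<in> sep p q" using t(3) sz by simp
  moreover have "sep p' q = sep p q - {h}"
    using sep_trans[OF gp' p q] calculation by (auto simp: sep_commute)
  ultimately show thesis using that gp' by blast
qed

abbreviation refl :: "'n vec \<times> int \<Rightarrow> 'n amap" where
  "refl h \<equiv> aref cor (fst h) (snd h)"

lemma refl_G: "h \<in> HP \<Longrightarrow> refl h \<in> G"
  by (rule aref_G[OF HP_root])

lemma hv_refl: "h \<in> HP \<Longrightarrow> hv h (refl h x) = - hv h x"
  using root_cor[OF HP_root, of h] by (simp add: hv_def aref_def inner_diff_right algebra_simps)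

text \<open>Choose \<open>e\<close> on the segment where only \<open>h\<close> vanishes. The
  reflection fixes \<open>e\<close>, and points near \<open>e\<close> have the signs of
  \<open>e\<close> on all other hyperplanes, so a point of the alcove of \<open>p\<close> near
  \<open>e\<close> is sent into the alcove of \<open>p'\<close>.\<close>

lemma refl_adjacent:
  assumes p: "generic p" "generic p'" and s: "sep p p' = {h}"
  shows "sep (refl h p) p' = {}"
proof -
  have h: "h \<in> HP" "hv h p * hv h p' < 0" using s by (auto simp: sep_def)
  define t where "t = hv h p / (hv h p - hv h p')"
  have t: "0 < t" "t < 1" using h(2) unfolding t_def by (auto simp: mult_less_0_iff divide_simps)
  define e where "e = p + t *\<^sub>R (p' - p)"
  have d0: "hv h p - hv h p' \<noteq> 0" using h(2) by (auto simp: mult_less_0_iff)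
  have e0: "hv h e = 0" unfolding e_def hv_affine t_def using d0 by (simp add: field_simps)
  have pos: "hv k p * hv k p' > 0" if "k \<in> HP" "k \<noteq> h" for k
    using s p that unfolding generic_def sep_def
    by (metis (mono_tags, lifting) mem_Collect_eq singletonD linorder_neqE_linordered_idom mult_eq_0_iff)
  have ep: "hv k e * hv k p' > 0" if k: "k \<in> HP" "k \<noteq> h" for k
  proof -
    have "hv k e * hv k p' = (1 - t) * (hv k p * hv k p') + t * (hv k p' * hv k p')"
      unfolding e_def hv_affine by (simp add: algebra_simps)
    moreover have "(1 - t) * (hv k p * hv k p') > 0" using t pos[OF k] by simp
    ultimately show ?thesis using t by (simp add: add_pos_nonneg)
  qed
  define r where "r = refl h"
  have rG: "r \<in> G" using refl_G[OF h(1)] by (simp add: r_def)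
  have re: "r (e + u *\<^sub>R (p - e)) = e + u *\<^sub>R (r p - e)" for u
    using e0 unfolding r_def aref_def hv_def
    by (simp add: inner_add_right inner_diff_right algebra_simps)
  obtain u :: real where u: "0 < u" "u < 1"
    "\<And>h. \<lbrakk>h \<in> HP; hv h e \<noteq> 0\<rbrakk> \<Longrightarrow> hv h (e + u *\<^sub>R (r p - e)) * hv h e > 0"
    using hv_sign_ray_ex[of 1 e "r p - e"] by auto
  define y where "y = e + u *\<^sub>R (p - e)"
  have "hv k y * hv k p > 0" if k: "k \<in> HP" for k
  proof -
    have eq: "hv k y * hv k p = (1 - u) * (hv k e * hv k p) + u * (hv k p * hv k p)"
      unfolding y_def hv_affine by (simp add: algebra_simps)
    have "hv k p \<noteq> 0" using p(1) k by (simp add: generic_def)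
    then have "u * (hv k p * hv k p) > 0" using u by (simp add: zero_less_mult_iff) linarith
    moreover have "hv k e * hv k p \<ge> 0"
      using e0 ep[OF k] pos[OF k] by (cases "k = h") (auto simp: zero_less_mult_iff zero_le_mult_iff)
    then have "(1 - u) * (hv k e * hv k p) \<ge> 0" using u by simp
    ultimately show ?thesis using eq by linarith
  qed
  then have "sep y p = {}" and gy: "generic y" by (force simp: sep_def, force simp: generic_def)
  then have s1: "sep (r y) (r p) = {}" using sep_empty_G[OF rG] by blast
  show ?thesis
  proof (rule ccontr)
    assume "sep (refl h p) p' \<noteq> {}"
    then obtain k where k: "k \<in> HP" "hv k (r p) * hv k p' < 0" by (auto simp: sep_def r_def)
    show False
    proof (cases "k = h")
      case True
      then show False using hv_refl[OF h(1)] k(2) h(2) by (simp add: r_def)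
    next
      case False
      have "hv k (r y) * hv k e > 0" using u(3)[OF k(1)] ep[OF k(1) False] re unfolding y_def by force
      moreover have "hv k (r p) \<noteq> 0" using generic_G[OF rG p(1)] k(1) by (simp add: generic_def)
      moreover have "\<not> hv k (r y) * hv k (r p) < 0" using s1 k(1) unfolding sep_def by blast
      ultimately show False
        using k(2) ep[OF k(1) False] by (auto simp: zero_less_mult_iff mult_less_0_iff)
    qed
  qed
qed

text \<open>Induction on the distance to the base alcove: the first wall of a gallery leads to a
  closer alcove, and reflecting in that wall leads back.\<close>

lemma alcove_transitive: "generic p \<Longrightarrow> \<exists>x\<in>G. sep (x base_pt) p = {}"
proof (induction "card (sep p base_pt)" arbitrary: p)
  case 0
  then have "sep p base_pt = {}" using finite_sep by simp
  then show ?case using G_id by (auto simp: sep_commute intro!: bexI[of _ id])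
next
  case (Suc n)
  then have "sep p base_pt \<noteq> {}" by force
  then obtain h p' where h: "h \<in> sep p base_pt" "generic p'" "sep p p' = {h}"
    "sep p' base_pt = sep p base_pt - {h}"
    using adjacent_step[OF Suc(3) generic_base] by metis
  have "n = card (sep p' base_pt)" using Suc(2) h finite_sep by simp
  then obtain x where x: "x \<in> G" "sep (x base_pt) p' = {}" using Suc(1) h(2) by blast
  have r: "refl h \<in> G" using refl_G sep_HP h(1) by blast
  have 1: "sep (refl h (x base_pt)) (refl h p') = {}" using sep_empty_G[OF r x(2)] .
  have 2: "sep (refl h p') p = {}" using refl_adjacent[OF h(2) Suc(3)] h(3) by (simp add: sep_commute)
  have "sep ((refl h \<circ> x) base_pt) p = {}"
    using sep_empty_trans[OF _ _ Suc(3) 1 2] generic_G[OF r] generic_G[OF x(1) generic_base] h(2) by simp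
  then show ?case using G_comp[OF r x(1)] by blast
qed

end

section \<open>Reduction in the Hecke algebra\<close>

locale hecke_setting = root_setting Phi Delta cor D
  for Phi Delta :: "'n::finite vec set"
    and cor :: "'n vec \<Rightarrow> 'n vec"
    and D :: "'n amap set" +
  fixes sc :: "laurent \<Rightarrow> 'h::ring_1 \<Rightarrow> 'h"
    and T :: "'n amap \<Rightarrow> 'h"
  assumes hecke: "is_hecke_algebra Phi cor Delta D sc T"
begin

lemma module_sc: "module sc"
  and sc_mult_left: "sc c (x * y) = sc c x * y"
  and sc_mult_right: "sc c (x * y) = x * sc c y"
  using hecke unfolding is_hecke_algebra_def A_algebra_def Let_def by blast+

sublocale H: module sc by (rule module_sc)

abbreviation comm :: "'h set" where "comm \<equiv> commutator_span sc"

lemma T_inj: "inj_on T G"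
  and T_independent: "H.independent (T ` G)"
  and T_span: "H.span (T ` G) = UNIV"
  and T_mult: "\<lbrakk>x \<in> G; y \<in> G; len (x \<circ> y) = len x + len y\<rbrakk> \<Longrightarrow> T x * T y = T (x \<circ> y)"
  and T_quadratic0: "s \<in> simple_refls Phi cor Delta \<Longrightarrow> (T s - sc lv 1) * (T s + sc lv_inv 1) = 0"
  using hecke by (auto simp: is_hecke_algebra_def Let_def)

lemma comm_mem: "a * b - b * a \<in> comm"
  unfolding commutator_span_def by (rule H.span_base) blast

lemma comm_subspace: "H.subspace comm"
  by (simp add: commutator_span_def H.subspace_span)

lemmas comm_add = H.subspace_add[OF comm_subspace]
lemmas comm_diff = H.subspace_diff[OF comm_subspace]
lemmas comm_scale = H.subspace_scale[OF comm_subspace]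
lemmas comm_zero = H.subspace_0[OF comm_subspace]

lemma comm_swap: "a - b \<in> comm \<Longrightarrow> b - a \<in> comm"
  using comm_diff[OF comm_zero, of "a - b"] by simp

lemma comm_trans: "\<lbrakk>a - b \<in> comm; b - c \<in> comm\<rbrakk> \<Longrightarrow> a - c \<in> comm"
  using comm_add[of "a - b" "b - c"] by simp

definition hh :: laurent where "hh = lv - lv_inv"

lemma lv_inverse: "lv * lv_inv = 1"
  by (simp add: lv_def lv_inv_def mult_single)

lemma T_quadratic:
  assumes "s \<in> simple_refls Phi cor Delta"
  shows "T s * T s = 1 + sc hh (T s)"
proof -
  have a: "sc c 1 * x = sc c x" "x * sc c 1 = sc c x" for c x
    using sc_mult_left[of c 1 x] sc_mult_right[of c x 1] by simp_all
  have "0 = T s * T s + sc lv_inv (T s) - (sc lv (T s) + sc lv (sc lv_inv 1))"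
    using T_quadratic0[OF assms] by (simp add: algebra_simps a)
  then have "0 = T s * T s - sc hh (T s) - 1"
    by (simp add: hh_def H.scale_left_diff_distrib H.scale_scale lv_inverse algebra_simps)
  then show ?thesis by (simp add: algebra_simps)
qed

lemma len_id: "len id = 0"
  using len_eq[OF G_id] by simp

lemma T_id: "T id = 1"
proof -
  have "T id * x = x" if "x \<in> H.span (T ` G)" for x
    using that
  proof (induction rule: H.span_induct_alt)
    case base
    then show ?case by simp
  next
    case (step c x y)
    then obtain g where "g \<in> G" "x = T g" by blast
    then have "T id * x = x" using T_mult[OF G_id, of g] len_id by simp
    then have "T id * sc c x = sc c x" using sc_mult_right[of c "T id" x] by metis
    then show ?case unfolding distrib_left using step(2) by metis
  qed
  then show ?thesis using T_span by (metis UNIV_I mult.right_neutral)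
qed

lemma len_inv: "x \<in> G \<Longrightarrow> len (inv x) = len x"
  using len_eq[OF G_inv] len_eq card_sep_G[of x base_pt "inv x base_pt"] by (simp add: sep_commute)

text \<open>Conjugating the wall reflection \<open>refl h\<close> back by \<open>x\<close> gives a
  reflection of length one, hence a simple one: right multiplication by \<open>s\<close> crosses the
  wall \<open>h\<close>.\<close>

lemma simple_step:
  assumes x: "x \<in> G" and p: "generic p" "generic p'" and xp: "sep (x base_pt) p = {}"
    and h: "sep p p' = {h}"
  obtains s where "s \<in> simple_refls Phi cor Delta" "s \<in> G" "len s = 1" "s \<circ> s = id"
    "x \<circ> s = refl h \<circ> x" "sep ((x \<circ> s) base_pt) p' = {}"
proof -
  have hH: "h \<in> HP" using h by (auto simp: sep_def)
  define s where "s = inv x \<circ> refl h \<circ> x"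
  have sG: "s \<in> G" unfolding s_def by (intro G_comp G_inv x refl_G hH)
  have xs: "x \<circ> s = refl h \<circ> x" unfolding s_def using x by (simp add: fun_eq_iff)
  have gx: "generic (x base_pt)" using generic_G x generic_base by blast
  have rr: "refl h (refl h y) = y" for y
    unfolding aref_def inner_diff_right inner_scaleR_right root_cor[OF HP_root[OF hH]]
    by (simp add: scaleR_diff_left[symmetric] diff_diff_eq scaleR_add_left[symmetric])
  have ss: "s \<circ> s = id" unfolding s_def using x rr by (simp add: fun_eq_iff)
  have e1: "sep (refl h (x base_pt)) (refl h p) = {}" using sep_empty_G[OF refl_G[OF hH] xp] .
  have e2: "sep (refl h p) p' = {}" using refl_adjacent[OF p h] .
  have e3: "sep ((x \<circ> s) base_pt) p' = {}"
    unfolding xs using sep_empty_trans[OF _ _ p(2) e1 e2] generic_G[OF refl_G[OF hH]] gx p by simp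
  have gxs: "generic ((x \<circ> s) base_pt)" using generic_G[OF G_comp[OF x sG] generic_base] .
  have "len s = card (sep (x base_pt) ((x \<circ> s) base_pt))"
    using len_eq[OF sG] card_sep_G[OF x] by simp
  also have "sep (x base_pt) ((x \<circ> s) base_pt) = sep p p'"
    using sep_cong[OF gx p(1) gxs xp] sep_cong[OF gxs p(2) p(1) e3] by (simp add: sep_commute)
  finally have len1: "len s = 1" using h by simp
  obtain b j where bj: "b \<in> Phi" "s = aref cor b j"
    using aref_conj[OF x HP_root[OF hH]] unfolding s_def by metis
  then have "s \<in> simple_refls Phi cor Delta" using len1 unfolding simple_refls_def by blast
  then show thesis using that sG len1 ss xs e3 by blast
qed

lemma T_simple_inverse:
  assumes "s \<in> simple_refls Phi cor Delta"
  shows "T s * (T s - sc hh 1) = 1" "(T s - sc hh 1) * T s = 1"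
  using T_quadratic[OF assms] sc_mult_left[of hh 1 "T s"] sc_mult_right[of hh "T s" 1]
  by (simp_all add: algebra_simps)

text \<open>\<open>s\<close> crosses the first wall of a minimal gallery from the base alcove to
  that of \<open>x\<close>.\<close>

lemma reduced_factor:
  assumes x: "x \<in> G" and n: "len x = Suc n"
  obtains s y where "s \<in> simple_refls Phi cor Delta" "s \<in> G" "len s = 1" "s \<circ> s = id"
    "y \<in> G" "len y = n" "x = s \<circ> y" "T x = T s * T y"
proof -
  have gx: "generic (x base_pt)" using generic_G x generic_base by blast
  have "sep base_pt (x base_pt) \<noteq> {}" using n len_eq[OF x] by force
  then obtain h p' where h: "h \<in> sep base_pt (x base_pt)" "generic p'" "sep base_pt p' = {h}"
    "sep p' (x base_pt) = sep base_pt (x base_pt) - {h}"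
    using adjacent_step[OF generic_base gx] by metis
  obtain s where s: "s \<in> simple_refls Phi cor Delta" "s \<in> G" "len s = 1" "s \<circ> s = id"
    "sep ((id \<circ> s) base_pt) p' = {}"
    using simple_step[OF G_id generic_base h(2) _ h(3)] by auto
  define y where "y = s \<circ> x"
  have y: "y \<in> G" unfolding y_def by (intro G_comp s x)
  have sy: "x = s \<circ> y" unfolding y_def using s(4) by (metis comp_assoc id_comp)
  have "len y = card (sep (s base_pt) (x base_pt))"
    using len_eq[OF y] card_sep_G[OF s(2), of base_pt "y base_pt"] sy by simp
  also have "sep (s base_pt) (x base_pt) = sep p' (x base_pt)"
    using sep_cong[OF _ h(2) gx] s(5) generic_G[OF s(2) generic_base] by simp
  finally have ly: "len y = n" using h(1,4) n len_eq[OF x] finite_sep by simp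
  have "T x = T s * T y" using T_mult[OF s(2) y] sy ly n s(3) by simp
  then show thesis using that[OF s(1-4) y ly sy] by blast
qed

text \<open>In length 0 the inverse is \<open>T (inv x)\<close>; a simple factor is inverted by the
  quadratic relation.\<close>

lemma T_invertible: "x \<in> G \<Longrightarrow> \<exists>b. T x * b = 1 \<and> b * T x = 1"
proof (induction "len x" arbitrary: x)
  case 0
  have "T x * T (inv x) = 1" "T (inv x) * T x = 1"
    using T_mult[OF 0(2) G_inv[OF 0(2)]] T_mult[OF G_inv[OF 0(2)] 0(2)] len_inv[OF 0(2)] 0 len_id T_id
    by (simp_all add: G_inv_comp)
  then show ?case by blast
next
  case (Suc n)
  then obtain s y where s: "s \<in> simple_refls Phi cor Delta" "y \<in> G" "len y = n" "T x = T s * T y"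
    using reduced_factor[of x n] by metis
  obtain b where b: "T y * b = 1" "b * T y = 1" using Suc(1) s by metis
  have "T x * (b * (T s - sc hh 1)) = T s * (T y * b) * (T s - sc hh 1)"
    unfolding s(4) by (simp only: mult.assoc)
  moreover have "(b * (T s - sc hh 1)) * T x = b * ((T s - sc hh 1) * T s) * T y"
    unfolding s(4) by (simp only: mult.assoc)
  ultimately show ?case using b T_simple_inverse[OF s(1)] by auto
qed

text \<open>The two disjointness conditions say that both factorisations of the element taking \<open>x\<close> to
  \<open>w y\<close> are length-additive, so \<open>T\<^sub>z\<close> intertwines the two conjugates.\<close>

lemma conj_T:
  assumes w: "w \<in> G" and x: "x \<in> G" and y: "y \<in> G"
    and 1: "sep (x base_pt) (y base_pt) \<inter> sep (y base_pt) (w (y base_pt)) = {}"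
    and 2: "sep (x base_pt) (y base_pt) \<inter> sep (x base_pt) (inv w (x base_pt)) = {}"
  shows "T (inv x \<circ> w \<circ> x) - T (inv y \<circ> w \<circ> y) \<in> comm \<and> len (inv x \<circ> w \<circ> x) = len (inv y \<circ> w \<circ> y)"
proof -
  define p where "p = x base_pt"
  define q where "q = y base_pt"
  have gen: "generic p" "generic q" "generic (w p)" "generic (w q)"
    unfolding p_def q_def using generic_G w x y generic_base by auto
  define a b z where abz: "a = inv x \<circ> w \<circ> x" "b = inv y \<circ> w \<circ> y" "z = inv x \<circ> y"
  have G: "a \<in> G" "b \<in> G" "z \<in> G" unfolding abz by (auto intro!: G_comp G_inv w x y)
  have zb: "z \<circ> b = inv x \<circ> (w \<circ> y)" and az: "a \<circ> z = inv x \<circ> (w \<circ> y)"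
    unfolding abz using x y by (simp_all add: fun_eq_iff)
  have lz: "len z = card (sep p q)" using len_dist[OF x y] by (simp add: abz p_def q_def)
  have lb: "len b = card (sep q (w q))"
    using len_dist[OF y G_comp[OF w y]] by (simp add: abz q_def comp_assoc)
  have la: "len a = card (sep p (w p))"
    using len_dist[OF x G_comp[OF w x]] by (simp add: abz p_def comp_assoc)
  have lt: "len (inv x \<circ> (w \<circ> y)) = card (sep p (w q))"
    using len_dist[OF x G_comp[OF w y]] by (simp add: p_def q_def)
  have e1: "len (z \<circ> b) = len z + len b"
    using card_sep_add[OF gen(1,2,4)] 1 by (simp add: zb lt lz lb p_def q_def)
  \<comment> \<open>The second hypothesis, transported by \<open>w\<close>.\<close>
  have "sep p (w p) \<inter> sep (w p) (w q) = {}"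
  proof (rule ccontr)
    assume "\<not> ?thesis"
    then obtain h where h: "h \<in> HP" "hv h p * hv h (w p) < 0" "hv h (w p) * hv h (w q) < 0"
      by (auto simp: sep_def)
    obtain h' \<sigma> where h': "h' \<in> HP" "\<sigma> = 1 \<or> \<sigma> = -1" "\<And>x. hv h (w x) = \<sigma> * hv h' x"
      using hv_pull[OF w h(1)] by metis
    have "hv h p = \<sigma> * hv h' (inv w p)" using h'(3)[of "inv w p"] w by simp
    then have "hv h' (inv w p) * hv h' p < 0" "hv h' p * hv h' q < 0"
      using h(2,3) h'(2) unfolding h'(3) by auto
    then have "h' \<in> sep p q" "h' \<in> sep p (inv w p)" using h'(1) by (auto simp: sep_def mult.commute)
    then show False using 2 unfolding p_def q_def by blast
  qed
  then have e2: "len (a \<circ> z) = len a + len z"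
    using card_sep_add[OF gen(1,3,4)] card_sep_G[OF w, of p q] by (simp add: az lt lz la)
  have ll: "len a = len b" using e1 e2 zb az by simp
  have eq: "T z * T b = T a * T z"
    using T_mult[OF G(3,2) e1] T_mult[OF G(1,3) e2] zb az by simp
  obtain c where c: "T z * c = 1" "c * T z = 1" using T_invertible[OF G(3)] by blast
  have "T b = (c * T z) * T b" unfolding c(2) by simp
  then have "T b = c * (T a * T z)" unfolding mult.assoc eq .
  moreover have "T a = (T a * T z) * c" unfolding mult.assoc c(1) by simp
  \<comment> \<open>\<open>T a\<close> and \<open>T b\<close> are the two products of
    \<open>T a * T z\<close> with the inverse \<open>c\<close> of \<open>T z\<close>.\<close>
  ultimately have "T a - T b \<in> comm" using comm_mem[of "T a * T z" c] by simp
  then show ?thesis using ll by (simp add: abz)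
qed

section \<open>Cocenter classes attached to alcoves, up to shorter elements\<close>

definition alc :: "'n vec \<Rightarrow> 'n amap" where
  "alc p = (SOME x. x \<in> G \<and> sep (x base_pt) p = {})"

lemma alc: assumes "generic p" shows "alc p \<in> G" "sep (alc p base_pt) p = {}"
proof -
  have "\<exists>x. x \<in> G \<and> sep (x base_pt) p = {}"
    using alcove_transitive[OF assms] unfolding Bex_def .
  from someI_ex[OF this] show "alc p \<in> G" "sep (alc p base_pt) p = {}"
    unfolding alc_def by (rule conjunct1, rule conjunct2)
qed

text \<open>\<open>alc p\<close> is determined only up to the stabiliser of the base alcove; by
  \<open>tau_rep\<close> the class modulo \<open>comm\<close> does not depend on that
  choice.\<close>

definition tau :: "'n amap \<Rightarrow> 'n vec \<Rightarrow> 'h" where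
  "tau w p = T (inv (alc p) \<circ> w \<circ> alc p)"

definition displ :: "'n amap \<Rightarrow> 'n vec \<Rightarrow> nat" where
  "displ w p = card (sep p (w p))"

lemma sep_rep:
  assumes p: "generic p" "x \<in> G" "sep (x base_pt) p = {}" and q: "generic q" "y \<in> G" "sep (y base_pt) q = {}"
  shows "sep (x base_pt) (y base_pt) = sep p q"
  using sep_cong[OF _ p(1) _ p(3), of "y base_pt"] sep_cong[OF _ q(1) p(1) q(3)] generic_G generic_base p(2) q(2)
  by (simp add: sep_commute)

lemma sep_rep_image:
  assumes w: "w \<in> G" and p: "generic p" "x \<in> G" "sep (x base_pt) p = {}"
    and q: "generic q" "y \<in> G" "sep (y base_pt) q = {}"
  shows "sep (x base_pt) (w (y base_pt)) = sep p (w q)"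
  using sep_rep[OF p generic_G[OF w q(1)] G_comp[OF w q(2)]] sep_empty_G[OF w q(3)] by simp

lemma displ_rep:
  assumes w: "w \<in> G" and p: "generic p" "x \<in> G" "sep (x base_pt) p = {}"
  shows "len (inv x \<circ> w \<circ> x) = displ w p"
  using len_dist[OF p(2) G_comp[OF w p(2)]] sep_rep_image[OF w p p]
  by (simp add: displ_def comp_assoc)

lemma tau_strong:
  assumes w: "w \<in> G" and p: "generic p" "x \<in> G" "sep (x base_pt) p = {}"
    and q: "generic q" "y \<in> G" "sep (y base_pt) q = {}"
    and 1: "sep p q \<inter> sep q (w q) = {}" and 2: "sep p q \<inter> sep p (inv w p) = {}"
  shows "T (inv x \<circ> w \<circ> x) - T (inv y \<circ> w \<circ> y) \<in> comm" "displ w p = displ w q"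
  using conj_T[OF w p(2) q(2)] 1 2 sep_rep[OF p q] sep_rep_image[OF w q q]
    sep_rep_image[OF G_inv[OF w] p p] displ_rep[OF w p] displ_rep[OF w q] by auto

lemma tau_rep:
  assumes w: "w \<in> G" and p: "generic p" "x \<in> G" "sep (x base_pt) p = {}"
  shows "T (inv x \<circ> w \<circ> x) - tau w p \<in> comm"
  unfolding tau_def using tau_strong(1)[OF w p p(1) alc[OF p(1)]] by simp

lemma tau_conj:
  assumes w: "w \<in> G" and p: "generic p" and q: "generic q"
    and 1: "sep p q \<inter> sep q (w q) = {}" and 2: "sep p q \<inter> sep p (inv w p) = {}"
  shows "tau w p - tau w q \<in> comm" "displ w p = displ w q"
  unfolding tau_def using tau_strong[OF w p alc[OF p] q alc[OF q] 1 2] by auto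

definition low :: "nat \<Rightarrow> 'h set" where
  "low n = H.span ({T z | z. z \<in> G \<and> len z < n} \<union> comm)"

lemma low_subspace: "H.subspace (low n)" by (simp add: low_def H.subspace_span)
lemma comm_low: "x \<in> comm \<Longrightarrow> x \<in> low n" by (simp add: low_def H.span_base)
lemma T_low: "\<lbrakk>z \<in> G; len z < n\<rbrakk> \<Longrightarrow> T z \<in> low n" unfolding low_def by (rule H.span_base) blast

text \<open>Either the length stays and the class is kept, or the length drops and all that is kept
  is that the start is, modulo \<open>comm\<close>, a combination of shorter elements. Forgetting
  the class at \<open>q\<close> in the second case makes the relation transitive and still suffices
  for an induction on length.\<close>

definition red :: "'n amap \<Rightarrow> 'n vec \<Rightarrow> 'n vec \<Rightarrow> bool" where
  "red w p q \<longleftrightarrow> (displ w q = displ w p \<and> tau w p - tau w q \<in> comm) \<or>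
     (displ w q < displ w p \<and> tau w p \<in> low (displ w p))"

lemma red_refl: "red w p p" by (simp add: red_def comm_zero)

lemma red_trans: "\<lbrakk>red w p q; red w q r\<rbrakk> \<Longrightarrow> red w p r"
proof -
  assume pq: "red w p q" and qr: "red w q r"
  show ?thesis
  proof (cases "displ w q = displ w p \<and> tau w p - tau w q \<in> comm")
    case True
    from qr show ?thesis unfolding red_def
    proof (elim disjE conjE)
      assume "displ w r = displ w q" "tau w q - tau w r \<in> comm"
      then show "(displ w r = displ w p \<and> tau w p - tau w r \<in> comm) \<or> (displ w r < displ w p \<and> tau w p \<in> low (displ w p))"
        using True comm_trans by auto
    next
      assume l: "displ w r < displ w q" "tau w q \<in> low (displ w q)"
      have "tau w p \<in> low (displ w p)"
        using H.subspace_add[OF low_subspace l(2) comm_low[of "tau w p - tau w q"]] True by simp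
      then show "(displ w r = displ w p \<and> tau w p - tau w r \<in> comm) \<or> (displ w r < displ w p \<and> tau w p \<in> low (displ w p))"
        using True l by auto
    qed
  next
    case False
    then show ?thesis using pq qr unfolding red_def by auto
  qed
qed

lemma red_same: "\<lbrakk>w \<in> G; generic p; generic q; sep p q = {}\<rbrakk> \<Longrightarrow> red w p q"
  using tau_conj[of w p q] by (simp add: red_def)

lemma card_sep_adjacent:
  assumes "generic x" "generic y" "generic z" "card (sep y z) = 1"
  shows "card (sep x z) = card (sep x y) + 1 \<or> card (sep x y) = card (sep x z) + 1"
proof -
  obtain h where h: "sep y z = {h}" using assms(4) by (rule card_1_singletonE)
  show ?thesis
  proof (cases "h \<in> sep x y")
    case True
    then have "sep x z = sep x y - {h}" using sep_trans[OF assms(1-3)] h by auto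
    then have "card (sep x y) = card (sep x z) + 1"
      using True finite_sep[of x y] card_Suc_Diff1[of "sep x y" h] by simp
    then show ?thesis ..
  next
    case False
    then show ?thesis using card_sep_add[OF assms(1-3)] h by simp
  qed
qed

text \<open>If \<open>y'\<close> is longer than \<open>u\<close> too, then \<open>T y - T y'\<close>
  is a commutator of \<open>T s\<close> and \<open>T u\<close>. Otherwise \<open>u\<close> is
  \<open>y'\<close> times \<open>s\<close> on that side, and the quadratic relation makes
  \<open>T y\<close> congruent to \<open>T y' + sc hh (T u)\<close> modulo \<open>comm\<close>,
  where both terms are shorter.\<close>

lemma hecke_shift:
  assumes s: "s \<in> simple_refls Phi cor Delta" "s \<in> G" "len s = 1" "s \<circ> s = id"
    and y: "y \<in> G" "y' \<in> G" and u: "u \<in> G" "len y = len u + 1"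
    and eqs: "(y = s \<circ> u \<and> y' = u \<circ> s) \<or> (y = u \<circ> s \<and> y' = s \<circ> u)"
    and ly': "len y' = len u + 1 \<or> len u = len y' + 1"
  shows "(len y' = len y \<and> T y - T y' \<in> comm) \<or> (len y' < len y \<and> T y \<in> low (len y))"
  using ly'
proof
  assume l: "len y' = len u + 1"
  from eqs have "T y - T y' \<in> comm"
  proof
    assume e: "y = s \<circ> u \<and> y' = u \<circ> s"
    then have "T y = T s * T u" "T y' = T u * T s"
      using T_mult[OF s(2) u(1)] T_mult[OF u(1) s(2)] s(3) u(2) l by simp_all
    then show ?thesis using comm_mem by simp
  next
    assume e: "y = u \<circ> s \<and> y' = s \<circ> u"
    then have "T y' = T s * T u" "T y = T u * T s"
      using T_mult[OF s(2) u(1)] T_mult[OF u(1) s(2)] s(3) u(2) l by simp_all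
    then show ?thesis using comm_mem by simp
  qed
  then show ?thesis using l u by simp
next
  assume l: "len u = len y' + 1"
  have "\<exists>c\<in>comm. T y = c + (T y' + sc hh (T u))"
    using eqs
  proof
    assume e: "y = s \<circ> u \<and> y' = u \<circ> s"
    have "u = y' \<circ> s" using e s(4) by (simp add: comp_assoc)
    then have tu: "T u = T y' * T s" using T_mult[OF y(2) s(2)] l s(3) by simp
    have ty: "T y = T s * T u" using T_mult[OF s(2) u(1)] e s(3) u(2) by simp
    have "T u * T s = T y' + sc hh (T u)"
      unfolding tu by (simp add: mult.assoc T_quadratic[OF s(1)] distrib_left sc_mult_right)
    then have "T y = (T s * T u - T u * T s) + (T y' + sc hh (T u))" using ty by simp
    then show ?thesis using comm_mem by blast
  next
    assume e: "y = u \<circ> s \<and> y' = s \<circ> u"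
    have "u = s \<circ> y'" using e s(4) by (metis comp_assoc id_comp)
    then have tu: "T u = T s * T y'" using T_mult[OF s(2) y(2)] l s(3) by simp
    have ty: "T y = T u * T s" using T_mult[OF u(1) s(2)] e s(3) u(2) by simp
    have "T s * T u = T y' + sc hh (T u)"
      unfolding tu by (simp add: mult.assoc[symmetric] T_quadratic[OF s(1)] distrib_right sc_mult_left)
    then have "T y = (T u * T s - T s * T u) + (T y' + sc hh (T u))" using ty by simp
    then show ?thesis using comm_mem by blast
  qed
  then obtain c where c: "c \<in> comm" "T y = c + (T y' + sc hh (T u))" by blast
  have "T y \<in> low (len y)"
    unfolding c(2)
    by (intro H.subspace_add[OF low_subspace] H.subspace_scale[OF low_subspace] comm_low[OF c(1)]
          T_low[OF y(2)] T_low[OF u(1)]) (use u(2) l in auto)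
  then show ?thesis using u l by simp
qed

text \<open>If \<open>h\<close> lies between \<open>p\<close> and \<open>w p\<close>, or between
  \<open>p\<close> and \<open>inv w p\<close>, then moving one end of the gallery across
  \<open>h\<close> shortens it by one, while moving the other end changes it by one either way. So a
  crossing in this direction never lengthens the conjugate.\<close>

lemma red_adjacent:
  assumes w: "w \<in> G" and p: "generic p" "generic p'" and h: "sep p p' = {h}"
    and dir: "hv h p * hv h (w p) < 0 \<or> hv h p * hv h (inv w p) < 0"
  shows "red w p p'"
proof -
  define x where "x = alc p"
  have x: "x \<in> G" "sep (x base_pt) p = {}" using alc[OF p(1)] by (auto simp: x_def)
  obtain s where s: "s \<in> simple_refls Phi cor Delta" "s \<in> G" "len s = 1" "s \<circ> s = id"
    "x \<circ> s = refl h \<circ> x" "sep ((x \<circ> s) base_pt) p' = {}"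
    using simple_step[OF x(1) p x(2) h] by metis
  have hH: "h \<in> HP" using h by (auto simp: sep_def)
  have xs: "x \<circ> s \<in> G" using G_comp x s by blast
  define y where "y = inv x \<circ> w \<circ> x"
  define y' where "y' = inv (x \<circ> s) \<circ> w \<circ> (x \<circ> s)"
  have yG: "y \<in> G" "y' \<in> G" unfolding y_def y'_def by (auto intro!: G_comp G_inv w x xs)
  have invs: "inv s = s" using s(2,4) by (simp add: inv_unique_comp)
  have y'eq: "y' = s \<circ> y \<circ> s"
    unfolding y'_def y_def inv_comp[OF x(1) s(2)] invs by (simp add: comp_assoc)
  have gw: "generic (w p)" "generic (w p')" "generic (inv w p)" using generic_G w G_inv p by auto
  have ly: "len y = displ w p" unfolding y_def using displ_rep[OF w p(1) x] .
  have ly': "len y' = displ w p'" unfolding y'_def using displ_rep[OF w p(2) xs s(6)] .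
  have c1: "card (sep (w p) (w p')) = 1" using card_sep_G[OF w] h by simp
  have remove: "card (sep p z) = card (sep p' z) + 1" if z: "generic z" "h \<in> sep p z" for z
  proof -
    have "sep p' z = sep p z - {h}"
      using sep_trans[OF p(2,1) z(1)] h z(2) by (auto simp: sep_commute)
    then show ?thesis using z(2) finite_sep[of p z] card_Suc_Diff1[of "sep p z" h] by simp
  qed
  have "(len y' = len y \<and> T y - T y' \<in> comm) \<or> (len y' < len y \<and> T y \<in> low (len y))"
    using dir
  proof
    assume d: "hv h p * hv h (w p) < 0"
    \<comment> \<open>\<open>u\<close> measures from \<open>p'\<close> to \<open>w p\<close>: only
      the start has crossed \<open>h\<close>.\<close>
    define u where "u = s \<circ> y"
    have u: "u \<in> G" unfolding u_def using G_comp s yG by blast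
    have "u = inv (x \<circ> s) \<circ> (w \<circ> x)" unfolding u_def y_def inv_comp[OF x(1) s(2)] invs by (simp add: comp_assoc)
    then have lu: "len u = card (sep p' (w p))"
      using len_dist[OF xs G_comp[OF w x(1)]] sep_rep_image[OF w p(2) xs s(6) p(1) x] by simp
    have l1: "len y = len u + 1"
      using remove[OF gw(1)] d hH lu ly by (simp add: sep_def displ_def)
    have l2: "len y' = len u + 1 \<or> len u = len y' + 1"
      using card_sep_adjacent[OF p(2) gw(1,2) c1] lu ly' by (simp add: displ_def)
    have "y = s \<circ> u \<and> y' = u \<circ> s" unfolding u_def y'eq using s(4) by (metis comp_assoc id_comp)
    then show ?thesis using hecke_shift[OF s(1-4) yG u l1 _ l2] by blast
  next
    assume d: "hv h p * hv h (inv w p) < 0"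
    \<comment> \<open>Here only the far end has moved: \<open>u\<close> measures from
      \<open>p\<close> to \<open>w p'\<close>.\<close>
    define u where "u = y \<circ> s"
    have u: "u \<in> G" unfolding u_def using G_comp s yG by blast
    have "u = inv x \<circ> (w \<circ> (x \<circ> s))" unfolding u_def y_def by (simp add: comp_assoc)
    then have "len u = card (sep p (w p'))"
      using len_dist[OF x(1) G_comp[OF w xs]] sep_rep_image[OF w p(1) x p(2) xs s(6)] by simp
    then have lu: "len u = card (sep p' (inv w p))"
      using card_sep_G[OF w, of "inv w p" p'] w by (simp add: sep_commute)
    have dp: "displ w p = card (sep p (inv w p))"
      using card_sep_G[OF w, of "inv w p" p] w by (simp add: sep_commute displ_def)
    have l1: "len y = len u + 1"
      using remove[OF gw(3)] d hH lu ly dp by (simp add: sep_def)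
    have "card (sep p (w p')) = len u" using card_sep_G[OF w, of "inv w p" p'] w lu by (simp add: sep_commute)
    then have l2: "len y' = len u + 1 \<or> len u = len y' + 1"
      using card_sep_adjacent[OF gw(2) p] h ly' by (auto simp: displ_def sep_commute)
    have "y = u \<circ> s \<and> y' = s \<circ> u" unfolding u_def y'eq using s(4) by (metis comp_assoc comp_id)
    then show ?thesis using hecke_shift[OF s(1-4) yG u l1 _ l2] by blast
  qed
  moreover have "T y = tau w p" unfolding y_def tau_def x_def ..
  moreover have "T y' - tau w p' \<in> comm" unfolding y'_def by (rule tau_rep[OF w p(2) xs s(6)])
  ultimately show ?thesis unfolding red_def ly ly' using comm_trans by auto
qed

text \<open>The direction condition is demanded only at alcoves \<open>d\<close> on minimal
  galleries from \<open>p\<close> to \<open>q\<close>, and only for the walls still to be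
  crossed.\<close>

lemma red_gallery:
  assumes w: "w \<in> G" and p: "generic p" "generic q"
    and dir: "\<And>d h. \<lbrakk>generic d; sep p d \<subseteq> sep p q; h \<in> sep p q; h \<notin> sep p d\<rbrakk>
      \<Longrightarrow> hv h d * hv h (w d) < 0 \<or> hv h d * hv h (inv w d) < 0"
  shows "red w p q"
proof -
  have "red w d q" if "generic d" "sep p d \<subseteq> sep p q" for d
    using that
  proof (induction "card (sep d q)" arbitrary: d)
    case 0
    then show ?case using red_same[OF w 0(2) p(2)] finite_sep by simp
  next
    case (Suc n)
    then have "sep d q \<noteq> {}" by force
    then obtain h d' where h: "h \<in> sep d q" "generic d'" "sep d d' = {h}" "sep d' q = sep d q - {h}"
      using adjacent_step[OF Suc(3) p(2)] by metis
    have dq: "sep d q = sep p q - sep p d"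
      using sep_trans[OF Suc(3) p] Suc(4) by (auto simp: sep_commute)
    have r1: "red w d d'"
      by (rule red_adjacent[OF w Suc(3) h(2,3) dir[OF Suc(3,4)]]) (use h(1) dq in auto)
    have "sep p d' \<subseteq> sep p q"
      using sep_trans[OF p(1) Suc(3) h(2)] h(1,3) dq Suc(4) by auto
    moreover have "n = card (sep d' q)" using h Suc(2) finite_sep by simp
    ultimately have "red w d' q" using Suc(1) h(2) by blast
    then show ?case using r1 red_trans by blast
  qed
  then show ?thesis using p by simp
qed

end

section \<open>Linear maps of finite order\<close>

text \<open>The period is even so that the angles include \<open>pi\<close>, the angle of the
  eigenvalue -1; a period can always be doubled.\<close>

locale finite_order_map =
  fixes L :: "'a::real_vector \<Rightarrow> 'a" and r :: nat
  assumes lin: "linear L" and period: "L ^^ (2 * r) = id" and r_pos: "r > 0"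
begin

definition ang :: "nat \<Rightarrow> real" where "ang i = pi * real i / real r"
definition ev :: "nat \<Rightarrow> real" where "ev i = 2 * cos (ang i)"
text \<open>The frequencies \<open>i\<close> and \<open>2 r - i\<close> have the same cosine and are merged, whence the factor 2.\<close>

definition wt :: "nat \<Rightarrow> real" where
  "wt i = (if i = 0 \<or> i = r then 1 else 2) / (2 * real r)"
text \<open>The real Fourier projector, for the cyclic group generated by \<open>L\<close>, onto the
  part on which \<open>L\<close> turns by \<open>ang i\<close>.\<close>

definition P :: "nat \<Rightarrow> 'a \<Rightarrow> 'a" where
  "P i v = wt i *\<^sub>R (\<Sum>t<2 * r. cos (real t * ang i) *\<^sub>R (L ^^ t) v)"

lemma pow_linear: "linear (L ^^ t)"
proof (induction t)
  case 0
  show ?case by (rule linearI) simp_all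
next
  case (Suc t)
  then show ?case using linear_compose[OF Suc lin] by (simp add: comp_def)
qed

lemma P_linear: "linear (P i)"
proof (rule linearI)
  fix x y and c :: real
  show "P i (x + y) = P i x + P i y"
    by (simp add: P_def linear_add[OF pow_linear] scaleR_add_right sum.distrib)
  show "P i (c *\<^sub>R x) = c *\<^sub>R P i x"
    by (simp add: P_def linear_scale[OF pow_linear] scaleR_sum_right mult.commute mult.left_commute)
qed

lemma L_P: "L (P i v) = P i (L v)"
  by (simp add: P_def linear_scale[OF lin] linear_sum[OF lin] funpow_swap1)

lemma P_zero [simp]: "P i 0 = 0" by (rule linear_0[OF P_linear])

lemma P_pow: "(L ^^ t) (P i v) = P i ((L ^^ t) v)"
  by (induction t) (simp_all add: L_P)

lemma periodic_sum:
  fixes f :: "nat \<Rightarrow> 'a"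
  assumes "f (2 * r) = f 0"
  shows "(\<Sum>t<2 * r. f (Suc t)) = (\<Sum>t<2 * r. f t)"
  using sum.lessThan_Suc_shift[of f "2 * r"] assms by simp

lemma cos_period: "cos (real (2 * r) * ang i + x) = cos x"
proof -
  have "real (2 * r) * ang i = 2 * real i * pi" using r_pos by (simp add: ang_def)
  then show ?thesis unfolding cos_add by (simp only: cos_2npi sin_2npi mult_1_left mult_zero_left diff_zero)
qed

text \<open>The quadratic equation of a rotation by \<open>ang i\<close>. It comes from cos(x - y) +
  cos(x + y) = 2 cos x cos y after shifting the summation index around the period.\<close>

lemma P_eigen: "L (L (P i v)) + P i v = ev i *\<^sub>R L (P i v)"
proof -
  define f where "f t = cos (real t * ang i - ang i) *\<^sub>R (L ^^ Suc t) v" for t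
  define g where "g t = cos (real t * ang i) *\<^sub>R (L ^^ t) v" for t
  have per: "(L ^^ Suc (2 * r)) v = L v" "(L ^^ (2 * r)) v = v" using period by simp_all
  have f: "f (2 * r) = f 0"
    using cos_period[of i "- ang i"] per by (simp add: f_def)
  have g: "g (2 * r) = g 0"
    using cos_period[of i 0] per by (simp add: g_def)
  have "(\<Sum>t<2 * r. cos (real t * ang i) *\<^sub>R (L ^^ Suc (Suc t)) v) = (\<Sum>t<2 * r. f (Suc t))"
    by (rule sum.cong) (simp_all add: f_def algebra_simps)
  then have 1: "(\<Sum>t<2 * r. cos (real t * ang i) *\<^sub>R (L ^^ Suc (Suc t)) v) = (\<Sum>t<2 * r. f t)"
    using periodic_sum[OF f] by simp
  have 2: "(\<Sum>t<2 * r. g t) = (\<Sum>t<2 * r. g (Suc t))" using periodic_sum[OF g] by simp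
  have "L (L (P i v)) = wt i *\<^sub>R (\<Sum>t<2 * r. f t)"
    unfolding 1[symmetric] by (simp add: P_def linear_scale[OF lin] linear_sum[OF lin])
  moreover have "P i v = wt i *\<^sub>R (\<Sum>t<2 * r. g (Suc t))"
    unfolding 2[symmetric] by (simp add: P_def g_def)
  ultimately have "L (L (P i v)) + P i v = wt i *\<^sub>R (\<Sum>t<2 * r. f t + g (Suc t))"
    by (simp add: sum.distrib scaleR_add_right)
  also have "(\<Sum>t<2 * r. f t + g (Suc t)) = (\<Sum>t<2 * r. (ev i * cos (real t * ang i)) *\<^sub>R (L ^^ Suc t) v)"
  proof (rule sum.cong)
    fix t
    have "cos (real t * ang i - ang i) + cos (real (Suc t) * ang i) = ev i * cos (real t * ang i)"
      by (simp add: ev_def distrib_right cos_add cos_diff algebra_simps)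
    then show "f t + g (Suc t) = (ev i * cos (real t * ang i)) *\<^sub>R (L ^^ Suc t) v"
      unfolding f_def g_def by (simp add: scaleR_add_left[symmetric])
  qed simp
  also have "wt i *\<^sub>R \<dots> = ev i *\<^sub>R L (P i v)"
    by (simp add: P_def linear_scale[OF lin] linear_sum[OF lin] scaleR_sum_right mult.commute mult.left_commute)
  finally show ?thesis .
qed

lemma L_inj: "L v = 0 \<Longrightarrow> v = 0"
proof -
  assume "L v = 0"
  moreover have "(L ^^ (2 * r)) v = (L ^^ (2 * r - 1)) (L v)"
    using r_pos funpow_Suc_right[of "2 * r - 1" L] by simp
  ultimately show ?thesis using period linear_0[OF pow_linear] by simp
qed

lemma ev_less: "\<lbrakk>i < j; j \<le> r\<rbrakk> \<Longrightarrow> ev j < ev i"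
proof -
  assume ij: "i < j" "j \<le> r"
  have "ang i < ang j" "0 \<le> ang i" "ang j \<le> pi"
    using ij r_pos pi_gt_zero by (simp_all add: ang_def divide_simps)
  then show ?thesis using cos_monotone_0_pi[of "ang i" "ang j"] by (simp add: ev_def)
qed

lemma ev_0: "ev 0 = 2" and ev_r: "ev r = -2"
  using r_pos by (simp_all add: ev_def ang_def)

lemma eigen_P_zero:
  assumes v: "L (L v) + v = ev i *\<^sub>R L v" and ij: "i \<noteq> j" "i \<le> r" "j \<le> r"
  shows "P j v = 0"
proof -
  have "L (L (P j v)) + P j v = ev i *\<^sub>R L (P j v)"
    using arg_cong[OF v, of "P j"] by (simp add: linear_add[OF P_linear] linear_scale[OF P_linear] L_P)
  then have "ev i *\<^sub>R L (P j v) = ev j *\<^sub>R L (P j v)" using P_eigen[of j v] by metis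
  then have "(ev i - ev j) *\<^sub>R L (P j v) = 0" unfolding scaleR_diff_left by simp
  moreover have "ev i \<noteq> ev j" using ij ev_less[of i j] ev_less[of j i] by (cases "i < j") auto
  ultimately show ?thesis using L_inj by simp
qed

lemma P_P_zero: "\<lbrakk>i \<noteq> j; i \<le> r; j \<le> r\<rbrakk> \<Longrightarrow> P j (P i v) = 0"
  using eigen_P_zero[OF P_eigen] .

text \<open>Closed form of the Dirichlet kernel with halved end terms, multiplied out to avoid
  dividing by \<open>sin (x / 2)\<close>.\<close>

lemma trapezoid_cos:
  "2 * sin (x / 2) * (1 + 2 * (\<Sum>i=1..<Suc n. cos (real i * x)) + cos (real (Suc n) * x))
     = 2 * sin (real (Suc n) * x) * cos (x / 2)" for x :: real
proof (induction n)
  case 0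
  have "cos x = 2 * (cos (x / 2))\<^sup>2 - 1" "sin x = 2 * sin (x / 2) * cos (x / 2)"
    using cos_double_cos[of "x / 2"] sin_double[of "x / 2"] by simp_all
  then show ?case by (simp add: power2_eq_square algebra_simps)
next
  case (Suc n)
  define y where "y = real (Suc n) * x"
  have y': "real (Suc (Suc n)) * x = y + x" by (simp add: y_def algebra_simps)
  have c: "cos x = 1 - 2 * (sin (x / 2))\<^sup>2" "cos x = 2 * (cos (x / 2))\<^sup>2 - 1" "sin x = 2 * sin (x / 2) * cos (x / 2)"
    using cos_double_cos[of "x / 2"] cos_double_sin[of "x / 2"] sin_double[of "x / 2"] by simp_all
  define s k where "s = sin (x / 2)" and "k = cos (x / 2)"
  have cs: "cos x = 1 - 2 * s\<^sup>2" "cos x = 2 * k\<^sup>2 - 1" "sin x = 2 * s * k"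
    using c by (simp_all add: s_def k_def)
  have sk: "s\<^sup>2 + k\<^sup>2 = 1" by (simp add: s_def k_def)
  have IH: "2 * s * (1 + 2 * (\<Sum>i=1..<Suc n. cos (real i * x)) + cos y) = 2 * sin y * k"
    using Suc by (simp add: s_def k_def y_def)
  have "2 * s * (1 + 2 * (\<Sum>i=1..<Suc (Suc n). cos (real i * x)) + cos (y + x))
     = 2 * s * (1 + 2 * (\<Sum>i=1..<Suc n. cos (real i * x)) + cos y) + 2 * s * (cos y + cos (y + x))"
    by (simp add: y_def algebra_simps)
  also have "\<dots> = 2 * sin y * k + 2 * s * (cos y + cos (y + x))" unfolding IH ..
  also have "\<dots> = 2 * sin (y + x) * k"
  proof -
    have "2 * sin y * k + 2 * s * (cos y + (cos y * cos x - sin y * sin x))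
       - 2 * (sin y * cos x + cos y * sin x) * k = 0"
      unfolding cs(3) using cs(1) cs(2) sk by algebra
    then show ?thesis by (simp add: cos_add sin_add algebra_simps)
  qed
  finally show ?case unfolding y' s_def k_def .
qed

text \<open>Fourier inversion on a cycle of length \<open>2 * r\<close>: for \<open>t > 0\<close>
  the kernel vanishes because \<open>r * x\<close> is a multiple of \<open>pi\<close> while
  \<open>sin (x / 2)\<close> is positive.\<close>

lemma wt_sum:
  assumes t: "t < 2 * r"
  shows "(\<Sum>i\<le>r. wt i * cos (real t * ang i)) = (if t = 0 then 1 else 0)"
proof -
  obtain n where n: "r = Suc n" using r_pos by (cases r) auto
  define x where "x = real t * pi / real r"
  have ta: "real t * ang i = real i * x" for i by (simp add: ang_def x_def)
  have "(\<Sum>i\<le>r. wt i * cos (real t * ang i)) = wt 0 + (\<Sum>i=1..<r. wt i * cos (real i * x)) + wt r * cos (real r * x)"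
  proof -
    have set: "{..r} = insert 0 (insert r {1..<r})" using n by auto
    have "0 \<notin> insert r {1..<r}" "r \<notin> {1..<r}" using r_pos by auto
    then show ?thesis unfolding set ta by simp
  qed
  also have "(\<Sum>i=1..<r. wt i * cos (real i * x)) = (\<Sum>i=1..<r. (2 * cos (real i * x)) / (2 * real r))"
    by (rule sum.cong) (auto simp: wt_def)
  also have "\<dots> = (2 * (\<Sum>i=1..<r. cos (real i * x))) / (2 * real r)"
    by (simp only: sum_divide_distrib[symmetric] sum_distrib_left[symmetric])
  also have "wt 0 = 1 / (2 * real r)" by (simp add: wt_def)
  also have "wt r * cos (real r * x) = cos (real r * x) / (2 * real r)" by (simp add: wt_def)
  finally have eq: "(\<Sum>i\<le>r. wt i * cos (real t * ang i)) =
     (1 + 2 * (\<Sum>i=1..<r. cos (real i * x)) + cos (real r * x)) / (2 * real r)"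
    by (simp add: add_divide_distrib)
  show ?thesis
  proof (cases "t = 0")
    case True
    then show ?thesis unfolding eq using n by (simp add: x_def field_simps)
  next
    case False
    have "x / 2 = pi * (real t / (2 * real r))" by (simp add: x_def mult.commute)
    moreover have "0 < real t / (2 * real r)" "real t / (2 * real r) < 1" using False t r_pos by (auto simp: divide_simps)
    ultimately have "0 < x / 2" "x / 2 < pi"
      using mult_pos_pos[OF pi_gt_zero] mult_strict_left_mono[OF _ pi_gt_zero, of "real t / (2 * real r)" 1]
      by (simp_all only: mult_1_right)
    then have s: "sin (x / 2) > 0" by (rule sin_gt_zero)
    have "sin (real r * x) = 0" using r_pos by (simp add: x_def)
    then have "2 * sin (x / 2) * (1 + 2 * (\<Sum>i=1..<r. cos (real i * x)) + cos (real r * x)) = 0"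
      using trapezoid_cos[of x n] n by simp
    then have "1 + 2 * (\<Sum>i=1..<r. cos (real i * x)) + cos (real r * x) = 0" using s by simp
    then show ?thesis unfolding eq using False by simp
  qed
qed

lemma P_sum: "(\<Sum>i\<le>r. P i v) = v"
proof -
  have "(\<Sum>i\<le>r. P i v) = (\<Sum>i\<le>r. \<Sum>t<2 * r. (wt i * cos (real t * ang i)) *\<^sub>R (L ^^ t) v)"
    by (simp add: P_def scaleR_sum_right)
  also have "\<dots> = (\<Sum>t<2 * r. (\<Sum>i\<le>r. wt i * cos (real t * ang i)) *\<^sub>R (L ^^ t) v)"
    by (subst sum.swap) (simp add: scaleR_sum_left)
  also have "\<dots> = (\<Sum>t<2 * r. (if t = 0 then v else 0))"
    by (rule sum.cong) (auto simp: wt_sum)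
  also have "\<dots> = v" using r_pos by simp
  finally show ?thesis .
qed

lemma P_idem: "i \<le> r \<Longrightarrow> P i (P i v) = P i v"
proof -
  assume i: "i \<le> r"
  have "P i v = (\<Sum>j\<le>r. P j (P i v))" by (simp add: P_sum)
  also have "\<dots> = (\<Sum>j\<le>r. if j = i then P i (P i v) else 0)"
    by (rule sum.cong) (auto simp: P_P_zero i)
  finally show ?thesis using i by simp
qed

lemma L_P_0: "L (P 0 v) = P 0 v"
proof -
  have "(\<Sum>t<2 * r. (L ^^ Suc t) v) = (\<Sum>t<2 * r. (L ^^ t) v)"
    by (rule periodic_sum) (simp add: period)
  then show ?thesis by (simp add: P_def ang_def linear_scale[OF lin] linear_sum[OF lin])
qed

lemma L_P_r: "L (P r v) = - P r v"
proof -
  have c: "cos (real t * ang r) = (-1) ^ t" for t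
    using r_pos by (simp add: ang_def cos_npi)
  define f where "f t = ((-1) ^ t :: real) *\<^sub>R (L ^^ t) v" for t
  have "(\<Sum>t<2 * r. f (Suc t)) = (\<Sum>t<2 * r. f t)"
    by (rule periodic_sum) (simp add: f_def period)
  moreover have "L (P r v) = wt r *\<^sub>R (\<Sum>t<2 * r. - f (Suc t))"
    by (simp add: P_def c f_def linear_scale[OF lin] linear_sum[OF lin])
  moreover have "P r v = wt r *\<^sub>R (\<Sum>t<2 * r. f t)"
    by (simp add: P_def c f_def)
  ultimately show ?thesis by (simp only: sum_negf scaleR_minus_right)
qed

text \<open>Finds a point on the axis of the affine map with linear part \<open>L\<close> and
  constant \<open>b\<close>. The witness averages partial orbit sums, which \<open>L\<close> minus
  the identity telescopes to \<open>(L ^^ t) b - b\<close>.\<close>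

lemma fixed_part:
  obtains z where "L z + b - z = P 0 b"
proof -
  define z where "z = (1 / real (2 * r)) *\<^sub>R (\<Sum>t<2 * r. \<Sum>s<t. (L ^^ s) b)"
  have step: "L (\<Sum>s<t. (L ^^ s) b) - (\<Sum>s<t. (L ^^ s) b) = (L ^^ t) b - b" for t
    by (induction t) (simp_all add: linear_0[OF lin] linear_add[OF lin] algebra_simps)
  have "L z - z = (1 / real (2 * r)) *\<^sub>R (\<Sum>t<2 * r. (L (\<Sum>s<t. (L ^^ s) b) - (\<Sum>s<t. (L ^^ s) b)))"
    unfolding z_def linear_scale[OF lin] linear_sum[OF lin, of _ "{..<2 * r}"]
    by (simp add: scaleR_diff_right sum_subtractf)
  also have "\<dots> = (1 / real (2 * r)) *\<^sub>R (\<Sum>t<2 * r. (L ^^ t) b) - (1 / real (2 * r)) *\<^sub>R (\<Sum>t<2 * r. b)"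
    unfolding step by (simp add: sum_subtractf scaleR_diff_right)
  also have "(1 / real (2 * r)) *\<^sub>R (\<Sum>t<2 * r. (L ^^ t) b) = P 0 b"
    by (simp add: P_def wt_def ang_def)
  also have "(1 / real (2 * r)) *\<^sub>R (\<Sum>t<2 * r. b) = b"
    using r_pos by (simp add: sum_constant_scaleR)
  finally show thesis using that[of z] by (simp add: algebra_simps)
qed

end

section \<open>Reflection-invariant forms and finiteness of the linear group\<close>

context root_setting
begin

text \<open>Invariant under the reflections on the side of the roots, because these permute the
  coroots. It compares roots with coroots, which the dot product cannot do.\<close>

definition coform :: "'n vec \<Rightarrow> 'n vec \<Rightarrow> real" where
  "coform z y = (\<Sum>a\<in>Phi. (cor a \<bullet> z) * (cor a \<bullet> y))"

lemma reflect_bij: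
  assumes b: "b \<in> Phi"
  shows "bij_betw (\<lambda>a. a - (a \<bullet> cor b) *\<^sub>R b) Phi Phi"
proof (rule bij_betw_byWitness[where f' = "\<lambda>a. a - (a \<bullet> cor b) *\<^sub>R b"])
  show "\<forall>a\<in>Phi. (a - (a \<bullet> cor b) *\<^sub>R b) - ((a - (a \<bullet> cor b) *\<^sub>R b) \<bullet> cor b) *\<^sub>R b = a"
    "\<forall>a\<in>Phi. (a - (a \<bullet> cor b) *\<^sub>R b) - ((a - (a \<bullet> cor b) *\<^sub>R b) \<bullet> cor b) *\<^sub>R b = a"
    using root_cor[OF b] by (simp_all add: inner_diff_left algebra_simps)
qed (use root_reflect b in auto)

text \<open>The reflection negates \<open>b\<close>; expanding invariance at \<open>b\<close> turns
  pairing with \<open>cor b\<close> into \<open>coform b\<close> up to a positive factor.\<close>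

lemma coform_root:
  assumes b: "b \<in> Phi"
  shows "2 * coform b y = (y \<bullet> cor b) * coform b b" "coform b b > 0"
proof -
  define s where "s z = z - (z \<bullet> cor b) *\<^sub>R b" for z
  have inv: "coform (s z) (s y) = coform z y" for z y
  proof -
    have "cor (s a) \<bullet> z = cor a \<bullet> s z" if "a \<in> Phi" for a z
      using cor_reflect[OF b that] by (simp add: s_def inner_diff_left inner_diff_right inner_commute)
    then have "coform (s z) (s y) = (\<Sum>a\<in>Phi. (cor (s a) \<bullet> z) * (cor (s a) \<bullet> y))"
      unfolding coform_def by (intro sum.cong) simp_all
    also have "\<dots> = coform z y"
      unfolding coform_def using reflect_bij[OF b] by (intro sum.reindex_bij_betw) (simp add: s_def)
    finally show ?thesis .
  qed
  have sb: "s b = - b" using root_cor[OF b] by (simp add: s_def scaleR_2)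
  have "coform b y = coform (- b) (s y)" using inv[of b y] sb by simp
  also have "\<dots> = - coform b y + (y \<bullet> cor b) * coform b b"
    by (simp add: coform_def s_def inner_diff_right sum_negf[symmetric] sum.distrib[symmetric] sum_distrib_left algebra_simps)
  finally show "2 * coform b y = (y \<bullet> cor b) * coform b b" by simp
  have "(cor b \<bullet> b) * (cor b \<bullet> b) \<le> coform b b"
    unfolding coform_def using member_le_sum[OF b _ finite_Phi, of "\<lambda>a. (cor a \<bullet> b) * (cor a \<bullet> b)"] by simp
  then show "coform b b > 0" using root_cor[OF b] by (simp add: inner_commute)
qed

text \<open>The roots need not span, so vanishing on all roots is conclusive only on the span of the
  coroots. There \<open>x\<close> is represented by \<open>coform z\<close> with \<open>z\<close> in
  the span of the roots; hence \<open>coform z z = z \<bullet> x = 0\<close>, and as a sum of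
  squares this forces \<open>x = 0\<close>.\<close>

lemma coroot_span_nondegenerate:
  assumes x: "x \<in> span (cor ` Phi)" and x0: "\<And>a. a \<in> Phi \<Longrightarrow> a \<bullet> x = 0"
  shows "x = 0"
proof -
  have "\<exists>z. z \<in> span Phi \<and> (\<forall>y. y \<bullet> x = coform z y)"
    using x
  proof (induction rule: span_induct_alt)
    case base
    then show ?case by (intro exI[of _ 0]) (simp add: coform_def span_zero)
  next
    case (step c x y)
    then obtain b where b: "b \<in> Phi" "x = cor b" by blast
    from step obtain z where z: "z \<in> span Phi" "\<forall>u. u \<bullet> y = coform z u" by blast
    define k where "k = 2 * c / coform b b"
    have "u \<bullet> (c *\<^sub>R x + y) = coform (k *\<^sub>R b + z) u" for u
    proof -
      have "u \<bullet> cor b = 2 * coform b u / coform b b"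
        using coform_root(1)[OF b(1), of u] coform_root(2)[OF b(1)] by (simp add: field_simps)
      then have "u \<bullet> (c *\<^sub>R x + y) = k * coform b u + coform z u"
        using z(2) by (simp add: inner_add_right b(2) k_def)
      also have "\<dots> = coform (k *\<^sub>R b + z) u"
        by (simp add: coform_def inner_add_right sum_distrib_left sum.distrib[symmetric] algebra_simps)
      finally show ?thesis .
    qed
    moreover have "k *\<^sub>R b + z \<in> span Phi" using b z by (simp add: span_add span_scale span_base)
    ultimately show ?case by blast
  qed
  then obtain z where z: "z \<in> span Phi" "\<And>y. y \<bullet> x = coform z y" by blast
  have "z \<bullet> x = 0" using z(1) x0
    by (induction rule: span_induct_alt) (auto simp: inner_add_left)
  then have "coform z z = 0" using z(2) by simp
  then have "\<forall>a\<in>Phi. (cor a \<bullet> z) * (cor a \<bullet> z) = 0"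
    unfolding coform_def by (subst (asm) sum_nonneg_eq_0_iff[OF finite_Phi]) auto
  then have "coform z y = 0" for y by (simp add: coform_def)
  then have "x \<bullet> x = 0" using z(2) by simp
  then show ?thesis by simp
qed

lemma W0_displacement: "w \<in> W0 Phi cor \<Longrightarrow> w x - x \<in> span (cor ` Phi)"
proof (induction rule: W0.induct)
  case W0_id
  show ?case by (simp add: span_zero)
next
  case (W0_step w a)
  have "(sref cor a \<circ> w) x - x = (w x - x) - (a \<bullet> w x) *\<^sub>R cor a" by (simp add: sref_def)
  moreover have "(w x - x) - (a \<bullet> w x) *\<^sub>R cor a \<in> span (cor ` Phi)"
    using span_diff[OF W0_step(3) span_scale[OF span_base[OF imageI[OF W0_step(2)]]]] .
  ultimately show ?case by metis
qed

text \<open>An element is determined by the map it induces on the roots: two elements inducing the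
  same one differ at each point by a vector of the coroot span that every root kills.\<close>

lemma finite_W0: "finite (W0 Phi cor)"
proof -
  define f where "f g = restrict (adjoint g) Phi" for g :: "'n amap"
  have adj: "a \<bullet> g x = adjoint g a \<bullet> x" if "g \<in> W0 Phi cor" for a g x
    using adjoint_works[OF Lin_linear[OF W0_Lin[OF that]], of x a] by (simp add: inner_commute)
  have "f ` W0 Phi cor \<subseteq> Phi \<rightarrow>\<^sub>E Phi"
  proof
    fix k assume "k \<in> f ` W0 Phi cor"
    then obtain g where g: "g \<in> W0 Phi cor" "k = f g" by blast
    have "adjoint g a \<in> Phi" if "a \<in> Phi" for a
    proof -
      obtain b where b: "b \<in> Phi" "\<forall>x. a \<bullet> g x = b \<bullet> x" using Lin_root[OF W0_Lin[OF g(1)] \<open>a \<in> Phi\<close>] by blast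
      have "adjoint g a \<bullet> x = b \<bullet> x" for x using adj[OF g(1), of a x] b(2) by simp
      then have "adjoint g a = b" by (metis vector_eq_rdot inner_commute)
      then show ?thesis using b by simp
    qed
    then show "k \<in> Phi \<rightarrow>\<^sub>E Phi" by (simp add: g f_def)
  qed
  then have fin: "finite (f ` W0 Phi cor)" using finite_PiE[OF finite_Phi, of "\<lambda>_. Phi"] finite_Phi finite_subset by blast
  have "inj_on f (W0 Phi cor)"
  proof (rule inj_onI)
    fix g k assume gk: "g \<in> W0 Phi cor" "k \<in> W0 Phi cor" "f g = f k"
    show "g = k"
    proof (rule ext)
      fix x
      have "(g x - x) - (k x - x) \<in> span (cor ` Phi)" by (intro span_diff W0_displacement gk)
      then have "g x - k x \<in> span (cor ` Phi)" by simp
      moreover have "a \<bullet> (g x - k x) = 0" if "a \<in> Phi" for a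
      proof -
        have "adjoint g a = adjoint k a" using gk(3) that by (metis f_def restrict_apply')
        then show ?thesis using adj[OF gk(1)] adj[OF gk(2)] by (simp add: inner_diff_right)
      qed
      ultimately show "g x = k x" using coroot_span_nondegenerate by fastforce
    qed
  qed
  then show ?thesis using fin finite_imageD by blast
qed

lemma finite_Lin: "finite Lin"
proof -
  have "Lin = (\<lambda>(w, d). w \<circ> d) ` (W0 Phi cor \<times> D)" by (auto simp: Lin_def)
  then show ?thesis using finite_W0 finite_D by simp
qed

lemma Lin_funpow: "l \<in> Lin \<Longrightarrow> l ^^ n \<in> Lin"
proof (induction n)
  case 0
  show ?case using Lin_id by (simp add: id_def[symmetric])
next
  case (Suc n)
  then have "l \<circ> l ^^ n \<in> Lin" by (intro Lin_comp)
  then show ?case unfolding funpow.simps .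
qed

lemma Lin_finite_order:
  assumes l: "l \<in> Lin"
  obtains n where "n > 0" "l ^^ n = id"
proof -
  have "range (\<lambda>n. l ^^ n) \<subseteq> Lin" using Lin_funpow[OF l] by blast
  then have "finite (range (\<lambda>n::nat. l ^^ n))" using finite_Lin finite_subset by blast
  then have "\<not> inj (\<lambda>n::nat. l ^^ n)" using finite_imageD infinite_UNIV_nat by blast
  then obtain i j where "i < j" "l ^^ i = l ^^ j"
    unfolding inj_def by (metis nat_neq_iff)
  moreover from \<open>i < j\<close> have "l ^^ j = l ^^ i \<circ> l ^^ (j - i)"
    using funpow_add[of i "j - i" l] by simp
  ultimately have "l ^^ i \<circ> l ^^ (j - i) = l ^^ i \<circ> id" by simp
  then have "l ^^ (j - i) = id"
    using G_cancel_left[OF Lin_G[OF Lin_funpow[OF l, of i]]] by blast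
  then show thesis using that[of "j - i"] \<open>i < j\<close> by simp
qed

end

section \<open>Descent to good alcoves\<close>

lemma sgn_eq_mult: "sgn (x::real) = sgn y \<Longrightarrow> x * z > 0 \<longleftrightarrow> y * z > 0"
  "sgn (x::real) = sgn y \<Longrightarrow> x * z < 0 \<longleftrightarrow> y * z < 0"
  "sgn (x::real) = sgn y \<Longrightarrow> x = 0 \<longleftrightarrow> y = 0"
  by (auto simp: sgn_real_def zero_less_mult_iff mult_less_0_iff split: if_splits)

text \<open>\<open>w\<close> is a screw motion: it moves \<open>org\<close> by \<open>nu\<close>,
  which the linear part \<open>L\<close> fixes, so that it translates along \<open>nu\<close>
  through \<open>org\<close>; \<open>nu\<close> may be 0.\<close>

locale motion = hecke_setting Phi Delta cor D sc T + finite_order_map L r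
  for Phi Delta :: "'n::finite vec set"
    and cor :: "'n vec \<Rightarrow> 'n vec"
    and D :: "'n amap set"
    and sc :: "laurent \<Rightarrow> 'h::ring_1 \<Rightarrow> 'h"
    and T :: "'n amap \<Rightarrow> 'h"
    and L :: "'n vec \<Rightarrow> 'n vec" and r :: nat +
  fixes w :: "'n amap" and org nu :: "'n vec"
  assumes wG: "w \<in> G" and L_Lin: "L \<in> Lin" and w_org: "\<And>v. w (org + v) = org + (nu + L v)" and L_nu: "L nu = nu"
begin

text \<open>The inverse of \<open>L\<close>, written as a power so that linearity and commutation
  with \<open>P\<close> are inherited.\<close>

definition Li :: "'n vec \<Rightarrow> 'n vec" where "Li = L ^^ (2 * r - 1)"

lemma L_Li: "L (Li v) = v" and Li_L: "Li (L v) = v"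
proof -
  have "Suc (2 * r - 1) = 2 * r" using r_pos by simp
  then show "L (Li v) = v" "Li (L v) = v"
    using period funpow.simps(2)[of "2 * r - 1" L] funpow_Suc_right[of "2 * r - 1" L]
    by (auto simp: Li_def fun_eq_iff)
qed

lemma Li_linear: "linear Li" unfolding Li_def by (rule pow_linear)

lemma P_Li: "Li (P i v) = P i (Li v)" unfolding Li_def by (rule P_pow)

lemma inv_w_org: "inv w (org + v) = org + (Li v - nu)"
proof -
  have "w (org + (Li v - nu)) = org + v" by (simp add: w_org linear_diff[OF lin] L_Li L_nu)
  then show ?thesis using wG by (metis G_inv_apply(1))
qed

lemma L_plus_Li: "L (P i v) + Li (P i v) = ev i *\<^sub>R P i v"
  using arg_cong[OF P_eigen[of i v], of Li]
  by (simp add: linear_add[OF Li_linear] linear_scale[OF Li_linear] Li_L)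

lemma L_plus_Li_sum: "L v + Li v = (\<Sum>j\<le>r. ev j *\<^sub>R P j v)"
proof -
  have "L v + Li v = L (\<Sum>j\<le>r. P j v) + Li (\<Sum>j\<le>r. P j v)" by (simp add: P_sum)
  then show ?thesis
    by (simp add: linear_sum[OF lin] linear_sum[OF Li_linear] sum.distrib[symmetric] L_plus_Li)
qed

text \<open>The direction of F_i: the sum of the parts with angle at most
  \<open>ang i\<close>.\<close>

definition U :: "nat \<Rightarrow> 'n vec set" where "U i = {v. \<forall>j. i < j \<and> j \<le> r \<longrightarrow> P j v = 0}"

lemma U_add: "\<lbrakk>u \<in> U i; v \<in> U i\<rbrakk> \<Longrightarrow> u + v \<in> U i"
  and U_diff: "\<lbrakk>u \<in> U i; v \<in> U i\<rbrakk> \<Longrightarrow> u - v \<in> U i"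
  and U_scale: "u \<in> U i \<Longrightarrow> t *\<^sub>R u \<in> U i"
  and U_zero: "0 \<in> U i"
  by (auto simp: U_def linear_add[OF P_linear] linear_diff[OF P_linear] linear_scale[OF P_linear])

lemma U_mono: "i \<le> j \<Longrightarrow> U i \<subseteq> U j" by (auto simp: U_def)

lemma U_r: "U r = UNIV" by (auto simp: U_def)

lemma U_L: "v \<in> U i \<Longrightarrow> L v \<in> U i" and U_Li: "v \<in> U i \<Longrightarrow> Li v \<in> U i"
  by (auto simp: U_def L_P[symmetric] P_Li[symmetric] linear_0[OF lin] linear_0[OF Li_linear])

lemma P_U: "i \<le> r \<Longrightarrow> j \<le> i \<Longrightarrow> P j v \<in> U i" by (auto simp: U_def P_P_zero)

lemma nu_U: "nu \<in> U i"
proof -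
  have "P j nu = 0" if "0 < j" "j \<le> r" for j
    by (rule eigen_P_zero[of nu 0]) (use that in \<open>simp_all add: L_nu ev_0 scaleR_2\<close>)
  then have "nu \<in> U 0" by (simp add: U_def)
  then show ?thesis using U_mono[of 0 i] by blast
qed

definition proj :: "nat \<Rightarrow> 'n vec \<Rightarrow> 'n vec" where "proj i v = (\<Sum>j\<le>i. P j v)"

lemma proj_linear: "linear (proj i)"
  unfolding proj_def by (intro linear_compose_sum ballI P_linear)

lemma proj_U: "i \<le> r \<Longrightarrow> proj i v \<in> U i"
  by (auto simp: U_def proj_def linear_sum[OF P_linear] P_P_zero)

lemma P_proj: "\<lbrakk>i \<le> r; j \<le> i\<rbrakk> \<Longrightarrow> P j (proj i v) = P j v"
proof -
  assume ij: "i \<le> r" "j \<le> i"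
  have "P j (proj i v) = (\<Sum>k\<le>i. if k = j then P j v else 0)"
    unfolding proj_def linear_sum[OF P_linear] using ij
    by (intro sum.cong) (auto simp: P_idem P_P_zero)
  then show ?thesis using ij by simp
qed

lemma proj_id: "\<lbrakk>i \<le> r; v \<in> U i\<rbrakk> \<Longrightarrow> proj i v = v"
proof -
  assume i: "i \<le> r" "v \<in> U i"
  have "(\<Sum>j\<le>r. P j v) = proj i v"
    unfolding proj_def using i by (intro sum.mono_neutral_right) (auto simp: U_def)
  then show ?thesis by (simp add: P_sum)
qed

definition contains :: "'n vec \<times> int \<Rightarrow> nat \<Rightarrow> bool" where
  "contains h i \<longleftrightarrow> (\<forall>v\<in>U i. hv h (org + v) = 0)"

lemma contains_org: "contains h i \<Longrightarrow> hv h org = 0"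
  using U_zero by (force simp: contains_def)

lemma contains_dir: "\<lbrakk>contains h i; v \<in> U i\<rbrakk> \<Longrightarrow> fst h \<bullet> v = 0"
  using contains_org[of h i] by (simp add: contains_def hv_add)

lemma contains_mono: "\<lbrakk>contains h j; i \<le> j\<rbrakk> \<Longrightarrow> contains h i"
  using U_mono by (auto simp: contains_def)

text \<open>The index is shifted: \<open>HX i\<close> consists of the hyperplanes containing \<open>F\<^bsub>i-1\<^esub>\<close>.\<close>

fun HX :: "nat \<Rightarrow> ('n vec \<times> int) set" where
  "HX 0 = HP" | "HX (Suc i) = {h\<in>HP. contains h i}"

lemma HX_HP: "h \<in> HX i \<Longrightarrow> h \<in> HP" by (cases i) auto

lemma HX_contains: "\<lbrakk>h \<in> HX i; j < i\<rbrakk> \<Longrightarrow> contains h j"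
  by (cases i) (auto intro: contains_mono)

text \<open>F_(i-1) is stable under \<open>w\<close> and \<open>inv w\<close>, because
  \<open>nu\<close> lies in every \<open>U i\<close>; hence so is the set of hyperplanes containing
  it.\<close>

lemma HX_pull:
  assumes "g = w \<or> g = inv w" and h: "h \<in> HX i" and h': "h' \<in> HP" "\<sigma> = 1 \<or> \<sigma> = (-1::real)"
    "\<And>x. hv h (g x) = \<sigma> * hv h' x"
  shows "h' \<in> HX i"
proof (cases i)
  case (Suc k)
  have "hv h' (org + v) = 0" if v: "v \<in> U k" for v
  proof -
    obtain u where u: "u \<in> U k" "g (org + v) = org + u"
      using assms(1) v U_add[OF nu_U U_L] U_diff[OF U_Li nu_U] w_org inv_w_org by metis
    have "hv h (g (org + v)) = 0" using h Suc u by (auto simp: contains_def)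
    then show ?thesis using h'(2,3) by auto
  qed
  then show ?thesis using Suc h'(1) by (simp add: contains_def)
qed (use h' in simp)

text \<open>\<open>q\<close> lies in the closure of the alcove of \<open>p\<close> as far as the
  hyperplanes in \<open>HX i\<close> can tell.\<close>

definition adhX :: "nat \<Rightarrow> 'n vec \<Rightarrow> 'n vec \<Rightarrow> bool" where
  "adhX i p q \<longleftrightarrow> (\<forall>h\<in>HX i. hv h q \<noteq> 0 \<longrightarrow> hv h q * hv h p > 0)"

lemma adhX_image:
  assumes g: "g = w \<or> g = inv w" and a: "adhX i p q" and h: "h \<in> HX i" "hv h (g q) \<noteq> 0"
  shows "hv h (g q) * hv h (g p) > 0"
proof -
  have "g \<in> G" using g wG G_inv by blast
  then obtain h' \<sigma> where h': "h' \<in> HP" "\<sigma> = 1 \<or> \<sigma> = (-1::real)" "\<And>x. hv h (g x) = \<sigma> * hv h' x"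
    using hv_pull[OF _ HX_HP[OF h(1)]] by metis
  have "h' \<in> HX i" by (rule HX_pull[OF g h(1) h'])
  moreover have "hv h' q \<noteq> 0" using h(2) unfolding h'(3) by auto
  ultimately have "hv h' q * hv h' p > 0" using a by (auto simp: adhX_def)
  then show ?thesis using h'(2) unfolding h'(3) by auto
qed

text \<open>Since \<open>hv h q = 0\<close>, any multiple of it may be subtracted; the multiple
  \<open>ev i\<close> removes the component of index \<open>i\<close>. Components of smaller index
  are invisible to \<open>h\<close>, which contains F_(i-1). What remains has negative coefficients
  \<open>ev j - ev i\<close>.\<close>

lemma descent_direction:
  assumes i: "i \<le> r" and h: "h \<in> HX i" and q: "hv h q = 0"
  shows "hv h (w q) + hv h (inv w q) = fst h \<bullet> (\<Sum>j\<in>{i<..r}. (ev j - ev i) *\<^sub>R P j (q - org))"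
proof -
  define v where "v = q - org"
  have qv: "q = org + v" by (simp add: v_def)
  have sum0: "hv h (w q) + hv h (inv w q) = 2 * hv h org + fst h \<bullet> (L v + Li v)"
    unfolding qv w_org inv_w_org hv_add by (simp add: inner_add_right inner_diff_right)
  have eq0: "hv h org = - (fst h \<bullet> v)" using q unfolding qv hv_add by simp
  have "hv h (w q) + hv h (inv w q) = fst h \<bullet> (L v + Li v - ev i *\<^sub>R v)"
  \<comment> \<open>For \<open>i = 0\<close> the constant \<open>hv h org\<close> cancels because
    \<open>ev 0 = 2\<close>; for larger \<open>i\<close> it is 0.\<close>
  proof (cases i)
    case 0
    then show ?thesis unfolding sum0 eq0 by (simp add: ev_0 inner_diff_right)
  next
    case (Suc k)
    have "hv h org = 0" using HX_contains[OF h, of k] Suc contains_org by blast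
    then show ?thesis unfolding sum0 using eq0 by (simp add: inner_diff_right)
  qed
  also have "L v + Li v - ev i *\<^sub>R v = (\<Sum>j\<le>r. (ev j - ev i) *\<^sub>R P j v)"
  proof -
    have "ev i *\<^sub>R v = (\<Sum>j\<le>r. ev i *\<^sub>R P j v)" by (simp add: scaleR_sum_right[symmetric] P_sum)
    then show ?thesis by (simp add: L_plus_Li_sum sum_subtractf scaleR_diff_left)
  qed
  also have "fst h \<bullet> \<dots> = (\<Sum>j\<le>r. (ev j - ev i) * (fst h \<bullet> P j v))" by (simp add: inner_sum_right)
  also have "\<dots> = (\<Sum>j\<in>{i<..r}. (ev j - ev i) * (fst h \<bullet> P j v))"
  proof (rule sum.mono_neutral_right)
    show "\<forall>j\<in>{..r} - {i<..r}. (ev j - ev i) * (fst h \<bullet> P j v) = 0"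
    proof
      fix j assume "j \<in> {..r} - {i<..r}"
      then have "j = i \<or> j < i" by auto
      then show "(ev j - ev i) * (fst h \<bullet> P j v) = 0"
        using contains_dir[OF HX_contains[OF h, of j] P_U[of j j v]] i by auto
    qed
  qed auto
  also have "\<dots> = fst h \<bullet> (\<Sum>j\<in>{i<..r}. (ev j - ev i) *\<^sub>R P j v)" by (simp add: inner_sum_right)
  finally show ?thesis unfolding v_def .
qed

definition regular :: "nat \<Rightarrow> 'n vec \<Rightarrow> bool" where
  "regular i x \<longleftrightarrow> x - org \<in> U i \<and> (\<forall>h\<in>HP. hv h x = 0 \<longrightarrow> contains h i)"

definition adh :: "'n vec \<Rightarrow> 'n vec \<Rightarrow> bool" where
  "adh p x \<longleftrightarrow> (\<forall>h\<in>HP. hv h x \<noteq> 0 \<longrightarrow> hv h x * hv h p > 0)"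

definition goodat :: "nat \<Rightarrow> 'n vec \<Rightarrow> bool" where
  "goodat i p \<longleftrightarrow> (\<exists>x. regular i x \<and> adh p x)"

lemma regular_zero_iff: "regular i x \<Longrightarrow> h \<in> HP \<Longrightarrow> hv h x = 0 \<longleftrightarrow> contains h i"
  unfolding regular_def contains_def by (metis add_diff_cancel_left' diff_add_cancel add.commute)

lemma same_sign: "\<lbrakk>generic p; generic q; h \<in> HP; h \<notin> sep p q\<rbrakk> \<Longrightarrow> hv h p * hv h q > 0"
proof -
  assume a: "generic p" "generic q" "h \<in> HP" "h \<notin> sep p q"
  then have "hv h p * hv h q \<noteq> 0" "\<not> hv h p * hv h q < 0" by (auto simp: generic_def sep_def simp del: mult_less_0_iff)
  then show ?thesis by linarith
qed

text \<open>Hyperplanes of \<open>HX i\<close> contain F_j for \<open>j < i\<close>, so they vanish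
  at its regular points, and crossing them does not disturb the witness.\<close>

lemma goodat_cong:
  assumes p: "generic p" "generic q" and s: "sep p q \<subseteq> HX i" and j: "j < i" and g: "goodat j p"
  shows "goodat j q"
proof -
  obtain x where x: "regular j x" "adh p x" using g by (auto simp: goodat_def)
  have "hv h x * hv h q > 0" if h: "h \<in> HP" "hv h x \<noteq> 0" for h
  proof -
    have "h \<notin> sep p q" using s HX_contains[of h i j] j regular_zero_iff[OF x(1) h(1)] h(2) by blast
    then have "hv h p * hv h q > 0" using same_sign p h by blast
    moreover have "hv h x * hv h p > 0" using x(2) h by (simp add: adh_def)
    ultimately show ?thesis by (auto simp: zero_less_mult_iff)
  qed
  then show ?thesis using x(1) by (auto simp: goodat_def adh_def)
qed

text \<open>Contracting towards a regular point of \<open>F\<^bsub>i-1\<^esub>\<close> realises any sign pattern on the hyperplanes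
  containing \<open>F\<^bsub>i-1\<^esub>\<close> while keeping all other signs.\<close>

lemma retract:
  assumes p: "\<And>j. j < i \<Longrightarrow> goodat j p"
  obtains z' where "\<And>h. h \<in> HX i \<Longrightarrow> sgn (hv h z') = sgn (hv h z)"
    "\<And>h. \<lbrakk>h \<in> HP; h \<notin> HX i\<rbrakk> \<Longrightarrow> hv h z' * hv h p > 0"
    "z - org \<in> U i \<Longrightarrow> z' - org \<in> U i"
proof (cases i)
  case 0
  then show ?thesis using that[of z] by simp
next
  case (Suc k)
  obtain x where x: "regular k x" "adh p x" using p[of k] Suc by (auto simp: goodat_def)
  obtain t :: real where t: "0 < t" "t < 1"
    "\<And>h. \<lbrakk>h \<in> HP; hv h x \<noteq> 0\<rbrakk> \<Longrightarrow> hv h (x + t *\<^sub>R (z - x)) * hv h x > 0"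
    using hv_sign_ray_ex[of 1 x "z - x"] by auto
  have 1: "sgn (hv h (x + t *\<^sub>R (z - x))) = sgn (hv h z)" if "h \<in> HX i" for h
  proof -
    have "hv h x = 0" using regular_zero_iff[OF x(1)] that Suc by simp
    then show ?thesis unfolding hv_affine using t(1) by (simp add: sgn_mult)
  qed
  have 2: "hv h (x + t *\<^sub>R (z - x)) * hv h p > 0" if h: "h \<in> HP" "h \<notin> HX i" for h
  proof -
    have n: "hv h x \<noteq> 0" using regular_zero_iff[OF x(1) h(1)] h Suc by simp
    then show ?thesis using t(3)[OF h(1) n] x(2) h(1) unfolding adh_def
      by (metis mult_less_cancel_right_pos zero_less_mult_iff not_less_iff_gr_or_eq)
  qed
  have 3: "x + t *\<^sub>R (z - x) - org \<in> U i" if "z - org \<in> U i"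
  proof -
    have "x - org \<in> U i" using x(1) U_mono[of k i] Suc by (auto simp: regular_def)
    then have "(x - org) + t *\<^sub>R ((z - org) - (x - org)) \<in> U i"
      using U_add[OF _ U_scale[OF U_diff[OF that]]] by blast
    then show ?thesis by (simp add: algebra_simps)
  qed
  show ?thesis using that 1 2 3 by blast
qed

text \<open>Measured by components instead of the plain norm: the descent step rescales each
  component by its own factor, which need not shorten the vector in the dot product norm.\<close>

definition nrm :: "'n vec \<Rightarrow> real" where "nrm v = (\<Sum>j\<le>r. (norm (P j v))\<^sup>2)"

lemma nrm_continuous: "continuous_on S (\<lambda>q. nrm (q - c))"
proof -
  have "continuous_on S (\<lambda>q. P j (q - c))" for j
    by (intro continuous_on_compose2[OF linear_continuous_on[OF linear_conv_bounded_linear[THEN iffD1, OF P_linear], of UNIV]]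
      continuous_intros) auto
  then show ?thesis unfolding nrm_def by (intro continuous_intros)
qed

lemma norm_le_nrm: "norm v \<le> (\<Sum>j\<le>r. sqrt (nrm v))"
proof -
  have "norm v \<le> (\<Sum>j\<le>r. norm (P j v))" using norm_sum[of "\<lambda>j. P j v" "{..r}"] by (simp add: P_sum)
  also have "\<dots> \<le> (\<Sum>j\<le>r. sqrt (nrm v))"
  proof (rule sum_mono)
    fix j assume "j \<in> {..r}"
    then have "(norm (P j v))\<^sup>2 \<le> nrm v"
      unfolding nrm_def using member_le_sum[of j "{..r}" "\<lambda>j. (norm (P j v))\<^sup>2"] by simp
    then show "norm (P j v) \<le> sqrt (nrm v)" using real_le_rsqrt by blast
  qed
  finally show ?thesis .
qed

lemma exists_nonzero_component: "v \<noteq> 0 \<Longrightarrow> \<exists>j\<le>r. P j v \<noteq> 0"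
  using P_sum[of v] by (metis atMost_iff sum.neutral)

lemma finite_through: "finite {h\<in>HP. hv h y = 0}"
proof (rule finite_subset)
  show "{h\<in>HP. hv h y = 0} \<subseteq> (\<lambda>a. (a, \<lfloor>a \<bullet> y\<rfloor>)) ` Pos"
    by (auto simp: HP_def hv_def image_iff)
qed (simp add: finite_Pos)

text \<open>Only finitely many hyperplanes pass through the projection of \<open>p\<close>; a small
  move of \<open>p\<close> inside its alcove takes the projection off those that do not contain
  F_i.\<close>

lemma proj_regular_perturb:
  assumes p: "generic p" and i: "i \<le> r"
  obtains p1 where "generic p1" "sep p p1 = {}" "regular i (org + proj i (p1 - org))"
proof -
  define Q where "Q z = org + proj i (z - org)" for z
  have Qc: "continuous_on S Q" for S
    unfolding Q_def
    by (intro continuous_intros continuous_on_compose2[OF linear_continuous_on[OF linear_conv_bounded_linear[THEN iffD1, OF proj_linear], of UNIV]]) auto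
  have Qaff: "Q (x + t *\<^sub>R (y - x)) = Q x + t *\<^sub>R (Q y - Q x)" for x y t
  proof -
    have "x + t *\<^sub>R (y - x) - org = (x - org) + t *\<^sub>R ((y - org) - (x - org))" by simp
    then have "proj i (x + t *\<^sub>R (y - x) - org) = proj i (x - org) + t *\<^sub>R (proj i (y - org) - proj i (x - org))"
      by (simp only: linear_add[OF proj_linear] linear_scale[OF proj_linear] linear_diff[OF proj_linear])
    then show ?thesis by (simp add: Q_def)
  qed
  obtain S1 where S1: "open S1" "p \<in> S1" "\<And>y h. \<lbrakk>y \<in> S1; h \<in> HP\<rbrakk> \<Longrightarrow> hv h y * hv h p > 0"
    using hv_sign_nhds[of p] p unfolding eventually_nhds generic_def by blast
  obtain S2 where S2: "open S2" "Q p \<in> S2" "\<And>y h. \<lbrakk>y \<in> S2; h \<in> HP; hv h (Q p) \<noteq> 0\<rbrakk> \<Longrightarrow> hv h y * hv h (Q p) > 0"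
    using hv_sign_nhds[of "Q p"] unfolding eventually_nhds by blast
  \<comment> \<open>\<open>S1\<close> keeps the point in its alcove, and \<open>S2\<close> keeps its
    projection off the hyperplanes that missed it before.\<close>
  have oS: "open (S1 \<inter> Q -` S2)"
    using S1(1) continuous_open_vimage[OF S2(1), of Q] Qc[of UNIV] by (auto simp: continuous_on_eq_continuous_at intro!: open_Int)
  define \<Psi> where "\<Psi> = (\<lambda>h z. hv h (Q z)) ` {h\<in>HP. hv h (Q p) = 0 \<and> \<not> contains h i}"
  have "\<exists>z\<in>UNIV \<inter> (S1 \<inter> Q -` S2). \<forall>\<psi>\<in>\<Psi>. \<psi> z \<noteq> 0"
  proof (rule avoid_affine_zeros[where ?x0.0=p])
    have "finite {h\<in>HP. hv h (Q p) = 0 \<and> \<not> contains h i}"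
      by (rule finite_subset[OF _ finite_through[of "Q p"]]) auto
    then show "finite \<Psi>" by (simp add: \<Psi>_def)
    fix \<psi> assume "\<psi> \<in> \<Psi>"
    then obtain h where h: "h \<in> HP" "\<not> contains h i" and \<psi>: "\<psi> = (\<lambda>z. hv h (Q z))" by (auto simp: \<Psi>_def)
    show "\<psi> (x + t *\<^sub>R (y - x)) = \<psi> x + t * (\<psi> y - \<psi> x)" for x y t
      unfolding \<psi> Qaff hv_affine ..
    show "continuous_on UNIV \<psi>" unfolding \<psi>
      by (rule continuous_on_compose2[OF continuous_hv Qc]) auto
    obtain u where u: "u \<in> U i" "hv h (org + u) \<noteq> 0" using h(2) by (auto simp: contains_def)
    then show "\<exists>z\<in>UNIV. \<psi> z \<noteq> 0"
      by (intro bexI[of _ "org + u"]) (auto simp: \<psi> Q_def proj_id[OF i])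
  qed (use S1 S2 oS in auto)
  then obtain z where z: "z \<in> S1" "Q z \<in> S2" "\<forall>\<psi>\<in>\<Psi>. \<psi> z \<noteq> 0" by auto
  have zp: "hv h z * hv h p > 0" if "h \<in> HP" for h using S1(3)[OF z(1) that] .
  have "generic z" unfolding generic_def using zp by fastforce
  moreover have "sep p z = {}" using zp by (force simp: sep_def mult.commute)
  moreover have "regular i (Q z)"
    unfolding regular_def
  proof (intro conjI ballI impI)
    show "Q z - org \<in> U i" using proj_U[OF i] by (simp add: Q_def)
    fix h assume h: "h \<in> HP" "hv h (Q z) = 0"
    then have 0: "hv h (Q p) = 0" using S2(3)[OF z(2) h(1)] by force
    show "contains h i"
    proof (rule ccontr)
      assume "\<not> contains h i"
      then have "(\<lambda>z. hv h (Q z)) \<in> \<Psi>" unfolding \<Psi>_def by (intro imageI CollectI conjI h(1) 0)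
      from bspec[OF z(3) this] h(2) show False by simp
    qed
  qed
  ultimately show thesis using that by (simp add: Q_def)
qed

text \<open>Among the points with fixed \<open>F\<^sub>i\<close>-projection in the closures of reachable alcoves, one nearest to
  \<open>F\<^sub>i\<close> exists by compactness; off \<open>F\<^sub>i\<close> the descent direction would bring it closer.\<close>

lemma stage:
  assumes p: "generic p" and i: "i \<le> r" and good: "\<And>j. j < i \<Longrightarrow> goodat j p"
  obtains p' where "generic p'" "red w p p'" "\<And>j. j \<le> i \<Longrightarrow> goodat j p'"
proof -
  obtain p1 where p1: "generic p1" "sep p p1 = {}" "regular i (org + proj i (p1 - org))"
    using proj_regular_perturb[OF p i] by metis
  have good1: "goodat j p1" if "j < i" for j
    using goodat_cong[OF p p1(1) _ that good[OF that]] p1(2) by simp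
  have red1: "red w p p1" by (rule red_same[OF wG p p1(1,2)])
  define u' where "u' = proj i (p1 - org)"
  define x' where "x' = org + u'"
  have u'U: "u' \<in> U i" unfolding u'_def by (rule proj_U[OF i])
  \<comment> \<open>Crossing only walls of \<open>HX i\<close> preserves the goodness obtained at
    earlier stages.\<close>
  define reach where "reach d \<longleftrightarrow> generic d \<and> red w p1 d \<and> sep p1 d \<subseteq> HX i" for d
  define M where "M = {q. proj i (q - org) = u' \<and> nrm (q - x') \<le> nrm (p1 - x') \<and> (\<exists>d. reach d \<and> adhX i d q)}"
  have p1M: "p1 \<in> M"
  proof -
    have "reach p1" by (simp add: reach_def p1 red_refl)
    moreover have "adhX i p1 p1"
      unfolding adhX_def by (intro ballI impI) (simp add: zero_less_mult_iff, linarith)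
    ultimately show ?thesis by (auto simp: M_def u'_def)
  qed
  have "closed M"
    unfolding closed_sequential_limits
  proof (intro allI impI, elim conjE)
    fix f q assume f: "\<forall>n. f n \<in> M" and lim: "f \<longlonglongrightarrow> q"
    have "continuous_on UNIV (\<lambda>q. proj i (q - org))"
      by (intro continuous_intros continuous_on_compose2[OF linear_continuous_on[OF linear_conv_bounded_linear[THEN iffD1, OF proj_linear], of UNIV]]) auto
    then have "(\<lambda>n. proj i (f n - org)) \<longlonglongrightarrow> proj i (q - org)"
      using continuous_on_tendsto_compose[OF _ lim, of UNIV "\<lambda>q. proj i (q - org)"] by simp
    moreover have "(\<lambda>n. proj i (f n - org)) = (\<lambda>n. u')" using f by (auto simp: M_def)
    ultimately have 1: "proj i (q - org) = u'" using LIMSEQ_unique tendsto_const by metis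
    have "(\<lambda>n. nrm (f n - x')) \<longlonglongrightarrow> nrm (q - x')"
      using continuous_on_tendsto_compose[OF nrm_continuous[of UNIV x'] lim] by simp
    then have 2: "nrm (q - x') \<le> nrm (p1 - x')"
      by (rule LIMSEQ_le_const2) (use f in \<open>auto simp: M_def\<close>)
    have "\<forall>\<^sub>F n in sequentially. \<forall>h\<in>HP. hv h q \<noteq> 0 \<longrightarrow> hv h (f n) * hv h q > 0"
      using eventually_compose_filterlim[OF hv_sign_nhds lim] .
    from eventually_happens'[OF trivial_limit_sequentially this]
    obtain n where n: "\<forall>h\<in>HP. hv h q \<noteq> 0 \<longrightarrow> hv h (f n) * hv h q > 0" ..
    \<comment> \<open>Off the hyperplanes through the limit \<open>q\<close>, the late term
      \<open>f n\<close> has the signs of \<open>q\<close>, so an alcove adherent to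
      \<open>f n\<close> is adherent to \<open>q\<close>.\<close>
    have "\<exists>d. reach d \<and> adhX i d (f n)" using f unfolding M_def by simp
    then obtain d where d: "reach d" "adhX i d (f n)" by (elim exE conjE)
    have "hv h q * hv h d > 0" if h: "h \<in> HX i" "hv h q \<noteq> 0" for h
    proof -
      have a: "hv h (f n) * hv h q > 0" using n HX_HP[OF h(1)] h(2) by blast
      then have "hv h (f n) * hv h d > 0" using d(2) h(1) by (auto simp: adhX_def)
      with a show ?thesis by (auto simp: zero_less_mult_iff)
    qed
    then have "adhX i d q" by (simp add: adhX_def)
    then show "q \<in> M" using 1 2 d(1) by (auto simp: M_def)
  qed
  moreover have "bounded M"
  proof (rule boundedI)
    fix q assume "q \<in> M"
    then have "nrm (q - x') \<le> nrm (p1 - x')" by (simp add: M_def)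
    then have "(\<Sum>j\<le>r. sqrt (nrm (q - x'))) \<le> (\<Sum>j\<le>r. sqrt (nrm (p1 - x')))"
      by (intro sum_mono) simp
    then show "norm q \<le> norm x' + (\<Sum>j\<le>r. sqrt (nrm (p1 - x')))"
      using norm_le_nrm[of "q - x'"] norm_triangle_sub[of q x'] by linarith
  qed
  ultimately have "compact M" by (simp add: compact_eq_bounded_closed)
  then obtain q where q: "q \<in> M" "\<And>y. y \<in> M \<Longrightarrow> nrm (q - x') \<le> nrm (y - x')"
    using continuous_attains_inf[OF _ _ nrm_continuous[of M x']] p1M by blast
  obtain d where d: "reach d" "adhX i d q" using q(1) by (auto simp: M_def)
  have gd: "generic d" and dHX: "sep p1 d \<subseteq> HX i" and redd: "red w p1 d" using d(1) by (auto simp: reach_def)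
  have p1d: "hv h p1 * hv h d > 0" if "h \<in> HP" "h \<notin> HX i" for h
    using same_sign[OF p1(1) gd that(1)] dHX that(2) by blast
  have "q = x'"
  proof (rule ccontr)
    assume "q \<noteq> x'"
    define z where "z = q - x'"
    have z0: "z \<noteq> 0" using \<open>q \<noteq> x'\<close> by (simp add: z_def)
    have pz: "proj i z = 0"
    proof -
      have "z = (q - org) - u'" by (simp add: z_def x'_def)
      then have "proj i z = proj i (q - org) - proj i u'" by (simp add: linear_diff[OF proj_linear])
      then show ?thesis using q(1) proj_id[OF i u'U] by (simp add: M_def)
    qed
    have Pz0: "P j z = 0" if "j \<le> i" for j using P_proj[OF i that, of z] pz by simp
    have Pz: "P j z = P j (q - org)" if "i < j" "j \<le> r" for j
    proof -
      have "P j u' = 0" using u'U that by (simp add: U_def)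
      moreover have "z = (q - org) - u'" by (simp add: z_def x'_def)
      ultimately show ?thesis by (simp add: linear_diff[OF P_linear])
    qed
    \<comment> \<open>The vector of \<open>descent_direction\<close> at \<open>q\<close>: it shrinks
      every component beyond \<open>i\<close>.\<close>
    define g where "g = (\<Sum>j\<in>{i<..r}. (ev j - ev i) *\<^sub>R P j z)"
    have g: "g = (\<Sum>j\<in>{i<..r}. (ev j - ev i) *\<^sub>R P j (q - org))"
      unfolding g_def by (rule sum.cong) (auto simp: Pz)
    have Pg: "P j g = (if i < j then (ev j - ev i) *\<^sub>R P j z else 0)" if j: "j \<le> r" for j
    proof -
      have "P j g = (\<Sum>k\<in>{i<..r}. if k = j then (ev j - ev i) *\<^sub>R P j z else 0)"
        unfolding g_def linear_sum[OF P_linear] linear_scale[OF P_linear]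
        by (rule sum.cong) (use j in \<open>auto simp: P_idem P_P_zero\<close>)
      then show ?thesis using j by simp
    qed
    \<comment> \<open>The values of \<open>ev\<close> lie between -2 and 2, so
      \<open>t < 1 / 8\<close> keeps every factor \<open>1 + t * (ev j - ev i)\<close> with
      \<open>j > i\<close> nonnegative and below 1.\<close>
    obtain t :: real where t: "0 < t" "t < 1 / 8"
      "\<And>h. \<lbrakk>h \<in> HP; hv h q \<noteq> 0\<rbrakk> \<Longrightarrow> hv h (q + t *\<^sub>R g) * hv h q > 0"
      using hv_sign_ray_ex[of "1 / 8" q g] by auto
    define y where "y = q + t *\<^sub>R g"
    have yx: "y - x' = z + t *\<^sub>R g" by (simp add: y_def z_def)
    have evb: "ev j \<le> 2 \<and> - 2 \<le> ev j" for j
      using cos_le_one[of "ang j"] cos_ge_minus_one[of "ang j"] by (simp add: ev_def)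
    have Py: "P j (y - x') = (1 + t * (ev j - ev i)) *\<^sub>R P j z" if "j \<le> r" for j
      using Pg[OF that] Pz0[of j] unfolding yx
      by (cases "i < j") (simp_all add: linear_add[OF P_linear] linear_scale[OF P_linear] scaleR_add_left)
    have fac: "0 \<le> 1 + t * (ev j - ev i) \<and> 1 + t * (ev j - ev i) < 1" if "i < j" "j \<le> r" for j
    proof -
      have "ev j - ev i < 0" "- 4 \<le> ev j - ev i" using ev_less[OF that] evb[of i] evb[of j] by auto
      then have "t * (ev j - ev i) < 0" "t * (-4) \<le> t * (ev j - ev i)"
        using mult_pos_neg[OF t(1)] mult_left_mono[OF _ less_imp_le[OF t(1)]] by blast+
      then show ?thesis using t(2) by linarith
    qed
    have le: "(norm (P j (y - x')))\<^sup>2 \<le> (norm (P j z))\<^sup>2" if j: "j \<le> r" for j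
    proof (cases "i < j")
      case True
      then have "norm (P j (y - x')) \<le> norm (P j z)"
        unfolding Py[OF j] using fac[OF True j] mult_right_mono[of "1 + t * (ev j - ev i)" 1 "norm (P j z)"] by simp
      then show ?thesis by (simp add: power_mono)
    next
      case False
      then show ?thesis using Py[OF j] Pz0[of j] by simp
    qed
    obtain k where k: "k \<le> r" "P k z \<noteq> 0" using exists_nonzero_component[OF z0] by blast
    then have ik: "i < k" using Pz0[of k] by (cases "i < k") auto
    have "norm (P k (y - x')) < norm (P k z)"
      unfolding Py[OF k(1)] using fac[OF ik k(1)] k(2) mult_strict_right_mono[of "1 + t * (ev k - ev i)" 1 "norm (P k z)"] by simp
    then have lt: "(norm (P k (y - x')))\<^sup>2 < (norm (P k z))\<^sup>2" by (simp add: power_strict_mono)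
    have "nrm (y - x') < nrm z"
      unfolding nrm_def by (rule sum_strict_mono_ex1) (use le lt k in auto)
    then have closer: "nrm (y - x') < nrm (q - x')" by (simp add: z_def)
    have projy: "proj i (y - org) = u'"
    proof -
      have "proj i g = 0" unfolding proj_def using Pg i by (intro sum.neutral) auto
      moreover have yo: "y - org = (q - org) + t *\<^sub>R g" by (simp add: y_def)
      moreover have "proj i (q - org) = u'" using q(1) by (simp add: M_def)
      ultimately show ?thesis
        unfolding yo linear_add[OF proj_linear] linear_scale[OF proj_linear] by simp
    qed
    \<comment> \<open>Move from \<open>y\<close> slightly in the direction from \<open>q\<close> to
      \<open>d\<close>, so that hyperplanes through both \<open>q\<close> and \<open>y\<close> keep
      the sign they have at \<open>d\<close>.\<close>
    obtain t2 :: real where t2: "0 < t2" "t2 < 1"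
      "\<And>h. \<lbrakk>h \<in> HP; hv h y \<noteq> 0\<rbrakk> \<Longrightarrow> hv h (y + t2 *\<^sub>R (d - q)) * hv h y > 0"
      using hv_sign_ray_ex[of 1 y "d - q"] by auto
    obtain d2 where d2: "\<And>h. h \<in> HX i \<Longrightarrow> sgn (hv h d2) = sgn (hv h (y + t2 *\<^sub>R (d - q)))"
      "\<And>h. \<lbrakk>h \<in> HP; h \<notin> HX i\<rbrakk> \<Longrightarrow> hv h d2 * hv h p1 > 0"
      using retract[OF good1] by metis
    have hy: "hv h y = hv h q + t * (fst h \<bullet> g)" for h by (simp add: y_def hv_add)
    \<comment> \<open>A wall of \<open>HX i\<close> crossed between \<open>d\<close> and
      \<open>d2\<close> passes through \<open>q\<close>, and \<open>g\<close> points across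
      it.\<close>
    have signs: "hv h d2 \<noteq> 0 \<and> (hv h y \<noteq> 0 \<longrightarrow> hv h y * hv h d2 > 0) \<and>
        (hv h d2 * hv h d < 0 \<longrightarrow> hv h q = 0 \<and> (fst h \<bullet> g) * hv h d < 0)" if h: "h \<in> HX i" for h
    proof -
      have hP: "h \<in> HP" using HX_HP[OF h] .
      have dn: "hv h d \<noteq> 0" using gd hP by (simp add: generic_def)
      note sg = sgn_eq_mult[OF d2(1)[OF h]]
      show ?thesis
      proof (cases "hv h q = 0")
        case True
        show ?thesis
        proof (cases "hv h y = 0")
          case True2: True
          have "hv h (y + t2 *\<^sub>R (d - q)) = t2 * hv h d"
            unfolding hv_add using True2 True by (simp add: hv_def inner_diff_right)
          then have "hv h (y + t2 *\<^sub>R (d - q)) * hv h d = t2 * (hv h d * hv h d)" by simp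
          also have "\<dots> > 0" using mult_pos_pos[OF t2(1)] dn not_real_square_gt_zero[of "hv h d"] by blast
          finally have "hv h (y + t2 *\<^sub>R (d - q)) * hv h d > 0" .
          then have "hv h d2 * hv h d > 0" using sg(1) by simp
          then show ?thesis using True2 by auto
        next
          case False
          have a: "hv h (y + t2 *\<^sub>R (d - q)) * hv h y > 0" by (rule t2(3)[OF hP False])
          then have b: "hv h d2 * hv h y > 0" using sg(1) by simp
          have "hv h y = t * (fst h \<bullet> g)" using hy True by simp
          then have "hv h d2 * hv h d < 0 \<longrightarrow> (fst h \<bullet> g) * hv h d < 0"
            using b t(1) by (auto simp: zero_less_mult_iff mult_less_0_iff)
          then show ?thesis using b True by (auto simp: mult.commute)
        qed
      next
        case False
        have a: "hv h y * hv h q > 0" using t(3)[OF hP False] by (simp add: y_def)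
        then have yn: "hv h y \<noteq> 0" by auto
        have b: "hv h d2 * hv h y > 0" using t2(3)[OF hP yn] sg(1) by simp
        have c: "hv h q * hv h d > 0" using d(2) h False by (simp add: adhX_def)
        show ?thesis using a b c by (auto simp: zero_less_mult_iff mult_less_0_iff)
      qed
    qed
    have gd2: "generic d2"
      unfolding generic_def using signs d2(2) by (metis mult_zero_left less_irrefl)
    have dd2: "hv h d2 * hv h d > 0" if h: "h \<in> HP" "h \<notin> HX i" for h
      using d2(2)[OF h] p1d[OF h] by (auto simp: zero_less_mult_iff)
    have sepd: "h \<in> HX i \<and> hv h q = 0 \<and> (fst h \<bullet> g) * hv h d < 0" if "h \<in> sep d d2" for h
    proof -
      have h: "h \<in> HP" "hv h d * hv h d2 < 0" using that by (auto simp: sep_def)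
      have "h \<in> HX i" using dd2[OF h(1)] h(2) by (auto simp: mult.commute)
      then show ?thesis using signs[of h] h(2) by (simp add: mult.commute)
    qed
    have "red w d d2"
    proof (rule red_gallery[OF wG gd gd2])
      fix e h assume e: "generic e" "sep d e \<subseteq> sep d d2" and h: "h \<in> sep d d2" "h \<notin> sep d e"
      have hH: "h \<in> HX i" "hv h q = 0" "(fst h \<bullet> g) * hv h d < 0" using sepd[OF h(1)] by auto
      have de: "hv h d * hv h e > 0" using same_sign[OF gd e(1) HX_HP[OF hH(1)] h(2)] .
      have adhe: "adhX i e q"
        unfolding adhX_def
      proof (intro ballI impI)
        fix k assume k: "k \<in> HX i" "hv k q \<noteq> 0"
        then have "k \<notin> sep d e" using e(2) sepd by blast
        then have "hv k d * hv k e > 0" using same_sign[OF gd e(1) HX_HP[OF k(1)]] by blast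
        moreover have "hv k q * hv k d > 0" using d(2) k by (simp add: adhX_def)
        ultimately show "hv k q * hv k e > 0" by (auto simp: zero_less_mult_iff)
      qed
      \<comment> \<open>As \<open>g\<close> points away from the side of \<open>e\<close>, one of
        the two summands lies on the opposite side of \<open>h\<close>, and adherence carries this
        over from \<open>q\<close> to \<open>e\<close>.\<close>
      have sum: "hv h (w q) + hv h (inv w q) = fst h \<bullet> g"
        using descent_direction[OF i hH(1,2)] g by simp
      have "hv h e * (hv h (w q) + hv h (inv w q)) < 0"
        unfolding sum using hH(3) de by (auto simp: zero_less_mult_iff mult_less_0_iff)
      then have "hv h e * hv h (w q) < 0 \<or> hv h e * hv h (inv w q) < 0" by (simp add: distrib_left) linarith
      then show "hv h e * hv h (w e) < 0 \<or> hv h e * hv h (inv w e) < 0"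
      proof
        assume a: "hv h e * hv h (w q) < 0"
        then have "hv h (w q) * hv h (w e) > 0" by (intro adhX_image[OF _ adhe hH(1)]) auto
        then show ?thesis using a by (auto simp: zero_less_mult_iff mult_less_0_iff)
      next
        assume a: "hv h e * hv h (inv w q) < 0"
        then have "hv h (inv w q) * hv h (inv w e) > 0" by (intro adhX_image[OF _ adhe hH(1)]) auto
        then show ?thesis using a by (auto simp: zero_less_mult_iff mult_less_0_iff)
      qed
    qed
    then have "red w p1 d2" using redd red_trans by blast
    moreover have "sep p1 d2 \<subseteq> HX i" using sep_trans[OF p1(1) gd gd2] dHX sepd by blast
    ultimately have "reach d2" using gd2 by (simp add: reach_def)
    moreover have "adhX i d2 y" unfolding adhX_def using signs by blast
    moreover have "nrm (y - x') \<le> nrm (p1 - x')" using closer q(1) by (simp add: M_def)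
    ultimately have "y \<in> M" using projy by (auto simp: M_def)
    then show False using q(2)[of y] closer by linarith
  qed
  then have dx: "adhX i d x'" using d(2) by simp
  have regx: "regular i x'" using p1(3) by (simp add: x'_def u'_def)
  \<comment> \<open>Adherence to \<open>x'\<close> is known only on \<open>HX i\<close>; retracting
    towards F_(i-1) corrects the remaining signs.\<close>
  obtain x2 where x2: "\<And>h. h \<in> HX i \<Longrightarrow> sgn (hv h x2) = sgn (hv h x')"
    "\<And>h. \<lbrakk>h \<in> HP; h \<notin> HX i\<rbrakk> \<Longrightarrow> hv h x2 * hv h p1 > 0" "x' - org \<in> U i \<Longrightarrow> x2 - org \<in> U i"
    using retract[OF good1] by metis
  have "regular i x2"
    unfolding regular_def
  proof (intro conjI ballI impI)
    show "x2 - org \<in> U i" using x2(3) regx by (simp add: regular_def)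
    fix h assume h: "h \<in> HP" "hv h x2 = 0"
    have hX: "h \<in> HX i" using x2(2)[OF h(1)] h(2) by fastforce
    then have "hv h x' = 0" using sgn_eq_mult(3)[OF x2(1)] h(2) by simp
    then show "contains h i" using regx h(1) by (simp add: regular_def)
  qed
  moreover have "adh d x2"
    unfolding adh_def
  proof (intro ballI impI)
    fix h assume h: "h \<in> HP" "hv h x2 \<noteq> 0"
    show "hv h x2 * hv h d > 0"
    proof (cases "h \<in> HX i")
      case True
      note sg = sgn_eq_mult[OF x2(1)[OF True]]
      have "hv h x' * hv h d > 0" using dx True h(2) sg(3) by (simp add: adhX_def)
      then show ?thesis using sg(1) by simp
    next
      case False
      then show ?thesis using x2(2)[OF h(1) False] p1d[OF h(1) False] by (auto simp: zero_less_mult_iff)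
    qed
  qed
  ultimately have gi: "goodat i d" by (auto simp: goodat_def)
  have "goodat j d" if "j \<le> i" for j
    using gi goodat_cong[OF p1(1) gd dHX _ good1] that by (cases "j = i") auto
  moreover have "red w p d" using red1 redd red_trans by blast
  ultimately show thesis using that gd by blast
qed

definition good :: "'n vec \<Rightarrow> bool" where "good p \<longleftrightarrow> generic p \<and> (\<forall>j\<le>r. goodat j p)"

lemma reduce_to_good:
  assumes p: "generic p"
  obtains p' where "good p'" "red w p p'"
proof -
  have "\<exists>p'. generic p' \<and> red w p p' \<and> (\<forall>j\<le>i. goodat j p')" if "i \<le> r" for i
    using that
  proof (induction i)
    case 0
    show ?case using stage[OF p, of 0] by (metis not_less_zero zero_le)
  next
    case (Suc i)
    then obtain p1 where p1: "generic p1" "red w p p1" "\<forall>j\<le>i. goodat j p1" by auto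
    obtain p2 where "generic p2" "red w p1 p2" "\<And>j. j \<le> Suc i \<Longrightarrow> goodat j p2"
      using stage[OF p1(1) Suc(2)] p1(3) by (metis less_Suc_eq_le)
    then show ?case using red_trans[OF p1(2)] by blast
  qed
  then show thesis using that by (auto simp: good_def)
qed

end

section \<open>Equivalence of good alcoves\<close>

context motion
begin

definition eqv :: "'n vec \<Rightarrow> 'n vec \<Rightarrow> bool" where
  "eqv p q \<longleftrightarrow> displ w p = displ w q \<and> tau w p - tau w q \<in> comm"

lemma eqv_trans: "\<lbrakk>eqv p q; eqv q s\<rbrakk> \<Longrightarrow> eqv p s"
  using comm_trans by (auto simp: eqv_def)

lemma adh_iff: "adh p x \<longleftrightarrow> adhX 0 p x" by (simp add: adh_def adhX_def)

lemma U_line: "\<lbrakk>x - org \<in> U i; y - org \<in> U i\<rbrakk> \<Longrightarrow> x + t *\<^sub>R (y - x) - org \<in> U i"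
proof -
  assume "x - org \<in> U i" "y - org \<in> U i"
  then have "(x - org) + t *\<^sub>R ((y - org) - (x - org)) \<in> U i"
    using U_add[OF _ U_scale[OF U_diff]] by blast
  then show ?thesis by (simp add: algebra_simps)
qed

lemma w_F: "x - org \<in> U i \<Longrightarrow> w x - org \<in> U i"
  using U_add[OF nu_U U_L, of "x - org" i] w_org[of "x - org"] by simp

text \<open>On the part of angle \<open>ang i\<close> a real eigenfunctional would need a real root
  \<open>k\<close> of \<open>k * k - ev i * k + 1\<close>, whose discriminant is negative as the
  angle lies strictly between 0 and \<open>pi\<close>. So \<open>h\<close> would vanish on all of
  F_i.\<close>

lemma no_real_eigenfunctional:
  assumes i: "0 < i" "i < r" and h: "h \<in> HX i" and nc: "\<not> contains h i"
  shows "\<exists>z. z - org \<in> U i \<and> hv h (w z) \<noteq> k * hv h z"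
proof (rule ccontr)
  assume neg: "\<not> ?thesis"
  define a where "a = fst h"
  have con: "contains h j" if "j < i" for j using HX_contains[OF h that] .
  have o0: "hv h org = 0" using contains_org con i(1) by blast
  have nu0: "a \<bullet> nu = 0" unfolding a_def using contains_dir[OF con[of 0] nu_U] i(1) by simp
  have e1: "a \<bullet> L (P i v) = k * (a \<bullet> P i v)" for v
  proof -
    have "P i v \<in> U i" using P_U[of i i v] i by simp
    then have "hv h (w (org + P i v)) = k * hv h (org + P i v)" using neg by (metis add_diff_cancel_left')
    then show ?thesis unfolding w_org hv_add o0 using nu0 by (simp add: a_def inner_add_right)
  qed
  have e2: "a \<bullet> L (L (P i v)) = k * (k * (a \<bullet> P i v))" for v
    using e1[of "L v"] e1[of v] by (simp add: L_P)
  have z: "a \<bullet> P i v = 0" for v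
  proof -
    have "a \<bullet> (L (L (P i v)) + P i v) = a \<bullet> (ev i *\<^sub>R L (P i v))" by (simp only: P_eigen)
    then have "(k * k + 1 - ev i * k) * (a \<bullet> P i v) = 0"
      by (simp add: inner_add_right e1 e2 algebra_simps)
    moreover have "\<bar>ev i\<bar> < 2" using ev_less[OF i(1)] ev_less[OF i(2)] i ev_0 ev_r by simp
    then have "k * k + 1 - ev i * k > 0"
    proof -
      have "ev i * ev i < 4"
        using \<open>\<bar>ev i\<bar> < 2\<close> abs_mult_less[of "ev i" 2 "ev i" 2] by simp
      moreover have "k * k + 1 - ev i * k = (k - ev i / 2) * (k - ev i / 2) + (1 - ev i * ev i / 4)"
        by (simp add: algebra_simps)
      moreover have "(k - ev i / 2) * (k - ev i / 2) \<ge> 0" by (rule zero_le_square)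
      ultimately show ?thesis by linarith
    qed
    ultimately show ?thesis by simp
  qed
  have "hv h (org + v) = 0" if v: "v \<in> U i" for v
  proof -
    have "v = (\<Sum>j\<le>i. P j v)" using proj_id[of i v] v i by (simp add: proj_def)
    then have "a \<bullet> v = (\<Sum>j\<le>i. a \<bullet> P j v)" by (metis inner_sum_right)
    also have "\<dots> = 0"
    proof (rule sum.neutral, rule ballI)
      fix j assume "j \<in> {..i}"
      then have "j = i \<or> j < i" by auto
      then show "a \<bullet> P j v = 0"
        using z contains_dir[OF con P_U[of j j v]] i by (auto simp: a_def)
    qed
    finally show ?thesis using o0 by (simp add: hv_add a_def)
  qed
  then show False using nc by (simp add: contains_def)
qed

text \<open>Moves \<open>x'\<close> without changing its signs until the segment from
  \<open>x\<close> is as generic as F_i allows: hyperplanes met simultaneously have proportional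
  restrictions to F_i, and for an angle strictly between 0 and \<open>pi\<close> the crossing point
  of \<open>h\<close> is not sent back into \<open>h\<close> by \<open>w\<close>.\<close>

lemma generic_target:
  assumes i: "i \<le> r" and x: "regular i x" and x': "regular i x'" and HXs: "sep x x' \<subseteq> HX i"
  obtains z where "z - org \<in> U i"
    "\<And>h. h \<in> HP \<Longrightarrow> sgn (hv h z) = sgn (hv h x')"
    "\<And>h k y. \<lbrakk>h \<in> sep x x'; k \<in> sep x x'; hv h x * hv k z = hv k x * hv h z; y - org \<in> U i\<rbrakk>
        \<Longrightarrow> hv h x * hv k y = hv k x * hv h y"
    "\<And>h. \<lbrakk>0 < i; i < r; h \<in> sep x x'\<rbrakk> \<Longrightarrow> hv h z * hv h (w x) - hv h x * hv h (w z) \<noteq> 0"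
proof -
  define F where "F = {y. y - org \<in> U i}"
  obtain S where S: "open S" "x' \<in> S" "\<And>y h. \<lbrakk>y \<in> S; h \<in> HP; hv h x' \<noteq> 0\<rbrakk> \<Longrightarrow> hv h y * hv h x' > 0"
    using hv_sign_nhds[of x'] unfolding eventually_nhds by blast
  \<comment> \<open>Pairs with proportional restrictions to \<open>F\<close> cannot be told apart
    there and are left out.\<close>
  define A where "A = {(h, k) \<in> sep x x' \<times> sep x x'. \<exists>y\<in>F. hv h x * hv k y - hv k x * hv h y \<noteq> 0}"
  define B where "B = (if 0 < i \<and> i < r then sep x x' else {})"
  define \<Psi>1 where "\<Psi>1 = (\<lambda>(h, k) z. hv h x * hv k z - hv k x * hv h z) ` A"
  define \<Psi>2 where "\<Psi>2 = (\<lambda>h z. hv h z * hv h (w x) - hv h x * hv h (w z)) ` B"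
  have "\<exists>z\<in>F \<inter> S. \<forall>\<psi>\<in>\<Psi>1 \<union> \<Psi>2. \<psi> z \<noteq> 0"
  proof (rule avoid_affine_zeros[where ?x0.0=x'])
    have "A \<subseteq> sep x x' \<times> sep x x'" unfolding A_def by blast
    then have "finite A" by (rule finite_subset) (simp add: finite_sep)
    moreover have "finite B" by (simp add: B_def finite_sep)
    ultimately show "finite (\<Psi>1 \<union> \<Psi>2)" by (simp add: \<Psi>1_def \<Psi>2_def)
    fix \<psi> assume "\<psi> \<in> \<Psi>1 \<union> \<Psi>2"
    then have "(\<forall>x y t. \<psi> (x + t *\<^sub>R (y - x)) = \<psi> x + t * (\<psi> y - \<psi> x)) \<and> continuous_on UNIV \<psi> \<and> (\<exists>z\<in>F. \<psi> z \<noteq> 0)"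
    proof
      assume "\<psi> \<in> \<Psi>1"
      then obtain h k where hk: "(h, k) \<in> A" and \<psi>: "\<psi> = (\<lambda>z. hv h x * hv k z - hv k x * hv h z)"
        by (auto simp: \<Psi>1_def)
      have "continuous_on UNIV \<psi>" unfolding \<psi> by (intro continuous_intros continuous_hv)
      moreover have "\<forall>x y t. \<psi> (x + t *\<^sub>R (y - x)) = \<psi> x + t * (\<psi> y - \<psi> x)"
        unfolding \<psi> hv_affine by (simp add: algebra_simps)
      moreover have "\<exists>z\<in>F. \<psi> z \<noteq> 0" unfolding \<psi> using hk by (auto simp: A_def)
      ultimately show ?thesis by blast
    next
      assume "\<psi> \<in> \<Psi>2"
      then obtain h where hB: "h \<in> B" and \<psi>: "\<psi> = (\<lambda>z. hv h z * hv h (w x) - hv h x * hv h (w z))"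
        by (auto simp: \<Psi>2_def)
      have ir: "0 < i" "i < r" and h: "h \<in> sep x x'" using hB by (auto simp: B_def split: if_splits)
      have hP: "h \<in> HP" using sep_HP[OF h] .
      have hx: "hv h x \<noteq> 0" using h by (auto simp: sep_def)
      obtain h' \<sigma> where h': "h' \<in> HP" "\<sigma> = 1 \<or> \<sigma> = (-1::real)" "\<And>x. hv h (w x) = \<sigma> * hv h' x"
        using hv_pull[OF wG hP] by metis
      have "continuous_on UNIV \<psi>" unfolding \<psi> h'(3) by (intro continuous_intros continuous_hv)
      moreover have "\<forall>x y t. \<psi> (x + t *\<^sub>R (y - x)) = \<psi> x + t * (\<psi> y - \<psi> x)"
        unfolding \<psi> h'(3) hv_affine by (simp add: algebra_simps)
      moreover have "\<exists>z\<in>F. \<psi> z \<noteq> 0"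
      proof -
        have "\<not> contains h i" using regular_zero_iff[OF x hP] hx by blast
        then obtain z where z: "z - org \<in> U i" "hv h (w z) \<noteq> (hv h (w x) / hv h x) * hv h z"
          using no_real_eigenfunctional[OF ir] h HXs by blast
        then have "\<psi> z \<noteq> 0" unfolding \<psi> using hx by (auto simp: field_simps)
        then show ?thesis using z(1) by (auto simp: F_def)
      qed
      ultimately show ?thesis by blast
    qed
    then show "\<And>x y t. \<psi> (x + t *\<^sub>R (y - x)) = \<psi> x + t * (\<psi> y - \<psi> x)" "continuous_on UNIV \<psi>"
      "\<exists>z\<in>F. \<psi> z \<noteq> 0" by blast+
  next
    show "x + t *\<^sub>R (y - x) \<in> F" if "x \<in> F" "y \<in> F" for x y t
      using that U_line unfolding F_def by blast
    show "x' \<in> F" using x' by (simp add: F_def regular_def)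
  qed (use S in auto)
  then obtain z where z: "z \<in> F" "z \<in> S" "\<And>\<psi>. \<psi> \<in> \<Psi>1 \<union> \<Psi>2 \<Longrightarrow> \<psi> z \<noteq> 0" by blast
  show thesis
  proof (rule that)
    show zU: "z - org \<in> U i" using z(1) by (simp add: F_def)
    show "sgn (hv h z) = sgn (hv h x')" if h: "h \<in> HP" for h
    proof (cases "hv h x' = 0")
      case True
      then have "contains h i" using regular_zero_iff[OF x' h] by simp
      then have "hv h z = 0" using zU unfolding contains_def by (metis add_diff_cancel_left' diff_add_cancel add.commute)
      then show ?thesis using True by simp
    next
      case False
      then show ?thesis using S(3)[OF z(2) h False] by (auto simp: zero_less_mult_iff)
    qed
    show "hv h x * hv k y = hv k x * hv h y"
      if a: "h \<in> sep x x'" "k \<in> sep x x'" "hv h x * hv k z = hv k x * hv h z" "y - org \<in> U i" for h k y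
    proof (rule ccontr)
      assume ne: "hv h x * hv k y \<noteq> hv k x * hv h y"
      have "(h, k) \<in> A" unfolding A_def using a ne by (auto simp: F_def intro!: bexI[of _ y])
      then have "(\<lambda>z. hv h x * hv k z - hv k x * hv h z) \<in> \<Psi>1"
        unfolding \<Psi>1_def by (intro image_eqI[of _ _ "(h, k)"]) simp_all
      then have "hv h x * hv k z - hv k x * hv h z \<noteq> 0" using z(3) by blast
      then show False using a(3) by simp
    qed
    show "hv h z * hv h (w x) - hv h x * hv h (w z) \<noteq> 0" if a: "0 < i" "i < r" "h \<in> sep x x'" for h
    proof -
      have "h \<in> B" using a by (simp add: B_def)
      then have "(\<lambda>z. hv h z * hv h (w x) - hv h x * hv h (w z)) \<in> \<Psi>2" unfolding \<Psi>2_def by blast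
      then show ?thesis using z(3) by blast
    qed
  qed
qed

text \<open>A hyperplane containing F_(r-1) sees only the part where \<open>L\<close> is -1, so
  \<open>L\<close> negates both its root and its coroot, and the two signs cancel in the
  reflection.\<close>

lemma refl_commute:
  assumes h: "h \<in> HX r"
  shows "w \<circ> refl h = refl h \<circ> w"
proof -
  define a where "a = fst h"
  have aP: "a \<in> Phi" using HP_root[OF HX_HP[OF h]] by (simp add: a_def)
  have con: "contains h j" if "j < r" for j using HX_contains[OF h that] .
  have o0: "hv h org = 0" using contains_org con r_pos by blast
  have nu0: "a \<bullet> nu = 0" unfolding a_def using contains_dir[OF con[of 0] nu_U] r_pos by simp
  have red_r: "a \<bullet> v = a \<bullet> P r v" for v
  proof -
    have "a \<bullet> v = (\<Sum>j\<le>r. a \<bullet> P j v)" using P_sum[of v] by (metis inner_sum_right)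
    also have "\<dots> = (\<Sum>j\<le>r. if j = r then a \<bullet> P r v else 0)"
    proof (rule sum.cong)
      fix j assume "j \<in> {..r}"
      then have "j = r \<or> j < r" by auto
      then show "a \<bullet> P j v = (if j = r then a \<bullet> P r v else 0)"
        using contains_dir[OF con P_U[of j j v]] by (auto simp: a_def)
    qed simp
    finally show ?thesis by simp
  qed
  have neg: "a \<bullet> L v = - (a \<bullet> v)" for v
    using red_r[of "L v"] red_r[of v] L_P_r[of v] by (simp add: L_P)
  obtain b where b: "b \<in> Phi" "\<forall>x. a \<bullet> L x = b \<bullet> x" "L (cor b) = cor a"
    using Lin_root[OF L_Lin aP] by blast
  have "b \<bullet> x = (- a) \<bullet> x" for x using b(2) neg by (metis inner_minus_left)
  then have "b = - a" by (metis vector_eq_rdot inner_commute)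
  then have Lc: "L (cor a) = - cor a"
    using b(3) cor_uminus[OF aP] linear_neg[OF lin, of "cor a"] by (metis add.inverse_inverse)
  show ?thesis
  proof (rule ext)
    fix y
    define v where "v = y - org"
    have y: "y = org + v" by (simp add: v_def)
    have ry: "refl h (org + u) = org + (u - (a \<bullet> u) *\<^sub>R cor a)" for u
    proof -
      have "refl h (org + u) = (org + u) - hv h (org + u) *\<^sub>R cor a" by (simp add: aref_def hv_def a_def)
      then show ?thesis using o0 by (simp add: hv_add a_def)
    qed
    show "(w \<circ> refl h) y = (refl h \<circ> w) y"
      unfolding y comp_apply ry w_org linear_diff[OF lin] linear_scale[OF lin] Lc
      by (simp add: inner_add_right nu0 neg)
  qed
qed

text \<open>Crossing the wall conjugates by a reflection that commutes with \<open>w\<close>, so the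
  element does not change at all.\<close>

lemma eqv_refl_adjacent:
  assumes p: "generic p" "generic q" and s: "sep p q = {h}" and h: "h \<in> HX r"
  shows "eqv p q"
proof -
  define x where "x = alc p"
  have x: "x \<in> G" "sep (x base_pt) p = {}" using alc[OF p(1)] by (auto simp: x_def)
  obtain s where s: "s \<in> G" "x \<circ> s = refl h \<circ> x" "sep ((x \<circ> s) base_pt) q = {}"
    using simple_step[OF x(1) p x(2) s] by metis
  have xs: "x \<circ> s \<in> G" using G_comp x s by blast
  have rG: "refl h \<in> G" using refl_G[OF HX_HP[OF h]] .
  have "inv (x \<circ> s) \<circ> w \<circ> (x \<circ> s) = inv x \<circ> (inv (refl h) \<circ> (w \<circ> refl h)) \<circ> x"
    unfolding s(2) inv_comp[OF rG x(1)] by (simp only: comp_assoc)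
  also have "inv (refl h) \<circ> (w \<circ> refl h) = w"
    unfolding refl_commute[OF h] by (rule G_inv_comp_cancel(1)[OF rG])
  finally have eq: "inv (x \<circ> s) \<circ> w \<circ> (x \<circ> s) = inv x \<circ> w \<circ> x" .
  have "displ w p = displ w q"
    using displ_rep[OF wG p(1) x] displ_rep[OF wG p(2) xs s(3)] unfolding eq by (rule trans[OF sym])
  moreover have "tau w p - tau w q \<in> comm"
    using tau_rep[OF wG p(2) xs s(3)] unfolding eq by (simp add: tau_def x_def)
  ultimately show ?thesis by (simp add: eqv_def)
qed

lemma sign_image:
  assumes g: "g = w \<or> g = inv w" and h: "h \<in> HP" "hv h (g e) \<noteq> 0"
    and near: "\<And>k. \<lbrakk>k \<in> HP; hv k e \<noteq> 0\<rbrakk> \<Longrightarrow> hv k y * hv k e > 0"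
  shows "hv h (g y) * hv h (g e) > 0"
proof -
  have "g \<in> G" using g wG G_inv by blast
  then obtain h' \<sigma> where h': "h' \<in> HP" "\<sigma> = 1 \<or> \<sigma> = (-1::real)" "\<And>x. hv h (g x) = \<sigma> * hv h' x"
    using hv_pull[OF _ h(1)] by metis
  have "hv h' e \<noteq> 0" using h(2) unfolding h'(3) by auto
  then have "hv h' y * hv h' e > 0" using near h'(1) by blast
  then show ?thesis using h'(2) unfolding h'(3) by auto
qed

text \<open>At the first panel the crossing point \<open>e\<close> lies in F_i, so the descent sum
  vanishes there: \<open>w e\<close> and \<open>inv w e\<close> lie on opposite sides of each
  crossed hyperplane, or both on it. Opposite sides make one of the two directions of crossing
  length-additive. Handled apart are \<open>i = r\<close>, where the crossed reflection commutes
  with \<open>w\<close>, and \<open>w e\<close> on the wall, which forces \<open>i = 0\<close>,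
  where \<open>w\<close> acts on F_0 as a translation parallel to the wall.\<close>

lemma cross_panel:
  assumes i: "i \<le> r" and p: "good p" and x: "regular i x" "adh p x" and x': "regular i x'"
    and HXs: "sep x x' \<subseteq> HX i" and ne: "sep x x' \<noteq> {}"
  obtains p2 x2 where "good p2" "regular i x2" "adh p2 x2" "eqv p p2" "sep p p2 \<subseteq> HX i"
    "card (sep x2 x') < card (sep x x')" "sep x2 x' \<subseteq> HX i"
proof -
  have gp: "generic p" using p by (simp add: good_def)
  obtain z where z: "z - org \<in> U i"
    "\<And>h. h \<in> HP \<Longrightarrow> sgn (hv h z) = sgn (hv h x')"
    "\<And>h k y. \<lbrakk>h \<in> sep x x'; k \<in> sep x x'; hv h x * hv k z = hv k x * hv h z; y - org \<in> U i\<rbrakk>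
        \<Longrightarrow> hv h x * hv k y = hv k x * hv h y"
    "\<And>h. \<lbrakk>0 < i; i < r; h \<in> sep x x'\<rbrakk> \<Longrightarrow> hv h z * hv h (w x) - hv h x * hv h (w z) \<noteq> 0"
    using generic_target[OF i x(1) x' HXs] by blast
  have xU: "x - org \<in> U i" using x(1) by (simp add: regular_def)
  have cont0: "hv h y = 0" if "contains h i" "y - org \<in> U i" for h y
    using that unfolding contains_def by (metis add_diff_cancel_left' diff_add_cancel add.commute)
  have sz: "sep x z = sep x x'"
    unfolding sep_def using sgn_eq_mult(2)[OF z(2)] by (auto simp: mult.commute)
  have zreg: "hv h x = 0 \<longleftrightarrow> hv h z = 0" if "h \<in> HP" for h
    using regular_zero_iff[OF x(1) that] regular_zero_iff[OF x' that] sgn_eq_mult(3)[OF z(2)[OF that]] by simp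
  obtain t h0 where t: "0 < t" "t < 1" "h0 \<in> sep x z" "hv h0 (x + t *\<^sub>R (z - x)) = 0"
    "\<And>h. \<lbrakk>h \<in> HP; hv h x \<noteq> 0\<rbrakk> \<Longrightarrow> (h \<in> sep x z \<and> hv h (x + t *\<^sub>R (z - x)) = 0)
        \<or> hv h (x + t *\<^sub>R (z - x)) * hv h x > 0"
    using first_crossing[of x z, OF zreg ne[folded sz]] by blast
  define e where "e = x + t *\<^sub>R (z - x)"
  \<comment> \<open>The hyperplanes met at \<open>e\<close> that do not contain F_i; they are
    crossed together.\<close>
  define C where "C = {h\<in>HP. hv h x \<noteq> 0 \<and> hv h e = 0}"
  have eU: "e - org \<in> U i" unfolding e_def by (rule U_line[OF xU z(1)])
  have Csep: "C \<subseteq> sep x z"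
  proof
    fix h assume "h \<in> C"
    then have h: "h \<in> HP" "hv h x \<noteq> 0" "hv h e = 0" unfolding C_def by blast+
    then show "h \<in> sep x z" using t(5)[OF h(1,2)] unfolding e_def[symmetric] h(3) by simp
  qed
  have CHX: "C \<subseteq> HX i" using Csep sz HXs by blast
  have h0C: "h0 \<in> C" using t(3,4) by (auto simp: C_def sep_def e_def)
  have notC: "hv h e * hv h x > 0" if "h \<in> HP" "hv h x \<noteq> 0" "h \<notin> C" for h
    using t(5)[OF that(1,2)] that by (auto simp: C_def e_def)
  obtain u1 :: real where u1: "0 < u1" "\<And>h. \<lbrakk>h \<in> HP; hv h e \<noteq> 0\<rbrakk> \<Longrightarrow> hv h (e + u1 *\<^sub>R (z - x)) * hv h e > 0"
    using hv_sign_ray_ex[OF zero_less_one, of e "z - x"] by blast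
  obtain u2 :: real where u2: "0 < u2" "\<And>h. \<lbrakk>h \<in> HP; hv h e \<noteq> 0\<rbrakk> \<Longrightarrow> hv h (e + u2 *\<^sub>R (x - z)) * hv h e > 0"
    using hv_sign_ray_ex[OF zero_less_one, of e "x - z"] by blast
  \<comment> \<open>\<open>xp\<close> and \<open>xm\<close> lie in F_i, just behind and just before
    the panel.\<close>
  define xp where "xp = e + u1 *\<^sub>R (z - x)"
  define xm where "xm = e + u2 *\<^sub>R (x - z)"
  have dU: "z - x \<in> U i" "x - z \<in> U i"
    using U_diff[OF z(1) xU] U_diff[OF xU z(1)] by simp_all
  have xpU: "xp - org \<in> U i"
  proof -
    have "(e - org) + u1 *\<^sub>R (z - x) \<in> U i" by (rule U_add[OF eU U_scale[OF dU(1)]])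
    then show ?thesis by (simp add: xp_def algebra_simps)
  qed
  have xmU: "xm - org \<in> U i"
  proof -
    have "(e - org) + u2 *\<^sub>R (x - z) \<in> U i" by (rule U_add[OF eU U_scale[OF dU(2)]])
    then show ?thesis by (simp add: xm_def algebra_simps)
  qed
  have Cxz: "hv h x * hv h z < 0" if "h \<in> C" for h using Csep that by (auto simp: sep_def)
  have C1: "hv h xp * hv h x < 0" "hv h xp * hv h z > 0" "hv h xm * hv h x > 0" if h: "h \<in> C" for h
  proof -
    have "hv h xp = u1 * (hv h z - hv h x)" "hv h xm = u2 * (hv h x - hv h z)"
      using h unfolding xp_def xm_def hv_add by (auto simp: C_def hv_def inner_diff_right)
    then show "hv h xp * hv h x < 0" "hv h xp * hv h z > 0" "hv h xm * hv h x > 0"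
      using Cxz[OF h] u1(1) u2(1) by (auto simp: mult_less_0_iff zero_less_mult_iff)
  qed
  have N1: "hv h xp * hv h x > 0" "hv h xm * hv h x > 0" if h: "h \<in> HP" "hv h x \<noteq> 0" "h \<notin> C" for h
  proof -
    have a: "hv h e * hv h x > 0" by (rule notC[OF h])
    then have "hv h e \<noteq> 0" by auto
    then have "hv h xp * hv h e > 0" "hv h xm * hv h e > 0" using u1(2) u2(2) h(1) by (auto simp: xp_def xm_def)
    then show "hv h xp * hv h x > 0" "hv h xm * hv h x > 0" using a by (auto simp: zero_less_mult_iff)
  qed
  have Z1: "hv h xp = 0 \<longleftrightarrow> contains h i" if h: "h \<in> HP" for h
  proof
    assume 0: "hv h xp = 0"
    have "hv h x = 0"
    proof (rule ccontr)
      assume n: "hv h x \<noteq> 0"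
      show False using C1(1)[of h] N1(1)[OF h n] 0 by (cases "h \<in> C") simp_all
    qed
    then show "contains h i" using regular_zero_iff[OF x(1) h] by simp
  qed (rule cont0[OF _ xpU])
  have regp: "regular i xp" unfolding regular_def using xpU Z1 by blast
  have adhm: "adh p xm"
    unfolding adh_def
  proof (intro ballI impI)
    fix h assume h: "h \<in> HP" "hv h xm \<noteq> 0"
    then have hx: "hv h x \<noteq> 0" using regular_zero_iff[OF x(1) h(1)] cont0[OF _ xmU] by blast
    have "hv h xm * hv h x > 0" using C1(3)[of h] N1(2)[OF h(1) hx] by blast
    moreover have "hv h x * hv h p > 0" using x(2) h(1) hx by (simp add: adh_def)
    ultimately show "hv h xm * hv h p > 0" by (auto simp: zero_less_mult_iff)
  qed
  obtain u3 :: real where u3: "0 < u3" "\<And>h. \<lbrakk>h \<in> HP; hv h xp \<noteq> 0\<rbrakk> \<Longrightarrow> hv h (xp + u3 *\<^sub>R (p - x)) * hv h xp > 0"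
    using hv_sign_ray_ex[OF zero_less_one, of xp "p - x"] by blast
  \<comment> \<open>The offset \<open>p - x\<close> keeps the sign of \<open>p\<close> on the
    hyperplanes through \<open>xp\<close>.\<close>
  define p2 where "p2 = xp + u3 *\<^sub>R (p - x)"
  have shift0: "hv h (xp + s *\<^sub>R (y - x)) = s * hv h y" if "h \<in> HP" "hv h xp = 0" for h s y
  proof -
    have "hv h x = 0" using Z1 regular_zero_iff[OF x(1)] that by blast
    then show ?thesis unfolding hv_add using that(2) by (simp add: hv_def inner_diff_right)
  qed
  have p2a: "hv h p2 * hv h xp > 0" if "h \<in> HP" "hv h xp \<noteq> 0" for h
    using u3(2)[OF that] by (simp add: p2_def)
  have p2b: "hv h p2 * hv h p > 0" if "h \<in> HP" "hv h xp = 0" for h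
  proof -
    have "hv h p \<noteq> 0" using gp that(1) by (simp add: generic_def)
    then have "u3 * (hv h p * hv h p) > 0" using mult_pos_pos[OF u3(1)] not_real_square_gt_zero[of "hv h p"] by blast
    then show ?thesis using shift0[OF that, of u3 p] by (simp add: p2_def)
  qed
  have gp2: "generic p2"
    unfolding generic_def
  proof
    fix h assume h: "h \<in> HP"
    show "hv h p2 \<noteq> 0" using p2a[OF h] p2b[OF h] by (cases "hv h xp = 0") auto
  qed
  have adhp: "adh p2 xp" unfolding adh_def using p2a by (simp add: mult.commute)
  have sepC: "sep p p2 = C"
  proof (rule set_eqI)
    fix h
    show "h \<in> sep p p2 \<longleftrightarrow> h \<in> C"
    proof (cases "h \<in> HP \<and> hv h xp \<noteq> 0")
      case True
      then have hx: "hv h x \<noteq> 0" using Z1 regular_zero_iff[OF x(1)] by blast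
      have a: "hv h x * hv h p > 0" using x(2) True hx by (simp add: adh_def)
      have b: "hv h p2 * hv h xp > 0" using p2a True by blast
      show ?thesis
        using a b C1(1)[of h] N1(1)[of h] True hx
        by (cases "h \<in> C") (auto simp: sep_def zero_less_mult_iff mult_less_0_iff)
    next
      case False
      then show ?thesis
      proof (cases "h \<in> HP")
        case True
        then have "hv h xp = 0" using False by simp
        then have "h \<notin> C" using C1(1)[of h] by auto
        moreover have "\<not> hv h p * hv h p2 < 0" using p2b[OF True \<open>hv h xp = 0\<close>] by (simp add: mult.commute)
        ultimately show ?thesis unfolding sep_def by blast
      next
        case False
        then show ?thesis unfolding sep_def C_def by blast
      qed
    qed
  qed
  have good2: "good p2"
    unfolding good_def
  proof (intro conjI allI impI gp2)
    fix j assume j: "j \<le> r"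
    have gj: "goodat j p" using p j by (simp add: good_def)
    consider "j < i" | "j = i" | "i < j" by linarith
    then show "goodat j p2"
    proof cases
      case 1
      then show ?thesis using goodat_cong[OF gp gp2 _ 1 gj] sepC CHX by blast
    next
      case 2
      then show ?thesis unfolding goodat_def using regp adhp by blast
    next
      case 3
      \<comment> \<open>For larger \<open>j\<close> the old witness is carried past the panel by the
        same kind of offset.\<close>
      obtain xj where xj: "regular j xj" "adh p xj" using gj by (auto simp: goodat_def)
      obtain u4 :: real where u4: "0 < u4" "\<And>h. \<lbrakk>h \<in> HP; hv h xp \<noteq> 0\<rbrakk> \<Longrightarrow> hv h (xp + u4 *\<^sub>R (xj - x)) * hv h xp > 0"
        using hv_sign_ray_ex[OF zero_less_one, of xp "xj - x"] by blast
      define y where "y = xp + u4 *\<^sub>R (xj - x)"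
      have sub: "U i \<subseteq> U j" using U_mono 3 by simp
      have "(xp - org) + u4 *\<^sub>R ((xj - org) - (x - org)) \<in> U j"
        using U_add[OF _ U_scale[OF U_diff]] sub xpU xU xj(1) unfolding regular_def by blast
      then have yU: "y - org \<in> U j" by (simp add: y_def algebra_simps)
      have "regular j y"
        unfolding regular_def
      proof (intro conjI ballI impI yU)
        fix h assume h: "h \<in> HP" "hv h y = 0"
        have "hv h xp = 0" using u4(2)[OF h(1)] h(2) unfolding y_def by force
        then have "hv h xj = 0" using shift0[OF h(1), of u4 xj] h(2) u4(1) by (simp add: y_def)
        then show "contains h j" using xj(1) h(1) by (simp add: regular_def)
      qed
      moreover have "adh p2 y"
        unfolding adh_def
      proof (intro ballI impI)
        fix h assume h: "h \<in> HP" "hv h y \<noteq> 0"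
        show "hv h y * hv h p2 > 0"
        proof (cases "hv h xp = 0")
          case True
          have yj: "hv h y = u4 * hv h xj" using shift0[OF h(1) True] by (simp add: y_def)
          then have "hv h xj \<noteq> 0" using h(2) by auto
          then have "hv h xj * hv h p > 0" using xj(2) h(1) by (simp add: adh_def)
          then show ?thesis using p2b[OF h(1) True] u4(1) unfolding yj by (auto simp: zero_less_mult_iff mult_less_0_iff)
        next
          case False
          then show ?thesis using u4(2)[OF h(1) False] p2a[OF h(1) False]
            unfolding y_def by (auto simp: zero_less_mult_iff)
        qed
      qed
      ultimately show ?thesis unfolding goodat_def by blast
    qed
  qed
  have card_less: "card (sep xp x') < card (sep x x')" and sub: "sep xp x' \<subseteq> sep x x'"
  proof -
    have "sep xp x' \<subseteq> sep x x' - {h0}"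
    proof
      fix h assume h: "h \<in> sep xp x'"
      have hP: "h \<in> HP" "hv h xp * hv h x' < 0" using h by (auto simp: sep_def)
      have xpz: "hv h xp * hv h z < 0" using hP(2) sgn_eq_mult(2)[OF z(2)[OF hP(1)]] by (simp add: mult.commute)
      have nC: "h \<notin> C" using C1(2)[of h] xpz by (meson less_asym)
      have "hv h x \<noteq> 0" using Z1[OF hP(1)] regular_zero_iff[OF x(1) hP(1)] hP(2) by force
      then have "hv h xp * hv h x > 0" using N1(1) hP(1) nC by blast
      then have "hv h x * hv h x' < 0" using hP(2) by (auto simp: zero_less_mult_iff mult_less_0_iff)
      then show "h \<in> sep x x' - {h0}" using hP(1) nC h0C unfolding sep_def by blast
    qed
    moreover have "h0 \<in> sep x x'" using t(3) sz by simp
    ultimately have "sep xp x' \<subset> sep x x'" by blast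
    then show "card (sep xp x') < card (sep x x')" "sep xp x' \<subseteq> sep x x'"
      using psubset_card_mono[OF finite_sep] by auto
  qed
  \<comment> \<open>The hyperplanes of \<open>C\<close> are met at the same parameter, so by the
    choice of \<open>z\<close> their restrictions to F_i are proportional.\<close>
  have ratio_eq: "hv h0 x * hv h y = hv h x * hv h0 y" if h: "h \<in> C" and y: "y - org \<in> U i" for h y
  proof (rule z(3)[OF _ _ _ y])
    show "h0 \<in> sep x x'" "h \<in> sep x x'" using h h0C Csep sz by auto
    have 1: "t * hv h0 z = (t - 1) * hv h0 x" "t * hv h z = (t - 1) * hv h x"
      using h h0C unfolding C_def e_def mem_Collect_eq hv_affine left_diff_distrib right_diff_distrib by linarith+
    have "t * (hv h0 x * hv h z) = hv h0 x * (t * hv h z)" by (simp only: mult_ac)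
    also have "\<dots> = hv h x * (t * hv h0 z)" unfolding 1 by (simp only: mult_ac)
    also have "\<dots> = t * (hv h x * hv h0 z)" by (simp only: mult_ac)
    finally show "hv h0 x * hv h z = hv h x * hv h0 z" using t(1) by simp
  qed
  have "eqv p p2"
  proof (cases "i = r")
    case True
    \<comment> \<open>F_r is the whole space, where proportional hyperplanes coincide.\<close>
    have "C = {h0}"
    proof -
      have "h = h0" if h: "h \<in> C" for h
      proof (rule hv_proportional_eq)
        show "h \<in> HP" "h0 \<in> HP" using h h0C by (auto simp: C_def)
        have "hv h0 x \<noteq> 0" using h0C by (simp add: C_def)
        then show "hv h y = (hv h x / hv h0 x) * hv h0 y" for y
          using ratio_eq[OF h, of y] True U_r by (simp add: field_simps)
      qed
      then show ?thesis using h0C by blast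
    qed
    then show ?thesis using eqv_refl_adjacent[OF gp gp2] sepC CHX True by blast
  next
    case False
    then have ir: "i < r" using i by simp
    have opp: "hv h (inv w e) = - hv h (w e)" if h: "h \<in> C" for h
    proof -
      have "hv h (w e) + hv h (inv w e) = fst h \<bullet> (\<Sum>j\<in>{i<..r}. (ev j - ev i) *\<^sub>R P j (e - org))"
        by (rule descent_direction[OF i]) (use h CHX in \<open>auto simp: C_def\<close>)
      also have "(\<Sum>j\<in>{i<..r}. (ev j - ev i) *\<^sub>R P j (e - org)) = 0"
        by (rule sum.neutral) (use eU in \<open>auto simp: U_def\<close>)
      finally show ?thesis by simp
    qed
    have weU: "w e - org \<in> U i" by (rule w_F[OF eU])
    \<comment> \<open>The factor is a square, so the direction of crossing is decided by
      \<open>h0\<close> for all of \<open>C\<close> at once.\<close>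
    have uniform: "hv h (w e) * hv h xp = (hv h x / hv h0 x) * (hv h x / hv h0 x) * (hv h0 (w e) * hv h0 xp)"
      if h: "h \<in> C" for h
    proof -
      have n: "hv h0 x \<noteq> 0" using h0C by (simp add: C_def)
      have "hv h (w e) = (hv h x / hv h0 x) * hv h0 (w e)" "hv h xp = (hv h x / hv h0 x) * hv h0 xp"
        using ratio_eq[OF h weU] ratio_eq[OF h xpU] n by (simp_all add: field_simps)
      then show ?thesis by simp
    qed
    have ratio: "(hv h x / hv h0 x) * (hv h x / hv h0 x) > 0" if h: "h \<in> C" for h
    proof -
      have "hv h x / hv h0 x \<noteq> 0" using h h0C by (auto simp: C_def)
      then show ?thesis using not_real_square_gt_zero by blast
    qed
    have Cx: "hv h x * hv h p > 0" "hv h p2 * hv h xp > 0" if h: "h \<in> C" for h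
    proof -
      have hP: "h \<in> HP" "hv h x \<noteq> 0" using h by (auto simp: C_def)
      show "hv h x * hv h p > 0" using x(2) hP by (simp add: adh_def)
      show "hv h p2 * hv h xp > 0" using p2a[OF hP(1)] C1(1)[OF h] by fastforce
    qed
    have imgp: "hv h (g xp) * hv h (g p2) > 0" if "g = w \<or> g = inv w" "h \<in> HP" "hv h (g xp) \<noteq> 0" for g h
      using adhX_image[OF that(1), of 0 p2 xp h] adhp that by (simp add: adh_iff)
    have imgm: "hv h (g xm) * hv h (g p) > 0" if "g = w \<or> g = inv w" "h \<in> HP" "hv h (g xm) \<noteq> 0" for g h
      using adhX_image[OF that(1), of 0 p xm h] adhm that by (simp add: adh_iff)
    have nearp: "hv h (g xp) * hv h (g e) > 0" if "g = w \<or> g = inv w" "h \<in> HP" "hv h (g e) \<noteq> 0" for g h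
      by (rule sign_image[OF that]) (use u1(2) in \<open>simp add: xp_def\<close>)
    have nearm: "hv h (g xm) * hv h (g e) > 0" if "g = w \<or> g = inv w" "h \<in> HP" "hv h (g e) \<noteq> 0" for g h
      by (rule sign_image[OF that]) (use u2(2) in \<open>simp add: xm_def\<close>)
    have forward: "eqv p p2"
      if a: "\<And>h. h \<in> C \<Longrightarrow> hv h (w xp) * hv h xp > 0 \<and> hv h (inv w xm) * hv h xm > 0"
    proof -
      have "h \<notin> sep p2 (w p2) \<and> h \<notin> sep p (inv w p)" if h: "h \<in> C" for h
      proof -
        have hP: "h \<in> HP" using h by (simp add: C_def)
        have b: "hv h (w xp) * hv h xp > 0" "hv h (inv w xm) * hv h xm > 0" using a[OF h] by auto
        have "hv h (w xp) * hv h (w p2) > 0" by (rule imgp) (use hP b in auto)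
        moreover have "hv h (inv w xm) * hv h (inv w p) > 0" by (rule imgm) (use hP b in auto)
        ultimately have "hv h p2 * hv h (w p2) > 0" "hv h p * hv h (inv w p) > 0"
          using b Cx[OF h] C1(3)[OF h] by (auto simp: zero_less_mult_iff)
        then show ?thesis unfolding sep_def by auto
      qed
      then have "sep p p2 \<inter> sep p2 (w p2) = {}" "sep p p2 \<inter> sep p (inv w p) = {}"
        unfolding sepC by blast+
      then show ?thesis using tau_conj[OF wG gp gp2] by (simp add: eqv_def)
    qed
    have backward: "eqv p p2"
      if a: "\<And>h. h \<in> C \<Longrightarrow> hv h (w xm) * hv h xm > 0 \<and> hv h (inv w xp) * hv h xp > 0"
    proof -
      have "h \<notin> sep p (w p) \<and> h \<notin> sep p2 (inv w p2)" if h: "h \<in> C" for h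
      proof -
        have hP: "h \<in> HP" using h by (simp add: C_def)
        have b: "hv h (w xm) * hv h xm > 0" "hv h (inv w xp) * hv h xp > 0" using a[OF h] by auto
        have "hv h (w xm) * hv h (w p) > 0" by (rule imgm) (use hP b in auto)
        moreover have "hv h (inv w xp) * hv h (inv w p2) > 0" by (rule imgp) (use hP b in auto)
        ultimately have "hv h p * hv h (w p) > 0" "hv h p2 * hv h (inv w p2) > 0"
          using b Cx[OF h] C1(3)[OF h] by (auto simp: zero_less_mult_iff)
        then show ?thesis unfolding sep_def by auto
      qed
      then have "sep p2 p \<inter> sep p (w p) = {}" "sep p2 p \<inter> sep p2 (inv w p2) = {}"
        using sepC unfolding sep_commute[of p2 p] by blast+
      then show ?thesis using tau_conj[OF wG gp2 gp] comm_swap by (simp add: eqv_def)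
    qed
    consider "hv h0 (w e) * hv h0 xp > 0" | "hv h0 (w e) * hv h0 xp < 0" | "hv h0 (w e) * hv h0 xp = 0"
      by linarith
    then show ?thesis
    proof cases
      case 1
      show ?thesis
      proof (rule forward)
        fix h assume h: "h \<in> C"
        have hP: "h \<in> HP" using h by (simp add: C_def)
        have a: "hv h (w e) * hv h xp > 0" unfolding uniform[OF h] by (rule mult_pos_pos[OF ratio[OF h] 1])
        have b: "hv h (w xp) * hv h (w e) > 0" by (rule nearp) (use hP a in auto)
        have c: "hv h (inv w xm) * hv h (inv w e) > 0" by (rule nearm) (use hP a opp[OF h] in auto)
        have d: "hv h xp * hv h xm < 0" using C1(1,3)[OF h] by (auto simp: zero_less_mult_iff mult_less_0_iff)
        have "hv h (w xp) * hv h xp > 0" using a b by (auto simp: zero_less_mult_iff)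
        moreover have "hv h (inv w xm) * hv h xm > 0"
          using a c d unfolding opp[OF h] by (auto simp: zero_less_mult_iff mult_less_0_iff)
        ultimately show "hv h (w xp) * hv h xp > 0 \<and> hv h (inv w xm) * hv h xm > 0" ..
      qed
    next
      case 2
      show ?thesis
      proof (rule backward)
        fix h assume h: "h \<in> C"
        have hP: "h \<in> HP" using h by (simp add: C_def)
        have a: "hv h (w e) * hv h xp < 0" unfolding uniform[OF h] by (rule mult_pos_neg[OF ratio[OF h] 2])
        have b: "hv h (w xm) * hv h (w e) > 0" by (rule nearm) (use hP a in auto)
        have c: "hv h (inv w xp) * hv h (inv w e) > 0" by (rule nearp) (use hP a opp[OF h] in auto)
        have d: "hv h xp * hv h xm < 0" using C1(1,3)[OF h] by (auto simp: zero_less_mult_iff mult_less_0_iff)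
        have "hv h (w xm) * hv h xm > 0" using a b d by (auto simp: zero_less_mult_iff mult_less_0_iff)
        moreover have "hv h (inv w xp) * hv h xp > 0"
          using a c unfolding opp[OF h] by (auto simp: zero_less_mult_iff mult_less_0_iff)
        ultimately show "hv h (w xm) * hv h xm > 0 \<and> hv h (inv w xp) * hv h xp > 0" ..
      qed
    next
      case 3
      have xp0: "hv h0 xp \<noteq> 0" using C1(1)[OF h0C] by auto
      then have we0: "hv h0 (w e) = 0" using 3 by simp
      \<comment> \<open>Both \<open>e\<close> and \<open>w e\<close> lie on \<open>h0\<close>, which
        the choice of \<open>z\<close> excludes for angles strictly between 0 and
        \<open>pi\<close>.\<close>
      have i0: "i = 0"
      proof (rule ccontr)
        assume "i \<noteq> 0"
        then have nz: "hv h0 z * hv h0 (w x) - hv h0 x * hv h0 (w z) \<noteq> 0" using z(4) ir t(3) sz by simp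
        obtain h' \<sigma> where h': "h' \<in> HP" "\<sigma> = 1 \<or> \<sigma> = (-1::real)" "\<And>x. hv h0 (w x) = \<sigma> * hv h' x"
          using hv_pull[OF wG sep_HP[OF t(3)]] by metis
        have n2: "t * (\<sigma> * hv h' z) = (t - 1) * (\<sigma> * hv h' x)"
        proof -
          have "hv h' e = 0" using we0 h'(2) unfolding h'(3) by auto
          then have "t * hv h' z = (t - 1) * hv h' x"
            unfolding e_def hv_affine left_diff_distrib right_diff_distrib by linarith
          then show ?thesis by (metis mult.left_commute)
        qed
        have n1: "t * hv h0 z = (t - 1) * hv h0 x"
          using t(4) unfolding hv_affine left_diff_distrib right_diff_distrib by linarith
        have "t * (hv h0 z * hv h0 (w x) - hv h0 x * hv h0 (w z))
          = (t * hv h0 z) * (\<sigma> * hv h' x) - hv h0 x * (t * (\<sigma> * hv h' z))"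
          unfolding h'(3) by (simp only: right_diff_distrib mult_ac)
        also have "\<dots> = 0" unfolding n1 n2 by (simp only: mult_ac diff_self)
        finally show False using nz t(1) by simp
      qed
      have wfix: "w y = y + nu" "inv w y = y - nu" if y: "y - org \<in> U 0" for y
      proof -
        define v where "v = y - org"
        have "proj 0 v = v" using proj_id[of 0 v] y by (simp add: v_def)
        then have "P 0 v = v" by (simp add: proj_def)
        then have Lv: "L v = v" using L_P_0[of v] by simp
        then have Liv: "Li v = v" using Li_L[of v] by simp
        have yv: "y = org + v" by (simp add: v_def)
        show "w y = y + nu" "inv w y = y - nu"
          unfolding yv w_org inv_w_org Lv Liv by simp_all
      qed
      show ?thesis
      proof (rule forward)
        fix h assume h: "h \<in> C"
        have "hv h (w e) * hv h xp = 0" unfolding uniform[OF h] 3 by simp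
        then have "hv h (w e) = 0" using C1(1)[OF h] by auto
        then have "fst h \<bullet> nu = 0" using wfix(1)[of e] eU i0 h by (simp add: hv_add C_def)
        then have "hv h (w xp) = hv h xp" "hv h (inv w xm) = hv h xm"
          using wfix(1)[of xp] wfix(2)[of xm] xpU xmU i0 hv_add[of h xp nu] hv_add[of h xm "- nu"] by simp_all
        moreover have "hv h xp \<noteq> 0" "hv h xm \<noteq> 0" using C1(1,3)[OF h] by auto
        ultimately show "hv h (w xp) * hv h xp > 0 \<and> hv h (inv w xm) * hv h xm > 0"
          using not_real_square_gt_zero by metis
      qed
    qed
  qed
  then show thesis using that[OF good2 regp adhp] sepC CHX card_less sub HXs by blast
qed

text \<open>Downward in \<open>i\<close>: \<open>HX (Suc r)\<close> is empty because F_r is the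
  whole space, and at stage \<open>i\<close> each panel crossed lowers the number of hyperplanes
  separating the two regular witnesses in F_i.\<close>

lemma good_equiv_stage:
  "\<lbrakk>i \<le> Suc r; good p; good p'; sep p p' \<subseteq> HX i\<rbrakk> \<Longrightarrow> eqv p p'"
proof (induction "Suc r - i" arbitrary: i p p')
  case 0
  then have i: "i = Suc r" by simp
  have "HX (Suc r) = {}"
  proof -
    have "\<not> contains h r" if h: "h \<in> HP" for h
    proof
      assume c: "contains h r"
      have "fst h \<bullet> cor (fst h) = 0" by (rule contains_dir[OF c]) (simp add: U_r)
      then show False using root_cor[OF HP_root[OF h]] by simp
    qed
    then show ?thesis by auto
  qed
  then have "sep p p' = {}" using 0(5) unfolding i by blast
  then show ?case using tau_conj[OF wG, of p p'] 0(3,4) by (simp add: eqv_def good_def)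
next
  case (Suc n)
  then have i: "i \<le> r" by simp
  have IH: "eqv p p'" if "good p" "good p'" "sep p p' \<subseteq> HX (Suc i)" for p p'
    using Suc(1)[of "Suc i" p p'] Suc(2) i that by simp
  obtain x' where x': "regular i x'" "adh p' x'" using Suc(5) i unfolding good_def goodat_def by blast
  have gp': "generic p'" using Suc(5) by (simp add: good_def)
  have main: "eqv q p'" if "good q" "regular i x" "adh q x" "sep q p' \<subseteq> HX i" for q x
    using that
  proof (induction "card (sep x x')" arbitrary: q x rule: less_induct)
    case less
    have gq: "generic q" using less(2) by (simp add: good_def)
    have sub: "sep x x' \<subseteq> sep q p'"
    proof
      fix h assume h: "h \<in> sep x x'"
      then have hP: "h \<in> HP" "hv h x * hv h x' < 0" by (auto simp: sep_def)
      then have "hv h x \<noteq> 0" "hv h x' \<noteq> 0" by auto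
      then have "hv h x * hv h q > 0" "hv h x' * hv h p' > 0"
        using less(4) x'(2) hP(1) by (simp_all add: adh_def)
      then have "hv h q * hv h p' < 0" using hP(2) by (auto simp: zero_less_mult_iff mult_less_0_iff)
      then show "h \<in> sep q p'" using hP(1) by (simp add: sep_def)
    qed
    show ?case
    proof (cases "sep x x' = {}")
      case True
      \<comment> \<open>With no hyperplane between the two witnesses, only hyperplanes that contain
        F_i can still separate the alcoves.\<close>
      have "sep q p' \<subseteq> HX (Suc i)"
      proof
        fix h assume h: "h \<in> sep q p'"
        then have hP: "h \<in> HP" "hv h q * hv h p' < 0" by (auto simp: sep_def)
        have "contains h i"
        proof (rule ccontr)
          assume "\<not> contains h i"
          then have n: "hv h x \<noteq> 0" "hv h x' \<noteq> 0"
            using regular_zero_iff[OF less(3) hP(1)] regular_zero_iff[OF x'(1) hP(1)] by auto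
          then have "hv h x * hv h q > 0" "hv h x' * hv h p' > 0"
            using less(4) x'(2) hP(1) by (auto simp: adh_def)
          then have "hv h x * hv h x' < 0" using hP(2) by (auto simp: zero_less_mult_iff mult_less_0_iff)
          then have "h \<in> sep x x'" using hP(1) by (simp add: sep_def)
          then show False using True by simp
        qed
        then show "h \<in> HX (Suc i)" using hP(1) by simp
      qed
      then show ?thesis using IH less(2) Suc(5) by blast
    next
      case False
      obtain q2 x2 where q2: "good q2" "regular i x2" "adh q2 x2" "eqv q q2" "sep q q2 \<subseteq> HX i"
        "card (sep x2 x') < card (sep x x')" "sep x2 x' \<subseteq> HX i"
        using cross_panel[OF i less(2,3,4) x'(1) _ False] sub less(5) by blast
      have gq2: "generic q2" using q2(1) by (simp add: good_def)
      have "sep q2 p' \<subseteq> HX i"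
        using sep_trans[OF gq2 gq gp'] q2(5) less(5) by (auto simp: sep_commute)
      then have "eqv q2 p'" using less(1)[OF q2(6,1,2,3)] by blast
      then show ?thesis using q2(4) eqv_trans by blast
    qed
  qed
  obtain x where "regular i x" "adh p x" using Suc(4) i unfolding good_def goodat_def by blast
  then show ?case using main[OF Suc(4)] Suc(6) by blast
qed

lemma good_equiv: "\<lbrakk>good p; good p'\<rbrakk> \<Longrightarrow> eqv p p'"
  using good_equiv_stage[of 0 p p'] sep_HP[of _ p p'] by (simp add: subsetI)

end

section \<open>The spanning set\<close>

fun vanish_diff :: "nat \<Rightarrow> (int \<Rightarrow> int) \<Rightarrow> bool" where
  "vanish_diff 0 q \<longleftrightarrow> (\<forall>j. q j = 0)"
| "vanish_diff (Suc n) q \<longleftrightarrow> vanish_diff n (\<lambda>j. q (j + 1) - q j)"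

lemma vanish_diff_add: "\<lbrakk>vanish_diff n p; vanish_diff n q\<rbrakk> \<Longrightarrow> vanish_diff n (\<lambda>j. p j + q j)"
proof (induction n arbitrary: p q)
  case (Suc n)
  then have "vanish_diff n (\<lambda>j. (p (j + 1) - p j) + (q (j + 1) - q j))" by simp
  moreover have "(\<lambda>j. (p (j + 1) - p j) + (q (j + 1) - q j)) = (\<lambda>j. (p (j + 1) + q (j + 1)) - (p j + q j))"
    by auto
  ultimately show ?case by simp
qed simp

lemma vanish_diff_shift: "vanish_diff n q \<Longrightarrow> vanish_diff n (\<lambda>j. q (j + 1))"
proof (induction n arbitrary: q)
  case (Suc n)
  then have "vanish_diff n (\<lambda>j. q (j + 1) - q j)" by simp
  from Suc.IH[OF this] show ?case by (simp only: vanish_diff.simps)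
qed simp

lemma vanish_diff_linear: "vanish_diff n q \<Longrightarrow> vanish_diff (Suc n) (\<lambda>j. (j - i) * q j)"
proof (induction n arbitrary: q)
  case (Suc n)
  have "vanish_diff (Suc n) (\<lambda>j. (j - i) * (q (j + 1) - q j) + q (j + 1))"
    using Suc.IH[of "\<lambda>j. q (j + 1) - q j"] Suc.prems vanish_diff_shift[OF Suc.prems]
    by (intro vanish_diff_add) auto
  moreover have "(\<lambda>j. (j - i) * (q (j + 1) - q j) + q (j + 1)) = (\<lambda>j. (j + 1 - i) * q (j + 1) - (j - i) * q j)"
    by (auto simp: algebra_simps)
  ultimately show ?case by (simp add: algebra_simps)
qed simp

lemma vanish_diff_prod: "finite K \<Longrightarrow> vanish_diff (Suc (card K)) (\<lambda>j. \<Prod>i\<in>K. (j - i))"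
proof (induction K rule: finite_induct)
  case (insert k K)
  then show ?case using vanish_diff_linear[OF insert.IH, of k] by simp
qed simp

definition moment :: "(int \<Rightarrow> int) \<Rightarrow> laurent \<Rightarrow> int" where
  "moment q f = (\<Sum>j\<in>Poly_Mapping.keys f. Poly_Mapping.lookup f j * q j)"

lemma moment_superset:
  "\<lbrakk>finite K; Poly_Mapping.keys f \<subseteq> K\<rbrakk> \<Longrightarrow> moment q f = (\<Sum>j\<in>K. Poly_Mapping.lookup f j * q j)"
  unfolding moment_def by (rule sum.mono_neutral_left) (auto simp: in_keys_iff)

lemma moment_add: "moment q (f + g) = moment q f + moment q g"
proof -
  have "finite (Poly_Mapping.keys f \<union> Poly_Mapping.keys g)" by simp
  from moment_superset[OF this, of f] moment_superset[OF this, of g] moment_superset[OF this, of "f + g"]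
  show ?thesis using Poly_Mapping.keys_add[of f g] by (simp add: lookup_add distrib_right sum.distrib)
qed

lemma moment_single: "moment q (Poly_Mapping.single k c) = c * q k"
  using moment_superset[of "{k}" "Poly_Mapping.single k c" q] by (simp add: lookup_single)

lemma moment_zero: "moment q 0 = 0" by (simp add: moment_def)

lemma moment_uminus: "moment q (- f) = - moment q f"
  using moment_add[of q f "- f"] by (simp add: moment_zero)

lemma moment_of_nat: "moment q (of_nat n * f) = int n * moment q f"
  by (induction n) (simp_all add: moment_zero moment_add algebra_simps)

lemma poly_mapping_as_sum:
  "f = (\<Sum>k\<in>Poly_Mapping.keys f. Poly_Mapping.single k (Poly_Mapping.lookup f k))"
  by (rule poly_mapping_eqI) (simp add: lookup_sum lookup_single when_def in_keys_iff)

text \<open>Multiplication by v - 1 is adjoint to the finite difference, so multiples of its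
  \<open>n\<close>-th power pair to 0 with polynomials of degree below \<open>n\<close>.\<close>

lemma moment_lv_minus_one: "moment q ((lv - 1) * f) = moment (\<lambda>j. q (j + 1) - q j) f"
proof -
  have step: "moment q ((lv - 1) * (\<Sum>k\<in>K. Poly_Mapping.single k (c k)))
      = moment (\<lambda>j. q (j + 1) - q j) (\<Sum>k\<in>K. Poly_Mapping.single k (c k))" if "finite K" for K c
    using that
  proof (induction K rule: finite_induct)
    case empty
    then show ?case by (simp add: moment_zero)
  next
    case (insert k K)
    have "(lv - 1) * Poly_Mapping.single k (c k) = Poly_Mapping.single (k + 1) (c k) + - Poly_Mapping.single k (c k)"
      by (simp add: lv_def left_diff_distrib mult_single add.commute)
    then have "moment q ((lv - 1) * Poly_Mapping.single k (c k)) = c k * (q (k + 1) - q k)"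
      by (simp only: moment_add moment_uminus moment_single) (simp add: algebra_simps)
    then show ?case using insert by (simp add: distrib_left moment_add moment_single)
  qed
  show ?thesis using step[of "Poly_Mapping.keys f" "Poly_Mapping.lookup f"] poly_mapping_as_sum[of f] by simp
qed

lemma moment_power: "vanish_diff n q \<Longrightarrow> moment q ((lv - 1) ^ n * f) = 0"
proof (induction n arbitrary: q)
  case 0
  then show ?case by (simp add: moment_def)
next
  case (Suc n)
  have "moment q ((lv - 1) ^ Suc n * f) = moment (\<lambda>j. q (j + 1) - q j) ((lv - 1) ^ n * f)"
    unfolding power_Suc mult.assoc by (rule moment_lv_minus_one)
  then show ?case using Suc by simp
qed

text \<open>The polynomial vanishing at all exponents of \<open>f\<close> but one isolates that
  coefficient, while a power of \<open>lv - 1\<close> beyond its degree makes the pairing 0. The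
  factor \<open>N\<close> is harmless because the integers have no torsion.\<close>

lemma laurent_zeroI:
  assumes div: "\<And>k. \<exists>N::nat>0. (lv - 1) ^ k dvd of_nat N * f"
  shows "f = 0"
proof (rule ccontr)
  assume "f \<noteq> 0"
  then obtain j where j: "j \<in> Poly_Mapping.keys f" by (metis all_not_in_conv keys_eq_empty)
  define K where "K = Poly_Mapping.keys f - {j}"
  define q where "q x = (\<Prod>i\<in>K. (x - i))" for x :: int
  have finK: "finite K" by (simp add: K_def)
  obtain N :: nat where N: "N > 0" "(lv - 1) ^ Suc (card K) dvd of_nat N * f" using div by blast
  then obtain g where g: "of_nat N * f = (lv - 1) ^ Suc (card K) * g" by (auto elim: dvdE)
  have "int N * moment q f = 0"
    using moment_power[of "Suc (card K)" q g] vanish_diff_prod[OF finK] g moment_of_nat[of q N f]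
    unfolding q_def by simp
  then have "moment q f = 0" using N(1) by simp
  moreover have "moment q f = Poly_Mapping.lookup f j * q j"
  proof -
    have "moment q f = Poly_Mapping.lookup f j * q j + (\<Sum>i\<in>K. Poly_Mapping.lookup f i * q i)"
      unfolding moment_def K_def using j by (subst sum.remove[OF _ j]) simp_all
    also have "(\<Sum>i\<in>K. Poly_Mapping.lookup f i * q i) = 0"
      by (rule sum.neutral) (use finK in \<open>auto simp: q_def intro!: prod_zero\<close>)
    finally show ?thesis by simp
  qed
  moreover have "q j \<noteq> 0" using finK by (auto simp: q_def K_def)
  ultimately show False using j by (simp add: in_keys_iff)
qed

section \<open>Reduction to minimal length in a conjugacy class\<close>

context hecke_setting
begin

text \<open>An order \<open>n\<close> of the linear part gives the period \<open>2 * n\<close>, and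
  the origin on the axis comes from \<open>fixed_part\<close>.\<close>

lemma motion_exists:
  assumes w: "w \<in> G"
  obtains L r org nu where "motion Phi Delta cor D sc T L r w org nu"
proof -
  obtain l p where *: "l \<in> Lin" "w = (\<lambda>x. l x + p)" using w by (auto simp: G_iff)
  obtain n where n: "n > 0" "l ^^ n = id" using Lin_finite_order[OF *(1)] by blast
  have "l ^^ (2 * n) = id" using n(2) by (simp add: mult_2 funpow_add)
  then interpret L: finite_order_map l n
    using Lin_linear[OF *(1)] n(1) by (simp add: finite_order_map_def)
  obtain z where z: "l z + p - z = L.P 0 p" using L.fixed_part by blast
  have "motion Phi Delta cor D sc T l n w z (L.P 0 p)"
  proof (intro motion.intro motion_axioms.intro)
    show "hecke_setting Phi Delta cor D sc T" "finite_order_map l n" by unfold_locales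
    show "w (z + v) = z + (L.P 0 p + l v)" for v
      unfolding z[symmetric] *(2) linear_add[OF Lin_linear[OF *(1)]] by simp
    show "l (L.P 0 p) = L.P 0 p" by (rule L.L_P_0)
  qed (fact w *(1))+
  then show thesis by (rule that)
qed

text \<open>The base alcove and the alcove of the minimal conjugate both reduce to good ones, and
  these are equivalent. Minimality forbids a drop on the second path, so a drop can occur only on
  the path from \<open>w\<close> itself.\<close>

lemma reduce_to_minimal:
  assumes w: "w \<in> G" and g: "g \<in> G"
    and min: "\<And>x. x \<in> G \<Longrightarrow> len (inv g \<circ> w \<circ> g) \<le> len (inv x \<circ> w \<circ> x)"
  shows "T w - T (inv g \<circ> w \<circ> g) \<in> comm \<or> T w \<in> low (len w)"
proof -
  obtain L r org nu where "motion Phi Delta cor D sc T L r w org nu" using motion_exists[OF w] by blast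
  then interpret M: motion Phi Delta cor D sc T L r w org nu .
  define q where "q = g base_pt"
  have gq: "generic q" using generic_G g generic_base by (simp add: q_def)
  have id0: "sep (id base_pt) base_pt = {}" "sep (g base_pt) q = {}" by (simp_all add: q_def)
  have inv_id: "inv id \<circ> w \<circ> id = w" by (metis comp_id id_comp inv_id)
  have lw: "len w = displ w base_pt"
    using displ_rep[OF w generic_base G_id id0(1)] unfolding inv_id .
  have tw: "T w - tau w base_pt \<in> comm"
    using tau_rep[OF w generic_base G_id id0(1)] unfolding inv_id .
  have lg: "len (inv g \<circ> w \<circ> g) = displ w q" by (rule displ_rep[OF w gq g id0(2)])
  have tg: "T (inv g \<circ> w \<circ> g) - tau w q \<in> comm" by (rule tau_rep[OF w gq g id0(2)])
  obtain p' where p': "M.good p'" "red w base_pt p'" using M.reduce_to_good[OF generic_base] by blast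
  obtain q' where q': "M.good q'" "red w q q'" using M.reduce_to_good[OF gq] by blast
  have e: "M.eqv p' q'" by (rule M.good_equiv[OF p'(1) q'(1)])
  have gq': "generic q'" using q'(1) by (simp add: M.good_def)
  have "displ w q \<le> displ w q'"
    using min[OF alc(1)[OF gq']] displ_rep[OF w gq' alc[OF gq']] lg by simp
  then have tq: "tau w q - tau w q' \<in> comm" using q'(2) by (simp add: red_def)
  from p'(2) show ?thesis
    unfolding red_def
  proof (elim disjE conjE)
    assume "tau w base_pt - tau w p' \<in> comm"
    then have "T w - tau w p' \<in> comm" using tw comm_trans by blast
    moreover have "tau w p' - tau w q' \<in> comm" using e by (simp add: M.eqv_def)
    ultimately have "T w - tau w q' \<in> comm" using comm_trans by blast
    then have "T w - tau w q \<in> comm" using comm_swap[OF tq] comm_trans by blast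
    then show ?thesis using comm_swap[OF tg] comm_trans by blast
  next
    assume "tau w base_pt \<in> low (displ w base_pt)"
    then have "(T w - tau w base_pt) + tau w base_pt \<in> low (len w)"
      unfolding lw by (intro H.subspace_add[OF low_subspace comm_low[OF tw]])
    then have "T w \<in> low (len w)" by simp
    then show ?thesis ..
  qed
qed

lemma conj_eq: "\<lbrakk>g \<in> G; g \<circ> w = v \<circ> g\<rbrakk> \<Longrightarrow> v = g \<circ> w \<circ> inv g"
  by (metis comp_assoc comp_id G_inv_comp(2))

lemma span_representatives:
  assumes R: "R \<subseteq> G"
    and ex: "\<And>w. w \<in> G \<Longrightarrow> \<exists>r\<in>R. conjugate_in G w r"
    and min: "\<And>r w. \<lbrakk>r \<in> R; w \<in> G; conjugate_in G w r\<rbrakk> \<Longrightarrow> len r \<le> len w"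
  shows "H.span (T ` R \<union> comm) = UNIV"
proof -
  let ?S = "H.span (T ` R \<union> comm)"
  have "T w \<in> ?S" if "w \<in> G" for w
    using that
  proof (induction "len w" arbitrary: w rule: less_induct)
    case less
    have low: "low (len w) \<subseteq> ?S"
      unfolding low_def
    proof (rule H.span_minimal)
      show "{T z |z. z \<in> G \<and> len z < len w} \<union> comm \<subseteq> ?S" using less(1) by (auto intro: H.span_base)
    qed (rule H.subspace_span)
    obtain r k where r: "r \<in> R" "k \<in> G" "k \<circ> w = r \<circ> k"
      using ex[OF less(2)] by (auto simp: conjugate_in_def)
    define g where "g = inv k"
    have g: "g \<in> G" "inv g = k" using r(2) G_inv by (auto simp: g_def)
    have rw: "inv g \<circ> w \<circ> g = r" using conj_eq[OF r(2,3)] g by (simp add: g_def)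
    have "len (inv g \<circ> w \<circ> g) \<le> len (inv x \<circ> w \<circ> x)" if x: "x \<in> G" for x
    proof -
      have "(k \<circ> x) \<circ> (inv x \<circ> w \<circ> x) = r \<circ> (k \<circ> x)"
        using x r(3) by (simp add: fun_eq_iff)
      then have "conjugate_in G (inv x \<circ> w \<circ> x) r"
        unfolding conjugate_in_def using G_comp[OF r(2) x] by blast
      then show ?thesis unfolding rw using min[OF r(1) G_comp[OF G_comp[OF G_inv[OF x] less(2)] x]] by blast
    qed
    then have "T w - T r \<in> comm \<or> T w \<in> low (len w)"
      using reduce_to_minimal[OF less(2) g(1)] rw by simp
    then show ?case
    proof
      assume a: "T w - T r \<in> comm"
      have "(T w - T r) + T r \<in> ?S"
        using a r(1) by (intro H.span_add H.span_base) auto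
      then show ?thesis by simp
    next
      assume "T w \<in> low (len w)"
      then show ?thesis using low by blast
    qed
  qed
  then have "T ` G \<subseteq> ?S" by blast
  then have "H.span (T ` G) \<subseteq> ?S" by (rule H.span_minimal) (rule H.subspace_span)
  then show ?thesis using T_span by blast
qed

end

section \<open>Commuting lifts\<close>

context root_setting
begin

definition dominant :: "'n vec \<Rightarrow> bool" where
  "dominant x \<longleftrightarrow> (\<forall>a\<in>Pos. 0 \<le> a \<bullet> x)"

lemma trans_comp: "trans p \<circ> trans q = trans (p + q)"
  by (simp add: trans_def fun_eq_iff algebra_simps)

lemma inv_trans: "inv (trans p) = trans (- p)"
  by (rule inv_unique_comp) (simp_all add: trans_def fun_eq_iff)

lemma len_trans_comp:
  assumes p: "p \<in> lattice" "dominant p" and q: "q \<in> lattice" "dominant q"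
  shows "len (trans p \<circ> trans q) = len (trans p) + len (trans q)"
proof (rule len_comp_add[OF trans_G[OF p(1)] trans_G[OF q(1)]])
  have "\<not> hv h (trans p base_pt) * hv h (trans p (trans q base_pt)) < 0"
    if h: "h \<in> HP" "hv h base_pt * hv h (trans p base_pt) < 0" for h
  proof -
    have "0 \<le> fst h \<bullet> p" "0 \<le> fst h \<bullet> q" using h(1) p(2) q(2) by (auto simp: HP_def dominant_def)
    moreover have "hv h (trans p base_pt) = hv h base_pt + fst h \<bullet> p"
      "hv h (trans p (trans q base_pt)) = hv h base_pt + fst h \<bullet> p + fst h \<bullet> q"
      by (simp_all add: trans_def hv_def inner_add_right)
    ultimately show ?thesis using h(2) by (auto simp: mult_less_0_iff)
  qed
  then show "sep base_pt (trans p base_pt) \<inter> sep (trans p base_pt) (trans p (trans q base_pt)) = {}"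
    unfolding sep_def by blast
qed

text \<open>If a hyperplane separates the base alcove from its image under \<open>u\<close>, its
  root pulls back along \<open>u\<close> to a negative root; a dominant translation then moves
  further to the same side.\<close>

lemma len_Lin_trans:
  assumes u: "u \<in> Lin" and q: "q \<in> lattice" "dominant q"
  shows "len (u \<circ> trans q) = len u + len (trans q)"
proof (rule len_comp_add[OF Lin_G[OF u] trans_G[OF q(1)]])
  have "\<not> hv h (u base_pt) * hv h (u (trans q base_pt)) < 0"
    if h: "h \<in> HP" "hv h base_pt * hv h (u base_pt) < 0" for h
  proof -
    obtain b where b: "b \<in> Phi" "\<forall>x. fst h \<bullet> u x = b \<bullet> x" using Lin_root[OF u HP_root[OF h(1)]] by blast
    have a: "0 < fst h \<bullet> base_pt" "fst h \<bullet> base_pt < 1" using base_pt_bounds h(1) by (auto simp: HP_def)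
    have e1: "hv h (u base_pt) = b \<bullet> base_pt - of_int (snd h)"
      and e2: "hv h (u (trans q base_pt)) = b \<bullet> base_pt - of_int (snd h) + b \<bullet> q"
      using b(2) by (simp_all add: hv_def trans_def inner_add_right)
    have "snd h \<le> 0 \<or> snd h \<ge> 1" by linarith
    then have k: "real_of_int (snd h) \<le> 0 \<or> real_of_int (snd h) \<ge> 1" by linarith
    show ?thesis
    proof (cases "b \<in> Pos")
      case True
      then have "0 < b \<bullet> base_pt" "b \<bullet> base_pt < 1" using base_pt_bounds by auto
      then have "\<not> hv h base_pt * hv h (u base_pt) < 0"
        using a k unfolding e1 by (auto simp: hv_def mult_less_0_iff)
      then show ?thesis using h(2) by blast
    next
      case False
      then have nb: "- b \<in> Pos" using Pos_or_neg[OF b(1)] by blast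
      then have "b \<bullet> base_pt < 0" "b \<bullet> q \<le> 0" using base_pt_bounds[OF nb] q(2) by (auto simp: dominant_def)
      then show ?thesis
        using h(2) a unfolding e1 e2 by (auto simp: hv_def[of h base_pt] mult_less_0_iff)
    qed
  qed
  then show "sep base_pt (u base_pt) \<inter> sep (u base_pt) (u (trans q base_pt)) = {}"
    unfolding sep_def by blast
qed

lemma strictly_dominant_lattice:
  obtains p where "p \<in> lattice" "\<And>a. a \<in> Pos \<Longrightarrow> 1 \<le> a \<bullet> p"
proof -
  obtain c where c: "\<And>a. a \<in> Pos \<Longrightarrow> 0 < a \<bullet> c" using positive_functional by blast
  \<comment> \<open>Rounding down costs at most the sum of the absolute values of the coordinates of
    \<open>a\<close>; a scale of at least \<open>B a\<close> leaves the value 1 after this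
    loss.\<close>
  define B where "B a = (1 + (\<Sum>i\<in>UNIV. \<bar>a $ i\<bar>)) / (a \<bullet> c)" for a :: "'n vec"
  have Bnn: "0 \<le> B a" if "a \<in> Pos" for a
    unfolding B_def using c[OF that] by (intro divide_nonneg_pos add_nonneg_nonneg sum_nonneg) auto
  define M where "M = (\<Sum>a\<in>Pos. B a)"
  define p :: "'n vec" where "p = (\<chi> i. of_int \<lfloor>M * c $ i\<rfloor>)"
  have "p \<in> lattice" by (simp add: p_def lattice_def)
  moreover have "1 \<le> a \<bullet> p" if a: "a \<in> Pos" for a
  proof -
    have "B a \<le> M" unfolding M_def using member_le_sum[OF a _ finite_Pos, of B] Bnn by simp
    then have 1: "1 + (\<Sum>i\<in>UNIV. \<bar>a $ i\<bar>) \<le> M * (a \<bullet> c)"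
      unfolding B_def using c[OF a] by (simp add: field_simps)
    have "a $ i * (M * c $ i) - \<bar>a $ i\<bar> \<le> a $ i * of_int \<lfloor>M * c $ i\<rfloor>" for i
    proof -
      have "\<bar>M * c $ i - of_int \<lfloor>M * c $ i\<rfloor>\<bar> \<le> 1" by linarith
      then have "\<bar>a $ i\<bar> * \<bar>M * c $ i - of_int \<lfloor>M * c $ i\<rfloor>\<bar> \<le> \<bar>a $ i\<bar> * 1" by (intro mult_left_mono) auto
      then have "\<bar>a $ i * (M * c $ i) - a $ i * of_int \<lfloor>M * c $ i\<rfloor>\<bar> \<le> \<bar>a $ i\<bar>"
        by (simp only: abs_mult[symmetric] right_diff_distrib mult_1_right)
      then show ?thesis by linarith
    qed
    then have "(\<Sum>i\<in>UNIV. a $ i * (M * c $ i) - \<bar>a $ i\<bar>) \<le> a \<bullet> p"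
      unfolding inner_vec_def p_def by (intro sum_mono) simp
    moreover have "(\<Sum>i\<in>UNIV. a $ i * (M * c $ i) - \<bar>a $ i\<bar>) = M * (a \<bullet> c) - (\<Sum>i\<in>UNIV. \<bar>a $ i\<bar>)"
      by (simp add: inner_vec_def sum_subtractf sum_distrib_left mult.left_commute)
    ultimately show ?thesis using 1 by linarith
  qed
  ultimately show thesis using that by blast
qed

text \<open>\<open>Q\<close> is invariant under the reflections. Among the \<open>u x\<close> take
  one with the largest \<open>Q (u x) base_pt\<close>: a positive root with negative value at it
  would give a reflection that increases this number.\<close>

lemma dominant_conjugate:
  obtains u where "u \<in> W0 Phi cor" "dominant (u x)"
proof -
  define Q where "Q x y = (\<Sum>a\<in>Phi. (a \<bullet> x) * (a \<bullet> y))" for x y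
  have inv: "Q (sref cor b x) (sref cor b y) = Q x y" if b: "b \<in> Phi" for b x y
    unfolding Q_def sref_pull
    using sum.reindex_bij_betw[OF reflect_bij[OF b], of "\<lambda>a. (a \<bullet> x) * (a \<bullet> y)"] by simp
  have Qlin: "Q (x - t *\<^sub>R z) y = Q x y - t * Q z y" for x y z t
    by (simp add: Q_def inner_diff_right left_diff_distrib sum_subtractf sum_distrib_left mult.assoc)
  have Qsym: "Q x y = Q y x" for x y by (simp add: Q_def mult.commute)
  have Qcor: "Q (cor b) y > 0" if b: "b \<in> Phi" "b \<bullet> y > 0" for b y
  proof -
    have "sref cor b (cor b) = 0 - 1 *\<^sub>R cor b" using root_cor[OF b(1)] by (simp add: sref_def scaleR_2)
    then have "Q (cor b) y = Q (0 - 1 *\<^sub>R cor b) (sref cor b y)" using inv[OF b(1), of "cor b" y] by simp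
    also have "\<dots> = Q 0 (sref cor b y) - Q (cor b) (sref cor b y)" using Qlin[of 0 1 "cor b"] by simp
    also have "Q 0 (sref cor b y) = 0" by (simp add: Q_def)
    also have "Q (cor b) (sref cor b y) = Q (cor b) y - (b \<bullet> y) * Q (cor b) (cor b)"
      unfolding sref_def by (simp only: Qsym[of "cor b" "_ - _"] Qlin) (simp only: Qsym[of y])
    finally have 2: "2 * Q (cor b) y = (b \<bullet> y) * Q (cor b) (cor b)" by simp
    have "(b \<bullet> cor b) * (b \<bullet> cor b) \<le> Q (cor b) (cor b)"
      unfolding Q_def using member_le_sum[OF b(1) _ finite_Phi, of "\<lambda>a. (a \<bullet> cor b) * (a \<bullet> cor b)"] by simp
    then have "Q (cor b) (cor b) > 0" using root_cor[OF b(1)] by simp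
    then have "2 * Q (cor b) y > 0" unfolding 2 using b(2) by simp
    then show ?thesis by simp
  qed
  define f where "f u = Q (u x) base_pt" for u :: "'n amap"
  have fin: "finite (f ` W0 Phi cor)" "f ` W0 Phi cor \<noteq> {}" using finite_W0 W0_id by auto
  obtain u where u: "u \<in> W0 Phi cor" "f u = Max (f ` W0 Phi cor)" using Max_in[OF fin] by auto
  have "0 \<le> a \<bullet> u x" if a: "a \<in> Pos" for a
  proof (rule ccontr)
    assume neg: "\<not> 0 \<le> a \<bullet> u x"
    have aP: "a \<in> Phi" using a Pos_subset by blast
    have "f (sref cor a \<circ> u) \<le> f u" unfolding u(2) using fin(1) W0_step[OF u(1) aP] by (intro Max_ge) auto
    moreover have "f (sref cor a \<circ> u) = f u - (a \<bullet> u x) * Q (cor a) base_pt"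
      by (simp add: f_def sref_def Qlin)
    moreover have "(a \<bullet> u x) * Q (cor a) base_pt < 0"
      using Qcor[OF aP] base_pt_bounds[OF a] neg by (simp add: mult_less_0_iff)
    ultimately show False by linarith
  qed
  then show thesis using that u(1) by (auto simp: dominant_def)
qed

lemma G_funpow_affine:
  assumes l: "l \<in> Lin" "p \<in> lattice" "g = (\<lambda>x. l x + p)"
  shows "\<exists>q\<in>lattice. g ^^ n = (\<lambda>x. (l ^^ n) x + q)"
proof (induction n)
  case 0
  show ?case by (intro bexI[of _ 0] lattice_zero) (simp add: fun_eq_iff)
next
  case (Suc n)
  then obtain q where q: "q \<in> lattice" "g ^^ n = (\<lambda>x. (l ^^ n) x + q)" by blast
  have "l q + p \<in> lattice" by (rule lattice_add[OF Lin_lattice[OF l(1) q(1)] l(2)])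
  moreover have "g ^^ Suc n = (\<lambda>x. (l ^^ Suc n) x + (l q + p))"
  proof
    fix x
    have "(g ^^ Suc n) x = l ((l ^^ n) x + q) + p" using q(2) l(3) by simp
    then show "(g ^^ Suc n) x = (l ^^ Suc n) x + (l q + p)" using linear_add[OF Lin_linear[OF l(1)]] by simp
  qed
  ultimately show ?case by blast
qed

lemma G_power_translation:
  assumes g: "g \<in> G"
  obtains n p where "n > 0" "p \<in> lattice" "g ^^ n = trans p"
proof -
  obtain l p where *: "l \<in> Lin" "p \<in> lattice" "g = (\<lambda>x. l x + p)" using g by (auto simp: G_iff)
  obtain n where n: "n > 0" "l ^^ n = id" using Lin_finite_order[OF *(1)] by blast
  obtain q where q: "q \<in> lattice" "g ^^ n = (\<lambda>x. (l ^^ n) x + q)" using G_funpow_affine[OF *] by blast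
  have "g ^^ n = trans q" unfolding q(2) n(2) trans_def by simp
  then show thesis using that n(1) q(1) by blast
qed

end

section \<open>The algebra modulo v - 1\<close>

context hecke_setting
begin

definition piv :: laurent where "piv = lv - 1"

text \<open>Why the deformation disappears modulo \<open>piv\<close>: the quadratic relation becomes
  \<open>T s * T s = 1\<close>.\<close>

lemma hh_piv: "hh = piv * (lv_inv * (lv + 1))"
proof -
  have "piv * (lv_inv * (lv + 1)) = (lv * lv_inv) * lv + lv * lv_inv - lv * lv_inv - lv_inv"
    by (simp add: piv_def algebra_simps)
  then show ?thesis by (simp add: lv_inverse hh_def)
qed

lemma piv_nonzero: "piv \<noteq> 0"
proof
  assume "piv = 0"
  then have "Poly_Mapping.lookup lv 0 = Poly_Mapping.lookup (1::laurent) 0" by (simp add: piv_def)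
  then show False by (simp add: lv_def lookup_single lookup_one)
qed

definition piH :: "'h set" where "piH = range (sc piv)"

lemma piH_subspace: "H.subspace piH"
  unfolding H.subspace_def piH_def
proof (intro conjI ballI allI)
  show "0 \<in> range (sc piv)" using H.scale_zero_right[of piv] by (metis rangeI)
  show "x + y \<in> range (sc piv)" if xy: "x \<in> range (sc piv)" "y \<in> range (sc piv)" for x y
  proof -
    obtain a b where "x = sc piv a" "y = sc piv b" using xy by blast
    then have "x + y = sc piv (a + b)" by (simp add: H.scale_right_distrib)
    then show ?thesis by blast
  qed
  show "sc c x \<in> range (sc piv)" if x: "x \<in> range (sc piv)" for c x
  proof -
    obtain a where "x = sc piv a" using x by blast
    then have "sc c x = sc piv (sc c a)" by (simp add: mult.commute)
    then show ?thesis by blast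
  qed
qed

lemma piH_mult_left: "x \<in> piH \<Longrightarrow> y * x \<in> piH" and piH_mult_right: "x \<in> piH \<Longrightarrow> x * y \<in> piH"
proof -
  assume "x \<in> piH"
  then obtain a where a: "x = sc piv a" by (auto simp: piH_def)
  have "y * x = sc piv (y * a)" "x * y = sc piv (a * y)"
    unfolding a by (rule sc_mult_right[symmetric], rule sc_mult_left[symmetric])
  then show "y * x \<in> piH" "x * y \<in> piH" unfolding piH_def by blast+
qed

lemma piH_trans: "\<lbrakk>x - y \<in> piH; y - z \<in> piH\<rbrakk> \<Longrightarrow> x - z \<in> piH"
  using H.subspace_add[OF piH_subspace, of "x - y" "y - z"] by simp

lemma piH_mult_cong: "\<lbrakk>a - a' \<in> piH; b - b' \<in> piH\<rbrakk> \<Longrightarrow> a * b - a' * b' \<in> piH"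
  using H.subspace_add[OF piH_subspace piH_mult_right[of "a - a'" b] piH_mult_left[of "b - b'" a']]
  by (simp add: algebra_simps)

lemma hh_piH: "sc hh x \<in> piH"
  unfolding hh_piv piH_def by (simp only: H.scale_scale[symmetric] rangeI)

lemma T_simple_mult:
  assumes s: "s \<in> simple_refls Phi cor Delta" "s \<in> G" "len s = 1" "s \<circ> s = id" and z: "z \<in> G"
  shows "T s * T z - T (s \<circ> z) \<in> piH"
proof -
  have sz: "s \<circ> z \<in> G" using G_comp s z by blast
  have szz: "s \<circ> (s \<circ> z) = z" using s(4) by (metis comp_assoc id_comp)
  have gen: "generic (z base_pt)" "generic (s base_pt)" using generic_G generic_base s z by auto
  have "len (s \<circ> z) = card (sep (s base_pt) (z base_pt))"
    using len_eq[OF sz] card_sep_G[OF s(2), of base_pt "(s \<circ> z) base_pt"] szz by (simp add: fun_eq_iff)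
  moreover have "len z = card (sep base_pt (z base_pt))" using len_eq[OF z] .
  moreover have "card (sep base_pt (s base_pt)) = 1" using len_eq[OF s(2)] s(3) by simp
  ultimately have "len (s \<circ> z) = len z + 1 \<or> len z = len (s \<circ> z) + 1"
    using card_sep_adjacent[OF gen(1) generic_base gen(2)] by (simp add: sep_commute)
  then show ?thesis
  proof
    assume "len (s \<circ> z) = len z + 1"
    then have "T s * T z = T (s \<circ> z)" using T_mult[OF s(2) z] s(3) by simp
    then show ?thesis using H.subspace_0[OF piH_subspace] by simp
  next
    assume l: "len z = len (s \<circ> z) + 1"
    then have "T s * T (s \<circ> z) = T z" using T_mult[OF s(2) sz] szz s(3) by simp
    then have "T s * T z = T s * T s * T (s \<circ> z)" by (simp add: mult.assoc)
    then have "T s * T z - T (s \<circ> z) = sc hh (T s * T (s \<circ> z))"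
      by (simp add: T_quadratic[OF s(1)] distrib_right sc_mult_left)
    then show ?thesis using hh_piH by simp
  qed
qed

lemma T_mult_piH: "\<lbrakk>x \<in> G; y \<in> G\<rbrakk> \<Longrightarrow> T x * T y - T (x \<circ> y) \<in> piH"
proof (induction "len x" arbitrary: x)
  case 0
  then have "sep base_pt (x base_pt) = {}" using len_eq[OF 0(2)] finite_sep by simp
  then have "len (x \<circ> y) = len x + len y" using len_comp_add[OF 0(2,3)] by simp
  from T_mult[OF 0(2,3) this] show ?case
    using H.subspace_0[OF piH_subspace] by (simp only: diff_self)
next
  case (Suc n)
  obtain s z where s: "s \<in> simple_refls Phi cor Delta" "s \<in> G" "len s = 1" "s \<circ> s = id"
    "z \<in> G" "len z = n" "x = s \<circ> z" "T x = T s * T z"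
    using reduced_factor[OF Suc(3) Suc(2)[symmetric]] by metis
  have 1: "T z * T y - T (z \<circ> y) \<in> piH" using Suc(1) s(5,6) Suc(4) by blast
  have "T x * T y - T s * T (z \<circ> y) \<in> piH"
    using piH_mult_left[OF 1, of "T s"] by (simp add: s(8) mult.assoc right_diff_distrib)
  moreover have "T s * T (z \<circ> y) - T (x \<circ> y) \<in> piH"
    using T_simple_mult[OF s(1-4) G_comp[OF s(5) Suc(4)]] by (simp add: s(7) comp_assoc)
  ultimately show ?case by (rule piH_trans)
qed

lemma T_inverse_piH:
  assumes x: "x \<in> G" and b: "b * T x = 1"
  shows "b - T (inv x) \<in> piH"
proof -
  have "T x * T (inv x) - 1 \<in> piH" using T_mult_piH[OF x G_inv[OF x]] x by (simp add: G_inv_comp T_id)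
  from piH_mult_left[OF this, of b] have "T (inv x) - b \<in> piH"
    by (simp add: right_diff_distrib mult.assoc[symmetric] b)
  then show ?thesis using H.subspace_neg[OF piH_subspace] by fastforce
qed

text \<open>Splitting the translation part as \<open>m1 - m2\<close> with both dominant lets every
  factor commute exactly with \<open>T (trans q)\<close>, by additivity of lengths. The inverse of
  \<open>T (trans m2)\<close> is used because \<open>T (trans (- m2))\<close> is controlled only
  modulo \<open>piv\<close>.\<close>

lemma commuting_lift:
  assumes y: "y \<in> G" and q: "q \<in> lattice" "dominant q" and com: "y \<circ> trans q = trans q \<circ> y"
  obtains a where "a - T y \<in> piH" "a * T (trans q) = T (trans q) * a"
proof -
  obtain u m where *: "u \<in> Lin" "m \<in> lattice" "y = (\<lambda>x. u x + m)" using y by (auto simp: G_iff)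
  have ulin: "linear u" using Lin_linear[OF *(1)] .
  \<comment> \<open>Commuting with the translation means that the linear part fixes
    \<open>q\<close>.\<close>
  have "u q + m = u 0 + m + q" using fun_cong[OF com, of 0] by (simp add: *(3) trans_def)
  then have uq: "u q = q" using linear_0[OF ulin] by simp
  have ucom: "u \<circ> trans q = trans q \<circ> u"
    using uq linear_add[OF ulin] by (simp add: trans_def fun_eq_iff)
  obtain rho where rho: "rho \<in> lattice" "\<And>a. a \<in> Pos \<Longrightarrow> 1 \<le> a \<bullet> rho" using strictly_dominant_lattice by blast
  \<comment> \<open>\<open>N\<close> bounds the values of positive roots at \<open>m\<close>; adding
    \<open>N\<close> times a strictly dominant lattice vector therefore makes \<open>m\<close>
    dominant.\<close>
  define N where "N = \<lceil>\<Sum>a\<in>Pos. \<bar>a \<bullet> m\<bar>\<rceil>"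
  have N: "\<bar>a \<bullet> m\<bar> \<le> of_int N" if "a \<in> Pos" for a
    using member_le_sum[OF that _ finite_Pos, of "\<lambda>a. \<bar>a \<bullet> m\<bar>"] unfolding N_def
    by (simp add: order_trans[OF _ le_of_int_ceiling])
  have "0 \<le> (\<Sum>a\<in>Pos. \<bar>a \<bullet> m\<bar>)" by (rule sum_nonneg) simp
  also have "\<dots> \<le> of_int N" unfolding N_def by (rule le_of_int_ceiling)
  finally have N0: "0 \<le> real_of_int N" .
  define m2 where "m2 = of_int N *\<^sub>R rho"
  define m1 where "m1 = m + m2"
  have Nrho: "of_int N \<le> of_int N * (a \<bullet> rho)" if "a \<in> Pos" for a
    using mult_left_mono[OF rho(2)[OF that] N0] by simp
  have m2: "m2 \<in> lattice" "dominant m2"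
    unfolding m2_def dominant_def using lattice_scale[OF rho(1)] order_trans[OF N0 Nrho] by auto
  have "0 \<le> a \<bullet> m1" if a: "a \<in> Pos" for a
    using N[OF a] Nrho[OF a] by (simp add: m1_def m2_def inner_add_right)
  then have m1: "m1 \<in> lattice" "dominant m1"
    unfolding m1_def dominant_def using lattice_add[OF *(2) m2(1)] by auto
  have G: "trans m1 \<in> G" "trans m2 \<in> G" "trans q \<in> G" "u \<in> G" using trans_G Lin_G m1 m2 q *(1) by auto
  have tq: "T (trans p) * T (trans q) = T (trans q) * T (trans p)" if p: "p \<in> lattice" "dominant p" for p
    using T_mult[OF trans_G[OF p(1)] G(3) len_trans_comp[OF p q]] T_mult[OF G(3) trans_G[OF p(1)] len_trans_comp[OF q p]]
    by (simp add: trans_comp add.commute)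
  have lu: "len (u \<circ> trans q) = len u + len (trans q)" by (rule len_Lin_trans[OF *(1) q])
  then have uqT: "T u * T (trans q) = T (trans q) * T u"
    using T_mult[OF G(4,3) lu] T_mult[OF G(3,4)] unfolding ucom by (simp add: add.commute)
  obtain b where b: "T (trans m2) * b = 1" "b * T (trans m2) = 1" using T_invertible[OF G(2)] by blast
  have bq: "b * T (trans q) = T (trans q) * b"
  proof -
    have "b * T (trans q) = b * (T (trans q) * T (trans m2)) * b" using b(1) by (simp add: mult.assoc)
    also have "\<dots> = (b * T (trans m2)) * T (trans q) * b" unfolding tq[OF m2, symmetric] by (simp only: mult.assoc)
    finally show ?thesis using b(2) by simp
  qed
  define a where "a = T (trans m1) * b * T u"
  have "a * T (trans q) = T (trans m1) * b * (T (trans q) * T u)" unfolding a_def mult.assoc uqT ..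
  also have "\<dots> = T (trans m1) * (T (trans q) * b) * T u" unfolding bq[symmetric] by (simp only: mult.assoc)
  also have "\<dots> = T (trans q) * a" unfolding a_def mult.assoc[symmetric] tq[OF m1] ..
  finally have acom: "a * T (trans q) = T (trans q) * a" .
  have b': "b - T (inv (trans m2)) \<in> piH" by (rule T_inverse_piH[OF G(2) b(2)])
  have z0: "x - x \<in> piH" for x using H.subspace_0[OF piH_subspace] by simp
  have "T (trans m1) * b - T (trans m1 \<circ> inv (trans m2)) \<in> piH"
    by (rule piH_trans[OF piH_mult_cong[OF z0 b'] T_mult_piH[OF G(1) G_inv[OF G(2)]]])
  then have "a - T ((trans m1 \<circ> inv (trans m2)) \<circ> u) \<in> piH"
    unfolding a_def
    by (rule piH_trans[OF piH_mult_cong[OF _ z0] T_mult_piH[OF G_comp[OF G(1) G_inv[OF G(2)]] G(4)]])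
  moreover have "(trans m1 \<circ> inv (trans m2)) \<circ> u = y"
    unfolding inv_trans trans_comp by (simp add: trans_def m1_def *(3) fun_eq_iff)
  ultimately show thesis using that acom by simp
qed

end

section \<open>Linear independence\<close>

context hecke_setting
begin

definition br :: "'h \<Rightarrow> 'h \<Rightarrow> 'h" where "br a b = a * b - b * a"

lemma br_comm: "br a b \<in> comm" unfolding br_def by (rule comm_mem)

text \<open>\<open>br_assoc\<close> is the cyclic identity from which \<open>shift\<close> inherits
  its additivity.\<close>

lemma br_add_left: "br (a + a') b = br a b + br a' b"
  and br_add_right: "br a (b + b') = br a b + br a b'"
  and br_swap: "br b a = - br a b"
  and br_assoc: "br (a * b) c = br a (b * c) + br b (c * a)"
  by (simp_all add: br_def algebra_simps)

lemma br_scale_left: "br (sc c a) b = sc c (br a b)"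
  unfolding br_def H.scale_right_diff_distrib using sc_mult_left[of c a b] sc_mult_right[of c b a] by simp

lemma br_scale_right: "br a (sc c b) = sc c (br a b)"
  unfolding br_def H.scale_right_diff_distrib using sc_mult_left[of c b a] sc_mult_right[of c a b] by simp

text \<open>A lift of \<open>w - g w g\<^sup>-\<^sup>1\<close> from the group ring to a commutator.\<close>

definition shift :: "'n amap \<Rightarrow> 'n amap \<Rightarrow> 'h" where
  "shift w g = br (T (w \<circ> inv g)) (T g)"

lemma shift_piH:
  assumes w: "w \<in> G" and g: "g \<in> G"
  shows "shift w g - (T w - T (g \<circ> w \<circ> inv g)) \<in> piH"
proof -
  have wg: "w \<circ> inv g \<in> G" using G_comp[OF w G_inv[OF g]] .
  have 1: "T (w \<circ> inv g) * T g - T w \<in> piH"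
    using T_mult_piH[OF wg g] g by (simp add: comp_assoc G_inv_comp)
  have 2: "T g * T (w \<circ> inv g) - T (g \<circ> w \<circ> inv g) \<in> piH"
    using T_mult_piH[OF g wg] by (simp only: comp_assoc)
  from H.subspace_diff[OF piH_subspace 1 2] show ?thesis
    unfolding shift_def br_def by (simp only: algebra_simps)
qed

definition coord :: "'n amap \<Rightarrow> 'h \<Rightarrow> laurent" where
  "coord w x = H.representation (T ` G) x (T w)"

lemma coord_diff: "coord w (x - y) = coord w x - coord w y"
  and coord_scale: "coord w (sc c x) = c * coord w x"
  and coord_sum: "coord w (sum f I) = (\<Sum>i\<in>I. coord w (f i))"
  unfolding coord_def
  using H.representation_scale[OF T_independent, of x c] H.representation_sum[OF T_independent, of I f]
    H.representation_diff[OF T_independent, of y x]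
  by (simp_all add: T_span)

lemma coord_T: "\<lbrakk>u \<in> G; w \<in> G\<rbrakk> \<Longrightarrow> coord w (T u) = (if u = w then 1 else 0)"
  unfolding coord_def using H.representation_basis[OF T_independent, of "T u"] inj_onD[OF T_inj, of w u] by auto

lemma coord_piH: "x \<in> piH \<Longrightarrow> piv dvd coord w x"
  unfolding piH_def using coord_scale by auto

lemma coord_eqI: "(\<And>w. w \<in> G \<Longrightarrow> coord w x = coord w y) \<Longrightarrow> x = y"
proof -
  assume eq: "\<And>w. w \<in> G \<Longrightarrow> coord w x = coord w y"
  have rep: "H.representation (T ` G) x = H.representation (T ` G) y"
  proof
    fix v
    show "H.representation (T ` G) x v = H.representation (T ` G) y v"
    proof (cases "v \<in> T ` G")
      case True
      then show ?thesis using eq unfolding coord_def by blast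
    next
      case False
      then show ?thesis using H.representation_ne_zero[of "T ` G" _ v] by metis
    qed
  qed
  have "v \<in> H.span (T ` G)" for v using T_span by simp
  from H.sum_nonzero_representation_eq[OF T_independent this[of x]]
    H.sum_nonzero_representation_eq[OF T_independent this[of y]]
  show ?thesis unfolding rep by (rule trans[OF sym])
qed

text \<open>The algebra is free over a ring in which \<open>piv\<close> can be cancelled.\<close>

lemma piv_cancel: "sc piv x = sc piv y \<Longrightarrow> x = y"
proof (rule coord_eqI)
  fix w assume "sc piv x = sc piv y"
  then have "piv * coord w x = piv * coord w y" using coord_scale by metis
  then show "coord w x = coord w y" using piv_nonzero by simp
qed

end

section \<open>Descent along the powers of v - 1\<close>

locale hecke_representatives = hecke_setting Phi Delta cor D sc T
  for Phi Delta :: "'n::finite vec set"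
    and cor :: "'n vec \<Rightarrow> 'n vec"
    and D :: "'n amap set"
    and sc :: "laurent \<Rightarrow> 'h::ring_1 \<Rightarrow> 'h"
    and T :: "'n amap \<Rightarrow> 'h" +
  fixes R :: "'n amap set"
  assumes R_sub: "R \<subseteq> G"
    and R_unique: "\<And>w. w \<in> G \<Longrightarrow> \<exists>!r. r \<in> R \<and> conjugate_in G w r"
begin

lemma conj_witness: "w \<in> G \<Longrightarrow> \<exists>g. g \<in> G \<and> g \<circ> w \<circ> inv g \<in> R \<and> (w \<in> R \<longrightarrow> g = id)"
proof -
  assume w: "w \<in> G"
  show ?thesis
  proof (cases "w \<in> R")
    case True
    have "id \<circ> w \<circ> inv id = w" by (metis comp_id id_comp inv_id)
    then show ?thesis using True G_id by (intro exI[of _ id]) metis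
  next
    case False
    obtain r g where r: "r \<in> R" "g \<in> G" "g \<circ> w = r \<circ> g"
      using R_unique[OF w] by (auto simp: conjugate_in_def)
    have "r = g \<circ> w \<circ> inv g" by (rule conj_eq[OF r(2,3)])
    then show ?thesis using r False by blast
  qed
qed

text \<open>The default \<open>id\<close> on \<open>R\<close> makes \<open>Cw\<close> vanish
  there.\<close>

definition cg :: "'n amap \<Rightarrow> 'n amap" where
  "cg w = (SOME g. g \<in> G \<and> g \<circ> w \<circ> inv g \<in> R \<and> (w \<in> R \<longrightarrow> g = id))"

definition rep :: "'n amap \<Rightarrow> 'n amap" where "rep w = cg w \<circ> w \<circ> inv (cg w)"

lemma cg: assumes "w \<in> G" shows "cg w \<in> G" "rep w \<in> R" "w \<in> R \<Longrightarrow> cg w = id"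
proof -
  have "cg w \<in> G \<and> cg w \<circ> w \<circ> inv (cg w) \<in> R \<and> (w \<in> R \<longrightarrow> cg w = id)"
    unfolding cg_def by (rule someI_ex[OF conj_witness[OF assms]])
  then show "cg w \<in> G" "rep w \<in> R" "w \<in> R \<Longrightarrow> cg w = id" unfolding rep_def by simp_all
qed

lemma rep_conj:
  assumes w: "w \<in> G" and g: "g \<in> G"
  shows "rep (g \<circ> w \<circ> inv g) = rep w"
proof -
  define v where "v = g \<circ> w \<circ> inv g"
  have v: "v \<in> G" unfolding v_def by (intro G_comp G_inv w g)
  have 1: "conjugate_in G w (rep w)"
    unfolding conjugate_in_def rep_def using cg(1)[OF w] by (intro bexI[of _ "cg w"]) (simp_all add: fun_eq_iff)
  have "(cg v \<circ> g) \<circ> w = rep v \<circ> (cg v \<circ> g)"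
    unfolding rep_def using cg(1)[OF v] g by (simp add: v_def fun_eq_iff)
  then have 2: "conjugate_in G w (rep v)"
    unfolding conjugate_in_def using G_comp[OF cg(1)[OF v] g] by blast
  have "rep v = rep w" using R_unique[OF w] 1 2 cg(2)[OF w] cg(2)[OF v] by blast
  then show ?thesis by (simp add: v_def)
qed

text \<open>By \<open>shift_piH\<close> this commutator lifts \<open>w\<close> minus its
  representative.\<close>

definition Cw :: "'n amap \<Rightarrow> 'h" where "Cw w = shift w (cg w)"

lemma br_one: "br x 1 = 0" by (simp add: br_def)

lemma shift_id: "shift w id = 0"
  unfolding shift_def T_id by (rule br_one)

lemma Cw_R: "\<lbrakk>w \<in> G; w \<in> R\<rbrakk> \<Longrightarrow> Cw w = 0"
  unfolding Cw_def using cg(3) shift_id by simp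

definition Sp :: "'h set" where "Sp = H.span (Cw ` G)"

lemma Sp_subspace: "H.subspace Sp" by (simp add: Sp_def H.subspace_span)

text \<open>The integer factor \<open>N\<close> is needed because only a power of a centralizing element is a
  translation.\<close>

definition Zs :: "'h set" where
  "Zs = {X. \<exists>N::nat. N > 0 \<and> (\<exists>S\<in>Sp. \<exists>Y\<in>comm. sc (of_nat N) X = S + sc piv Y)}"

lemma ZsI: "\<lbrakk>N > 0; S \<in> Sp; Y \<in> comm; sc (of_nat N) X = S + sc piv Y\<rbrakk> \<Longrightarrow> X \<in> Zs"
  unfolding Zs_def by blast

lemma Zs_subspace: "H.subspace Zs"
  unfolding H.subspace_def
proof (intro conjI ballI allI)
  show "0 \<in> Zs"
    by (rule ZsI[of 1 0 0]) (simp_all add: H.subspace_0[OF Sp_subspace] comm_zero)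
  fix x assume "x \<in> Zs"
  then obtain N S Y where x: "N > 0" "S \<in> Sp" "Y \<in> comm" "sc (of_nat N) x = S + sc piv Y"
    unfolding Zs_def by blast
  show "sc c x \<in> Zs" for c
  proof (rule ZsI[OF x(1) H.subspace_scale[OF Sp_subspace x(2), of c] comm_scale[OF x(3), of c]])
    have "sc (of_nat N) (sc c x) = sc c (sc (of_nat N) x)" by (simp add: mult.commute)
    also have "\<dots> = sc c S + sc piv (sc c Y)" unfolding x(4) by (simp add: H.scale_right_distrib mult.commute)
    finally show "sc (of_nat N) (sc c x) = sc c S + sc piv (sc c Y)" .
  qed
  fix y assume "y \<in> Zs"
  then obtain M S' Y' where y: "M > 0" "S' \<in> Sp" "Y' \<in> comm" "sc (of_nat M) y = S' + sc piv Y'"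
    unfolding Zs_def by blast
  show "x + y \<in> Zs"
  proof (rule ZsI)
    show "N * M > 0" using x y by simp
    show "sc (of_nat M) S + sc (of_nat N) S' \<in> Sp"
      by (intro H.subspace_add[OF Sp_subspace] H.subspace_scale[OF Sp_subspace] x y)
    show "sc (of_nat M) Y + sc (of_nat N) Y' \<in> comm" by (intro comm_add comm_scale x y)
    have "sc (of_nat (N * M)) (x + y) = sc (of_nat M) (sc (of_nat N) x) + sc (of_nat N) (sc (of_nat M) y)"
      by (simp add: H.scale_right_distrib mult.commute)
    also have "\<dots> = sc (of_nat M) S + sc (of_nat N) S' + sc piv (sc (of_nat M) Y + sc (of_nat N) Y')"
      unfolding x(4) y(4) by (simp add: H.scale_right_distrib mult.commute algebra_simps)
    finally show "sc (of_nat (N * M)) (x + y)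
      = sc (of_nat M) S + sc (of_nat N) S' + sc piv (sc (of_nat M) Y + sc (of_nat N) Y')" .
  qed
qed

lemmas Zs_add = H.subspace_add[OF Zs_subspace]
lemmas Zs_diff = H.subspace_diff[OF Zs_subspace]
lemmas Zs_neg = H.subspace_neg[OF Zs_subspace]

lemma Zs_zero: "0 \<in> Zs" by (rule H.subspace_0[OF Zs_subspace])

lemma Zs_torsion: "\<lbrakk>k > 0; sc (of_nat k) X \<in> Zs\<rbrakk> \<Longrightarrow> X \<in> Zs"
proof -
  assume k: "k > 0" and "sc (of_nat k) X \<in> Zs"
  then obtain N S Y where x: "N > 0" "S \<in> Sp" "Y \<in> comm" "sc (of_nat N) (sc (of_nat k) X) = S + sc piv Y"
    unfolding Zs_def by blast
  then show ?thesis using k by (intro ZsI[of "N * k" S Y]) (simp_all add: H.scale_scale)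
qed

lemma Zs_piv: "Y \<in> comm \<Longrightarrow> sc piv Y \<in> Zs"
  by (rule ZsI[of 1 0 Y]) (simp_all add: H.subspace_0[OF Sp_subspace])

lemma Zs_Cw: "w \<in> G \<Longrightarrow> Cw w \<in> Zs"
  by (rule ZsI[of 1 "Cw w" 0]) (auto simp: Sp_def comm_zero intro: H.span_base)

text \<open>Changing an argument by a multiple of \<open>piv\<close> changes the bracket by
  \<open>piv\<close> times a commutator, which \<open>Zs\<close> absorbs.\<close>

lemma br_cong:
  assumes a: "a - a' \<in> piH" and b: "b - b' \<in> piH"
  shows "br a b - br a' b' \<in> Zs"
proof -
  obtain c where c: "a - a' = sc piv c" using a by (auto simp: piH_def)
  obtain d where d: "b - b' = sc piv d" using b by (auto simp: piH_def)
  have "br a b - br a' b' = br (a - a') b + br a' (b - b')" by (simp add: br_def algebra_simps)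
  also have "\<dots> = sc piv (br c b + br a' d)" unfolding c d br_scale_left br_scale_right by (simp add: H.scale_right_distrib)
  finally show ?thesis using Zs_piv[OF comm_add[OF br_comm br_comm]] by simp
qed

lemma piH_refl: "x - x \<in> piH" using H.subspace_0[OF piH_subspace] by simp

lemma br_cocycle:
  assumes x: "x \<in> G" and y: "y \<in> G" and z: "z \<in> G"
  shows "br (T (x \<circ> y)) (T z) - br (T x) (T (y \<circ> z)) - br (T y) (T (z \<circ> x)) \<in> Zs"
proof -
  have 1: "br (T x * T y) (T z) - br (T (x \<circ> y)) (T z) \<in> Zs" by (rule br_cong[OF T_mult_piH[OF x y] piH_refl])
  have 2: "br (T x) (T y * T z) - br (T x) (T (y \<circ> z)) \<in> Zs" by (rule br_cong[OF piH_refl T_mult_piH[OF y z]])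
  have 3: "br (T y) (T z * T x) - br (T y) (T (z \<circ> x)) \<in> Zs" by (rule br_cong[OF piH_refl T_mult_piH[OF z x]])
  have "br (T (x \<circ> y)) (T z) - br (T x) (T (y \<circ> z)) - br (T y) (T (z \<circ> x))
    = (br (T x) (T y * T z) - br (T x) (T (y \<circ> z))) + (br (T y) (T z * T x) - br (T y) (T (z \<circ> x)))
      - (br (T x * T y) (T z) - br (T (x \<circ> y)) (T z))"
    unfolding br_assoc[of "T x" "T y" "T z"] by (simp only: algebra_simps)
  then show ?thesis using Zs_diff[OF Zs_add[OF 2 3] 1] by (simp only:)
qed

text \<open>The cyclic identity for \<open>w \<circ> inv g \<circ> inv k\<close>, \<open>k\<close>
  and \<open>g\<close>: modulo \<open>Zs\<close>, successive conjugations add up. On the centralizer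
  of \<open>w\<close> this is the additivity of the character.\<close>

lemma shift_comp:
  assumes w: "w \<in> G" and g: "g \<in> G" and k: "k \<in> G"
  shows "shift w (k \<circ> g) - (shift w g + shift (g \<circ> w \<circ> inv g) k) \<in> Zs"
proof -
  define x where "x = w \<circ> inv g \<circ> inv k"
  have x: "x \<in> G" unfolding x_def by (intro G_comp G_inv w g k)
  have e1: "x \<circ> k = w \<circ> inv g" unfolding x_def using k by (simp add: fun_eq_iff)
  have e2: "w \<circ> inv (k \<circ> g) = x" unfolding x_def inv_comp[OF k g] by (simp only: comp_assoc)
  have e3: "g \<circ> w \<circ> inv g \<circ> inv k = g \<circ> x" unfolding x_def by (simp only: comp_assoc)
  have "br (T (w \<circ> inv g)) (T g) - br (T x) (T (k \<circ> g)) - br (T k) (T (g \<circ> x)) \<in> Zs"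
    using br_cocycle[OF x k g] unfolding e1 .
  then have "shift w g - shift w (k \<circ> g) + shift (g \<circ> w \<circ> inv g) k \<in> Zs"
    unfolding shift_def e2 e3 br_swap[of "T (g \<circ> x)" "T k"] by simp
  from Zs_neg[OF this] show ?thesis by (simp add: algebra_simps)
qed

lemma shift_power:
  assumes w: "w \<in> G" and z: "z \<in> G" and com: "z \<circ> w \<circ> inv z = w"
  shows "shift w (z ^^ n) - sc (of_nat n) (shift w z) \<in> Zs \<and> z ^^ n \<in> G \<and> z ^^ n \<circ> w \<circ> inv (z ^^ n) = w"
proof (induction n)
  case 0
  have "z ^^ 0 = id" by simp
  moreover have "id \<circ> w \<circ> inv id = w" by (metis comp_id id_comp inv_id)
  ultimately show ?case using shift_id Zs_zero G_id by (metis H.scale_zero_left diff_zero of_nat_0)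
next
  case (Suc n)
  have zn: "z ^^ n \<in> G" "z ^^ n \<circ> w \<circ> inv (z ^^ n) = w" using Suc by blast+
  have "shift w (z \<circ> z ^^ n) - (shift w (z ^^ n) + shift w z) \<in> Zs"
    using shift_comp[OF w zn(1) z] unfolding zn(2) .
  from Zs_add[OF this conjunct1[OF Suc]]
  have 1: "shift w (z \<circ> z ^^ n) - sc (of_nat (Suc n)) (shift w z) \<in> Zs"
    by (simp add: H.scale_left_distrib algebra_simps)
  have "(z \<circ> z ^^ n) \<circ> w \<circ> inv (z \<circ> z ^^ n) = z \<circ> (z ^^ n \<circ> w \<circ> inv (z ^^ n)) \<circ> inv z"
    unfolding inv_comp[OF z zn(1)] by (simp only: comp_assoc)
  then have 2: "(z \<circ> z ^^ n) \<circ> w \<circ> inv (z \<circ> z ^^ n) = w" unfolding zn(2) com .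
  show ?case unfolding funpow.simps using 1 2 G_comp[OF z zn(1)] by blast
qed

text \<open>By \<open>commuting_lift\<close> the factor \<open>T (w \<circ> inv (trans q))\<close>
  can be exchanged, modulo \<open>piH\<close>, for one that commutes with
  \<open>T (trans q)\<close>.\<close>

lemma shift_dominant:
  assumes w: "w \<in> G" and q: "q \<in> lattice" "dominant q" and com: "trans q \<circ> w \<circ> inv (trans q) = w"
  shows "shift w (trans q) \<in> Zs"
proof -
  have tG: "trans q \<in> G" using trans_G q by blast
  define y where "y = w \<circ> inv (trans q)"
  have y: "y \<in> G" unfolding y_def by (intro G_comp G_inv w tG)
  have "y \<circ> trans q = w" unfolding y_def using tG by (simp add: fun_eq_iff)
  moreover have "trans q \<circ> y = w" unfolding y_def using com by (simp only: comp_assoc)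
  ultimately have yc: "y \<circ> trans q = trans q \<circ> y" by simp
  obtain a where a: "a - T y \<in> piH" "a * T (trans q) = T (trans q) * a" using commuting_lift[OF y q yc] by blast
  have "br a (T (trans q)) - br (T y) (T (trans q)) \<in> Zs" by (rule br_cong[OF a(1) piH_refl])
  moreover have "br a (T (trans q)) = 0" using a(2) by (simp add: br_def)
  ultimately show ?thesis unfolding shift_def y_def[symmetric] using Zs_neg by fastforce
qed

text \<open>Conjugate \<open>q\<close> to a dominant \<open>u q\<close>; evaluating
  \<open>shift\<close> on both sides of \<open>u \<circ> trans q = trans (u q) \<circ> u\<close>
  cancels \<open>shift w u\<close>.\<close>

lemma shift_translation:
  assumes w: "w \<in> G" and q: "q \<in> lattice" and com: "trans q \<circ> w \<circ> inv (trans q) = w"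
  shows "shift w (trans q) \<in> Zs"
proof -
  obtain u where u: "u \<in> W0 Phi cor" "dominant (u q)" using dominant_conjugate by blast
  have uL: "u \<in> Lin" using W0_Lin[OF u(1)] .
  have uG: "u \<in> G" using Lin_G[OF uL] .
  have uq: "u q \<in> lattice" using Lin_lattice[OF uL q] .
  have tG: "trans q \<in> G" "trans (u q) \<in> G" using trans_G q uq by auto
  have ut: "u \<circ> trans q = trans (u q) \<circ> u"
    using linear_add[OF Lin_linear[OF uL]] by (simp add: trans_def fun_eq_iff)
  define v where "v = u \<circ> w \<circ> inv u"
  have v: "v \<in> G" unfolding v_def by (intro G_comp G_inv w uG)
  have "trans (u q) \<circ> v \<circ> inv (trans (u q)) = (trans (u q) \<circ> u) \<circ> w \<circ> inv (trans (u q) \<circ> u)"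
    unfolding v_def inv_comp[OF tG(2) uG] by (simp only: comp_assoc)
  also have "\<dots> = u \<circ> (trans q \<circ> w \<circ> inv (trans q)) \<circ> inv u"
    unfolding ut[symmetric] inv_comp[OF uG tG(1)] by (simp only: comp_assoc)
  finally have vc: "trans (u q) \<circ> v \<circ> inv (trans (u q)) = v" unfolding com v_def .
  have 1: "shift w (u \<circ> trans q) - (shift w (trans q) + shift w u) \<in> Zs"
    using shift_comp[OF w tG(1) uG] unfolding com .
  have 2: "shift w (trans (u q) \<circ> u) - (shift w u + shift v (trans (u q))) \<in> Zs"
    using shift_comp[OF w uG tG(2)] unfolding v_def .
  have 3: "shift v (trans (u q)) \<in> Zs" by (rule shift_dominant[OF v uq u(2) vc])
  have "shift w (trans q) = shift v (trans (u q))
     + ((shift w (trans (u q) \<circ> u) - (shift w u + shift v (trans (u q))))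
     - (shift w (u \<circ> trans q) - (shift w (trans q) + shift w u)))"
    unfolding ut by simp
  then show ?thesis using Zs_add[OF 3 Zs_diff[OF 2 1]] by simp
qed

text \<open>A power \<open>z ^^ n\<close> is a translation; its shift is \<open>n\<close> times that
  of \<open>z\<close> modulo \<open>Zs\<close>, and \<open>Zs_torsion\<close> removes the factor
  \<open>n\<close>.\<close>

lemma shift_centralizer:
  assumes w: "w \<in> G" and z: "z \<in> G" and com: "z \<circ> w \<circ> inv z = w"
  shows "shift w z \<in> Zs"
proof -
  obtain n p where n: "n > 0" "p \<in> lattice" "z ^^ n = trans p" using G_power_translation[OF z] by blast
  have 1: "shift w (trans p) - sc (of_nat n) (shift w z) \<in> Zs" and 2: "trans p \<circ> w \<circ> inv (trans p) = w"
    using shift_power[OF w z com, of n] unfolding n(3) by auto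
  have "sc (of_nat n) (shift w z) = shift w (trans p) - (shift w (trans p) - sc (of_nat n) (shift w z))" by simp
  then have "sc (of_nat n) (shift w z) \<in> Zs"
    using Zs_diff[OF shift_translation[OF w n(2) 2] 1] by metis
  then show ?thesis using Zs_torsion[OF n(1)] by blast
qed

text \<open>Both \<open>cg v \<circ> g\<close> and \<open>cg w\<close> conjugate \<open>w\<close> to
  its representative, so they differ by an element \<open>z\<close> centralizing the representative,
  which contributes nothing modulo \<open>Zs\<close>.\<close>

lemma shift_Zs:
  assumes w: "w \<in> G" and g: "g \<in> G"
  shows "shift w g \<in> Zs"
proof -
  define v where "v = g \<circ> w \<circ> inv g"
  have v: "v \<in> G" unfolding v_def by (intro G_comp G_inv w g)
  have cgG: "cg w \<in> G" "cg v \<in> G" using cg(1) w v by auto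
  define z where "z = cg v \<circ> g \<circ> inv (cg w)"
  have z: "z \<in> G" unfolding z_def by (intro G_comp G_inv cgG g)
  have zc: "z \<circ> cg w = cg v \<circ> g" unfolding z_def using cgG by (simp add: fun_eq_iff)
  have rG: "rep w \<in> G" using cg(2)[OF w] R_sub by blast
  have "z \<circ> rep w \<circ> inv z = (z \<circ> cg w) \<circ> w \<circ> inv (z \<circ> cg w)"
    unfolding rep_def inv_comp[OF z cgG(1)] by (simp only: comp_assoc)
  also have "\<dots> = cg v \<circ> (g \<circ> w \<circ> inv g) \<circ> inv (cg v)"
    unfolding zc inv_comp[OF cgG(2) g] by (simp only: comp_assoc)
  also have "\<dots> = rep v" unfolding v_def[symmetric] rep_def ..
  also have "\<dots> = rep w" unfolding v_def by (rule rep_conj[OF w g])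
  finally have com: "z \<circ> rep w \<circ> inv z = rep w" .
  have 1: "shift w (cg v \<circ> g) - (shift w g + Cw v) \<in> Zs"
    using shift_comp[OF w g cgG(2)] unfolding Cw_def v_def .
  have 2: "shift w (z \<circ> cg w) - (Cw w + shift (rep w) z) \<in> Zs"
    using shift_comp[OF w cgG(1) z] unfolding Cw_def rep_def .
  have 3: "shift (rep w) z \<in> Zs" by (rule shift_centralizer[OF rG z com])
  have "shift w g = ((shift w (z \<circ> cg w) - (Cw w + shift (rep w) z)) + (Cw w + shift (rep w) z))
     - ((shift w (cg v \<circ> g) - (shift w g + Cw v)) + Cw v)"
    unfolding zc by simp
  moreover have "\<dots> \<in> Zs"
    by (intro Zs_diff Zs_add 1 2 3 Zs_Cw w v)
  ultimately show ?thesis by metis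
qed

lemma br_T_Zs: "\<lbrakk>x \<in> G; y \<in> G\<rbrakk> \<Longrightarrow> br (T x) (T y) \<in> Zs"
proof -
  assume xy: "x \<in> G" "y \<in> G"
  have "(x \<circ> y) \<circ> inv y = x" using xy by (simp add: fun_eq_iff)
  then have "shift (x \<circ> y) y = br (T x) (T y)" unfolding shift_def by (simp only:)
  then show ?thesis using shift_Zs[OF G_comp[OF xy] xy(2)] by simp
qed

lemma br_Zs: "br a b \<in> Zs"
proof -
  have left: "br a (T y) \<in> Zs" if y: "y \<in> G" and a: "a \<in> H.span (T ` G)" for a y
    using a
  proof (induction rule: H.span_induct_alt)
    case base
    then show ?case using Zs_zero by (simp add: br_def)
  next
    case (step c x z)
    then show ?case unfolding br_add_left br_scale_left
      using br_T_Zs[OF _ y] by (intro Zs_add H.subspace_scale[OF Zs_subspace]) auto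
  qed
  have "b \<in> H.span (T ` G)" using T_span by simp
  then show ?thesis
  proof (induction rule: H.span_induct_alt)
    case base
    then show ?case using Zs_zero by (simp add: br_def)
  next
    case (step c x z)
    then show ?case unfolding br_add_right br_scale_right
      using left[of _ a] T_span by (intro Zs_add H.subspace_scale[OF Zs_subspace]) auto
  qed
qed

lemma comm_Zs: "comm \<subseteq> Zs"
  unfolding commutator_span_def
proof (rule H.span_minimal[OF _ Zs_subspace])
  show "{a * b - b * a |a b. True} \<subseteq> Zs" using br_Zs unfolding br_def by blast
qed

text \<open>The inclusion of \<open>comm\<close> in \<open>Zs\<close> is applied again to the
  remainder \<open>Y\<close>; the integer factors multiply.\<close>

lemma comm_approx:
  assumes X: "X \<in> comm"
  shows "\<exists>N::nat. N > 0 \<and> (\<exists>S\<in>Sp. \<exists>Y\<in>comm. sc (of_nat N) X = S + sc (piv ^ k) Y)"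
proof (induction k)
  case 0
  show ?case using X H.subspace_0[OF Sp_subspace] by (intro exI[of _ 1] conjI bexI[of _ 0] bexI[of _ X]) simp_all
next
  case (Suc k)
  then obtain N S Y where N: "N > 0" "S \<in> Sp" "Y \<in> comm" "sc (of_nat N) X = S + sc (piv ^ k) Y" by blast
  have "Y \<in> Zs" using comm_Zs N(3) by blast
  then obtain M S' Y' where M: "M > 0" "S' \<in> Sp" "Y' \<in> comm" "sc (of_nat M) Y = S' + sc piv Y'"
    unfolding Zs_def by blast
  have "sc (of_nat (M * N)) X = sc (of_nat M) (sc (of_nat N) X)" by simp
  also have "\<dots> = sc (of_nat M) S + sc (piv ^ k) (sc (of_nat M) Y)"
    unfolding N(4) by (simp add: H.scale_right_distrib mult.commute)
  also have "\<dots> = (sc (of_nat M) S + sc (piv ^ k) S') + sc (piv ^ Suc k) Y'"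
    unfolding M(4) by (simp add: H.scale_right_distrib mult.commute add.assoc)
  finally have eq: "sc (of_nat (M * N)) X = (sc (of_nat M) S + sc (piv ^ k) S') + sc (piv ^ Suc k) Y'" .
  have "sc (of_nat M) S + sc (piv ^ k) S' \<in> Sp"
    by (intro H.subspace_add[OF Sp_subspace] H.subspace_scale[OF Sp_subspace] N M)
  moreover have "M * N > 0" using N M by simp
  ultimately show ?case using eq M(3) by blast
qed

definition bv :: "'n amap \<Rightarrow> 'h" where "bv w = (if w \<in> R then T w else Cw w)"

lemma coord_bv:
  assumes u: "u \<in> G" and v: "v \<in> G"
  shows "piv dvd coord v (bv u) - ((if u = v then 1 else 0) - (if u \<notin> R \<and> rep u = v then 1 else 0))"
proof (cases "u \<in> R")
  case True
  then show ?thesis using coord_T[OF u v] by (simp add: bv_def)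
next
  case False
  have rG: "rep u \<in> G" using cg(2)[OF u] R_sub by blast
  have "shift u (cg u) - (T u - T (rep u)) \<in> piH" using shift_piH[OF u cg(1)[OF u]] unfolding rep_def .
  from coord_piH[OF this, of v] show ?thesis
    using False coord_T[OF u v] coord_T[OF rG v] by (simp add: coord_diff bv_def Cw_def)
qed

text \<open>Modulo \<open>piv\<close> the family is triangular: the coordinate at a
  non-representative \<open>v\<close> comes from \<open>bv v\<close> alone, so coefficients outside
  \<open>R\<close> are settled first and those in \<open>R\<close> afterwards. Dividing the relation
  by \<open>piv\<close> gives the induction on \<open>k\<close>.\<close>

lemma bv_divisible:
  "\<lbrakk>finite F; F \<subseteq> G; (\<Sum>w\<in>F. sc (c w) (bv w)) = sc (piv ^ k) x\<rbrakk> \<Longrightarrow> \<forall>w\<in>F. piv ^ k dvd c w"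
proof (induction k arbitrary: c)
  case 0
  then show ?case by simp
next
  case (Suc k)
  define d where "d u v = (if u = v then 1 else 0) - (if u \<notin> R \<and> rep u = v then 1 else (0::laurent))" for u v
  have cong: "piv dvd (\<Sum>u\<in>F. c u * d u v)" if v: "v \<in> G" for v
  proof -
    have "(\<Sum>u\<in>F. c u * coord v (bv u)) = coord v (sc (piv ^ Suc k) x)"
      unfolding Suc(4)[symmetric] coord_sum coord_scale ..
    then have d1: "piv dvd (\<Sum>u\<in>F. c u * coord v (bv u))" by (simp add: coord_scale)
    have d2: "piv dvd (\<Sum>u\<in>F. c u * (coord v (bv u) - d u v))"
    proof (rule dvd_sum)
      fix u assume "u \<in> F"
      then have "u \<in> G" using Suc(3) by blast
      then show "piv dvd c u * (coord v (bv u) - d u v)"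
        unfolding d_def by (intro dvd_mult coord_bv[OF _ v])
    qed
    have eq: "(\<Sum>u\<in>F. c u * d u v)
      = (\<Sum>u\<in>F. c u * coord v (bv u)) - (\<Sum>u\<in>F. c u * (coord v (bv u) - d u v))"
      by (simp add: right_diff_distrib sum_subtractf)
    show ?thesis unfolding eq by (rule dvd_diff[OF d1 d2])
  qed
  have out: "piv dvd c v" if v: "v \<in> F" "v \<notin> R" for v
  proof -
    have vG: "v \<in> G" using v Suc(3) by blast
    have "(\<Sum>u\<in>F. c u * d u v) = (\<Sum>u\<in>F. if u = v then c v else 0)"
    proof (rule sum.cong)
      fix u assume u: "u \<in> F"
      have "rep u \<in> R" using cg(2) u Suc(3) by blast
      then have "rep u \<noteq> v" using v(2) by blast
      then show "c u * d u v = (if u = v then c v else 0)" by (simp add: d_def)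
    qed simp
    then show ?thesis using cong[OF vG] v(1) Suc(2) by simp
  qed
  have "piv dvd c v" if v: "v \<in> F" for v
  proof (cases "v \<in> R")
    case True
    have vG: "v \<in> G" using v Suc(3) by blast
    have "d v v = 1" using True by (simp add: d_def)
    then have eq: "c v = (\<Sum>u\<in>F. c u * d u v) - (\<Sum>u\<in>F - {v}. c u * d u v)"
      using sum.remove[OF Suc(2) v, of "\<lambda>u. c u * d u v"] by simp
    have dvd: "piv dvd (\<Sum>u\<in>F - {v}. c u * d u v)"
    proof (rule dvd_sum)
      fix u assume u: "u \<in> F - {v}"
      show "piv dvd c u * d u v"
      proof (cases "u \<in> R")
        case True
        then show ?thesis using u by (simp add: d_def)
      next
        case False
        then show ?thesis using out[of u] u by (intro dvd_mult2) auto
      qed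
    qed
    show ?thesis unfolding eq by (rule dvd_diff[OF cong[OF vG] dvd])
  qed (use out v in blast)
  then have "\<forall>v\<in>F. \<exists>e. c v = piv * e" by (auto elim: dvdE)
  then obtain e where e: "\<And>v. v \<in> F \<Longrightarrow> c v = piv * e v" by metis
  have "sc piv (\<Sum>w\<in>F. sc (e w) (bv w)) = (\<Sum>w\<in>F. sc (c w) (bv w))"
    unfolding H.scale_sum_right by (rule sum.cong) (simp_all add: e)
  also have "\<dots> = sc piv (sc (piv ^ k) x)" unfolding Suc(4) by simp
  finally have "(\<Sum>w\<in>F. sc (e w) (bv w)) = sc (piv ^ k) x" by (rule piv_cancel)
  then have "\<forall>w\<in>F. piv ^ k dvd e w" using Suc(1)[OF Suc(2,3)] by blast
  then show ?case using e by (simp add: mult_dvd_mono)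
qed

lemma Sp_finite_sum:
  assumes "S \<in> Sp"
  shows "\<exists>F c. finite F \<and> F \<subseteq> G - R \<and> S = (\<Sum>w\<in>F. sc (c w) (Cw w))"
  using assms unfolding Sp_def
proof (induction rule: H.span_induct_alt)
  case base
  show ?case by (rule exI[of _ "{}"]) simp
next
  case (step a x y)
  then obtain F c where F: "finite F" "F \<subseteq> G - R" "y = (\<Sum>w\<in>F. sc (c w) (Cw w))" by blast
  obtain u where u: "u \<in> G" "x = Cw u" using step by blast
  show ?case
  proof (cases "u \<in> R")
    case True
    then have "sc a x + y = y" using u Cw_R by simp
    then show ?thesis using F by auto
  next
    case False
    \<comment> \<open>\<open>u\<close> may already lie in \<open>F\<close>, so the two coefficients
      are added.\<close>
    define e where "e w = (if w \<in> F then c w else 0) + (if w = u then a else 0)" for w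
    have "(\<Sum>w\<in>insert u F. sc (e w) (Cw w))
       = (\<Sum>w\<in>insert u F. sc (if w \<in> F then c w else 0) (Cw w)) + (\<Sum>w\<in>insert u F. sc (if w = u then a else 0) (Cw w))"
      by (simp only: e_def H.scale_left_distrib sum.distrib)
    also have "(\<Sum>w\<in>insert u F. sc (if w \<in> F then c w else 0) (Cw w)) = (\<Sum>w\<in>F. sc (if w \<in> F then c w else 0) (Cw w))"
      using F(1) by (intro sum.mono_neutral_right) auto
    also have "\<dots> = y" unfolding F(3) by (rule sum.cong) simp_all
    also have "(\<Sum>w\<in>insert u F. sc (if w = u then a else 0) (Cw w)) = (\<Sum>w\<in>{u}. sc (if w = u then a else 0) (Cw w))"
      using F(1) by (intro sum.mono_neutral_right) auto
    also have "\<dots> = sc a x" by (simp add: u(2))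
    finally have "sc a x + y = (\<Sum>w\<in>insert u F. sc (e w) (Cw w))" by simp
    then show ?thesis using F(1,2) u(1) False by (intro exI[of _ "insert u F"] exI[of _ e]) auto
  qed
qed

theorem representatives_independent:
  assumes F: "finite F" "F \<subseteq> R" and X: "(\<Sum>r\<in>F. sc (f r) (T r)) \<in> comm" and r: "r \<in> F"
  shows "f r = 0"
proof (rule laurent_zeroI)
  fix k
  obtain N S Y where N: "N > 0" "S \<in> Sp" "Y \<in> comm"
    "sc (of_nat N) (\<Sum>r\<in>F. sc (f r) (T r)) = S + sc (piv ^ k) Y"
    using comm_approx[OF X] by blast
  obtain F' c where F': "finite F'" "F' \<subseteq> G - R" "S = (\<Sum>w\<in>F'. sc (c w) (Cw w))"
    using Sp_finite_sum[OF N(2)] by blast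
  \<comment> \<open>\<open>S\<close> is moved to the other side, hence the sign; what is left is
    \<open>piv ^ k\<close> times \<open>Y\<close>, and \<open>k\<close> is arbitrary.\<close>
  define e where "e w = (if w \<in> R then of_nat N * f w else - c w)" for w
  have disj: "F \<inter> F' = {}" using F F' by blast
  have "(\<Sum>w\<in>F \<union> F'. sc (e w) (bv w)) = (\<Sum>w\<in>F. sc (e w) (bv w)) + (\<Sum>w\<in>F'. sc (e w) (bv w))"
    by (rule sum.union_disjoint[OF F(1) F'(1) disj])
  also have "(\<Sum>w\<in>F. sc (e w) (bv w)) = sc (of_nat N) (\<Sum>r\<in>F. sc (f r) (T r))"
    unfolding H.scale_sum_right by (rule sum.cong) (use F in \<open>auto simp: e_def bv_def\<close>)
  also have "(\<Sum>w\<in>F'. sc (e w) (bv w)) = - S"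
    unfolding F'(3) sum_negf[symmetric] by (rule sum.cong) (use F' in \<open>auto simp: e_def bv_def\<close>)
  finally have "(\<Sum>w\<in>F \<union> F'. sc (e w) (bv w)) = sc (piv ^ k) Y" unfolding N(4) by simp
  then have "\<forall>w\<in>F \<union> F'. piv ^ k dvd e w"
    using bv_divisible[of "F \<union> F'" e k Y] F F' R_sub by blast
  then have "piv ^ k dvd e r" using r by blast
  moreover have "e r = of_nat N * f r" using r F(2) by (auto simp: e_def)
  ultimately have "piv ^ k dvd of_nat N * f r" by simp
  then show "\<exists>N::nat>0. (lv - 1) ^ k dvd of_nat N * f r" using N(1) unfolding piv_def by blast
qed

end

theorem theorem6p10:
  fixes Phi Delta :: "'n::finite vec set"
    and cor :: "'n vec \<Rightarrow> 'n vec"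
    and D :: "'n amap set"
    and sc :: "laurent \<Rightarrow> 'h::ring_1 \<Rightarrow> 'h"
    and T :: "'n amap \<Rightarrow> 'h"
    and R :: "'n amap set"
  assumes "reduced_root_datum Phi cor"
    and "root_base Phi Delta"
    and "diagram_aut_group Phi cor Delta D"
    and "is_hecke_algebra Phi cor Delta D sc T"
    and "R \<subseteq> ext_affine_weyl Phi cor D"
    and "\<forall>w\<in>ext_affine_weyl Phi cor D.
           \<exists>!r. r \<in> R \<and> conjugate_in (ext_affine_weyl Phi cor D) w r"
    and "\<forall>r\<in>R. \<forall>w\<in>ext_affine_weyl Phi cor D.
           conjugate_in (ext_affine_weyl Phi cor D) w r \<longrightarrow> wlen Phi Delta r \<le> wlen Phi Delta w"
  shows "module.span sc (T ` R \<union> commutator_span sc) = UNIV \<and>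
         (\<forall>F f. finite F \<longrightarrow> F \<subseteq> R \<longrightarrow> (\<Sum>r\<in>F. sc (f r) (T r)) \<in> commutator_span sc \<longrightarrow>
            (\<forall>r\<in>F. f r = 0))"
proof -
  interpret hecke_representatives Phi Delta cor D sc T R
    using assms(1-6) by unfold_locales auto
  show ?thesis
  proof (intro conjI allI impI ballI)
    show "module.span sc (T ` R \<union> commutator_span sc) = UNIV"
    proof (rule span_representatives[OF assms(5)])
      show "\<exists>r\<in>R. conjugate_in (ext_affine_weyl Phi cor D) w r" if "w \<in> ext_affine_weyl Phi cor D" for w
        using assms(6) that by blast
    qed (use assms(7) in blast)
    show "f r = 0" if "finite F" "F \<subseteq> R" "(\<Sum>r\<in>F. sc (f r) (T r)) \<in> commutator_span sc" "r \<in> F" for F f r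
      using representatives_independent[OF that] .
  qed
qed

end
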